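(* For every integer $m\ge 0$ the diagram formed by $\varphi_m:U^{(m)}(\mathcal G)\to U^{(m+1)}(\mathcal G)$, $\rho_m:U^{(m)}(\mathcal G)\to H^0(X,\mathcal D_X^{(m)})$, $\rho_{m+1}:U^{(m+1)}(\mathcal G)\to H^0(X,\mathcal D_X^{(m+1)})$ and $P\mapsto P'$, $H^0(X,\mathcal D_X^{(m)})\to H^0(X,\mathcal D_X^{(m+1)})$, is commutative, i.e. for all $u\in U^{(m)}(\mathcal G)$, $$\rho_{m+1}(\varphi_m(u))=(\rho_m(u))'.$$
   Context: Let $p>2$ be a prime, $k=\mathbb F_p$, $G=SL_2$ over $k$, $\mathcal G$ its Lie algebra with standard basis $(E,F,H)$, and $X=\mathbb P^1_k$ the flag variety of $G$, covered by the two standard affine lines $\mathrm{Spec}\,k[t]$ and $\mathrm{Spec}\,k[t']$, $t'=1/t$. Let $F:X\to X'$ be the relative Frobenius (since $k=\mathbb F_p$, $X'=X$ and $F^*$ raises functions to the $p$-th power). Distributions. $\mathrm{Dist}(G)=U(\mathcal G)$ is the algebra of distributions of $G$, identified with the reduction mod $p$ of the Kostant $\mathbb Z$-form of the enveloping algebra of $sl_2$, with $k$-basis $E^{[a]}\binom{H}{b}F^{[c]}$, where $E^{[n]}=E^n/n!$, $F^{[n]}=F^n/n!$, $\binom{H}{n}=H(H-1)\cdots(H-n+1)/n!$. $\mathrm{Dist}(G)_n$ is the subspace of distributions of order $\le n$ (spanned by the basis elements with $a+b+c\le n$), and $\epsilon_G$ is the unit of $\mathrm{Dist}(G)$. For $m\ge0$,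 $U^{(m)}(\mathcal G)$ is the quotient of the tensor algebra $\mathbb T_k(\mathrm{Dist}(G)_{2p^m-1})$ by the two-sided ideal generated by $\lambda-\lambda\epsilon_G$ ($\lambda\in k$), $\mu\otimes\mu'-\mu'\otimes\mu-[\mu,\mu']$ and $\mu''\otimes\mu-\mu''\mu$ for $\mu,\mu'\in\mathrm{Dist}(G)_{p^m}$, $\mu''\in\mathrm{Dist}(G)_{p^m-1}$. It is generated as an algebra by $E^{[i]},\binom{H}{i},F^{[i]}$, $0\le i\le p^m$. Put $\Delta_T:=\sum_{i=0}^{p-1}(-1)^i\binom{H}{i}$. The map $\varphi_m:U^{(m)}(\mathcal G)\to U^{(m+1)}(\mathcal G)$ is the (well-defined, non-unital) $k$-algebra morphism with $\varphi_m(1)=\Delta_T$ and $\varphi_m(E^{[i]})=E^{[ip]}\Delta_T$, $\varphi_m(F^{[i]})=F^{[ip]}\Delta_T$, $\varphi_m(\binom{H}{i})=\binom{H}{ip}\Delta_T$ for $0\le i\le p^m$. Differential operators. $\mathcal D_X=\bigcup_n\mathcal D_X^n$ is the sheaf of all (Grothendieck) differential operators on $X$ over $k$, filtered by order. $\mathcal D_X^{(m)}$ (Berthelot's differential operators of level $m$) is the sheaf of rings quotient of $\mathbb T_k(\mathcal D_X^{2p^m-1})$ by the two-sided ideal generated by $\lambda-\lambda 1_{O_X}$ ($\lambda\in k$), $D\otimes D'-D'\otimes D-[D,D']$, $D\otimes D''-DD''$ for $D,D'\in\mathcal D_X^{p^m}$, $D''\in\mathcal D_X^{p^m-1}$. If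 $\tau$ is a local coordinate with divided-power derivations $\partial_\tau^{[r]}=\partial_\tau^{r}/r!$, put $\partial_\tau^{\langle l\rangle_m}=\partial_\tau^{[r]}(\partial_\tau^{[p^m]})^q\in\mathcal D_X^{(m)}$ for $l=p^mq+r$, $0\le r<p^m$; these form a basis of $\mathcal D_X^{(m)}$ as a left $O_X$-module. Maps. The action of $G$ on $X$ defines the canonical algebra morphism $\rho:U(\mathcal G)\to H^0(X,\mathcal D_X)$, normalized by $E^{[n]}\mapsto\partial_t^{[n]}$, $F^{[n]}\mapsto\partial_{t'}^{[n]}$ (so $H\mapsto 2t'\partial_{t'}=-2t\partial_t$). It respects orders and so induces algebra morphisms $\rho_m:U^{(m)}(\mathcal G)\to H^0(X,\mathcal D_X^{(m)})$. The Dwork operator $\mathcal H\in H^0(X,\mathcal D_X^{(m+1)})$ is given on each standard chart, with $\tau=t$ or $\tau=t'$, by $\mathcal H=\sum_{r=0}^{p-1}(-\tau)^r\partial_\tau^{[r]}$. The map $P\mapsto P'$ (due to Garnier) is the (non-unital) ring morphism given on each standard chart by $\big(\sum_l f_l\,\partial_\tau^{\langle l\rangle_m}\big)'=\sum_l F^*(f_l)\,\partial_\tau^{\langle lp\rangle_{m+1}}\,\mathcal H$; in particular $(1)'=\mathcal H$ and $(\partial_\tau^{[n]})'=\partial_\tau^{[np]}\mathcal H=\sum_{r=0}^{p-1}(-\tau)^r\binom{np+r}{np}\partial_\tau^{[np+r]}$ for $0\le n\le p^m$. It satisfies $F^*(P\cdot f)=P'\cdot F^*f$ for local sections $f$ of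 $O_{X'}$, and the expressions on the two charts agree on the overlap, so it is defined on global sections. *)

theory Defs
  imports
    "HOL-Library.Cardinality"
    "HOL-Library.Poly_Mapping"
    "HOL-Computational_Algebra.Computational_Algebra"
    "HOL-Algebra.Algebra"
    "HOL-Algebra.Algebraic_Closure_Type"
begin

text \<open>
  Algebras over a field are \<open>module\<close> records of HOL-Algebra (a ring together with a
  scalar multiplication). The field \<open>k = F\<^sub>p\<close> is a finite type \<open>'k\<close> of class \<open>field\<close> whose
  cardinality \<open>CARD('k)\<close> is the prime \<open>p\<close>; the primality is a hypothesis of the theorem.
\<close>

section \<open>Morphisms, quotients and tensor algebras\<close>

text \<open>Ring and algebra morphisms that need not preserve the unit.\<close>

definition nonunital_ring_hom ::
  "('a, 'm) ring_scheme \<Rightarrow> ('b, 'n) ring_scheme \<Rightarrow> ('a \<Rightarrow> 'b) set" where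
  "nonunital_ring_hom R S =
    {h \<in> carrier R \<rightarrow> carrier S.
      \<forall>x\<in>carrier R. \<forall>y\<in>carrier R.
        h (x \<otimes>\<^bsub>R\<^esub> y) = h x \<otimes>\<^bsub>S\<^esub> h y \<and> h (x \<oplus>\<^bsub>R\<^esub> y) = h x \<oplus>\<^bsub>S\<^esub> h y}"

definition nonunital_alg_hom :: "('k, 'a) module \<Rightarrow> ('k, 'b) module \<Rightarrow> ('a \<Rightarrow> 'b) set" where
  "nonunital_alg_hom A B =
    {h \<in> nonunital_ring_hom A B. \<forall>c. \<forall>x\<in>carrier A. h (c \<odot>\<^bsub>A\<^esub> x) = c \<odot>\<^bsub>B\<^esub> h x}"

definition alg_hom :: "('k, 'a) module \<Rightarrow> ('k, 'b) module \<Rightarrow> ('a \<Rightarrow> 'b) set" where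
  "alg_hom A B = {h \<in> nonunital_alg_hom A B. h \<one>\<^bsub>A\<^esub> = \<one>\<^bsub>B\<^esub>}"

definition quot_alg :: "('k, 'a) module \<Rightarrow> 'a set \<Rightarrow> ('k, 'a set) module" where
  "quot_alg A I = ring.extend (A Quot I) (module.fields (\<lambda>c Y. \<Union>x\<in>Y. I +>\<^bsub>A\<^esub> (c \<odot>\<^bsub>A\<^esub> x)))"

definition lin_span :: "('k::field, 'a) module \<Rightarrow> 'a set \<Rightarrow> 'a set" where
  "lin_span M B = \<Inter>{N. submodule N (ring_of_type_algebra :: 'k ring) M \<and> B \<subseteq> N}"

text \<open>
  Words as an additively written monoid (addition is concatenation), so that
  \<open>'a word \<Rightarrow>\<^sub>0 'k\<close> with the convolution product of Poly_Mapping is the free associative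
  \<open>'k\<close>-algebra on \<open>'a\<close>.
\<close>

datatype 'a word = Word (letters: "'a list")

instantiation word :: (type) monoid_add
begin

definition zero_word :: "'a word" where "zero_word = Word []"

definition plus_word :: "'a word \<Rightarrow> 'a word \<Rightarrow> 'a word" where
  "plus_word u v = Word (letters u @ letters v)"

instance by standard (auto simp: zero_word_def plus_word_def)

end

definition free_const :: "'k \<Rightarrow> 'a word \<Rightarrow>\<^sub>0 'k::comm_ring_1" where
  "free_const c = Poly_Mapping.single 0 c"

definition letter :: "'a \<Rightarrow> 'a word \<Rightarrow>\<^sub>0 'k::comm_ring_1" where
  "letter x = Poly_Mapping.single (Word [x]) 1"

definition free_alg :: "'a set \<Rightarrow> ('k::comm_ring_1, 'a word \<Rightarrow>\<^sub>0 'k) module" where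
  "free_alg V = ring.extend
    (ring_of_type_algebra\<lparr>carrier := {f. \<forall>w\<in>Poly_Mapping.keys f. set (letters w) \<subseteq> V}\<rparr>)
    (module.fields (\<lambda>c f. free_const c * f))"

text \<open>
  The tensor algebra of the vector space \<open>M\<close> is the free algebra on the set \<open>carrier M\<close>
  modulo the linearity of the generators.
\<close>

definition linearity_rels :: "('k::comm_ring_1, 'a) module \<Rightarrow> ('a word \<Rightarrow>\<^sub>0 'k) set" where
  "linearity_rels M =
    {letter (x \<oplus>\<^bsub>M\<^esub> y) - letter x - letter y | x y. x \<in> carrier M \<and> y \<in> carrier M} \<union>
    {letter (c \<odot>\<^bsub>M\<^esub> x) - free_const c * letter x | c x. x \<in> carrier M}"

definition linearity_ideal :: "('k::comm_ring_1, 'a) module \<Rightarrow> ('a word \<Rightarrow>\<^sub>0 'k) set" where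
  "linearity_ideal M = genideal (free_alg (carrier M)) (linearity_rels M)"

definition tensor_alg :: "('k::comm_ring_1, 'a) module \<Rightarrow> ('k, ('a word \<Rightarrow>\<^sub>0 'k) set) module" where
  "tensor_alg M = quot_alg (free_alg (carrier M)) (linearity_ideal M)"

definition tensor_class ::
  "('k::comm_ring_1, 'a) module \<Rightarrow> ('a word \<Rightarrow>\<^sub>0 'k) \<Rightarrow> ('a word \<Rightarrow>\<^sub>0 'k) set" where
  "tensor_class M f = linearity_ideal M +>\<^bsub>free_alg (carrier M)\<^esub> f"

definition tensor_gen :: "('k::comm_ring_1, 'a) module \<Rightarrow> 'a \<Rightarrow> ('a word \<Rightarrow>\<^sub>0 'k) set" where
  "tensor_gen M x = tensor_class M (letter x)"

text \<open>
  The construction common to \<open>U\<^sup>(\<^sup>m\<^sup>)\<close> and \<open>D\<^sup>(\<^sup>m\<^sup>)\<close>: \<open>A\<close> is an algebra filtered by the subspaces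
  \<open>S i\<close> and \<open>n = p\<^sup>m\<close>. The tensor algebra of \<open>S (2 n - 1)\<close> is divided by the two-sided ideal
  that identifies the two kinds of scalars, identifies the commutators of elements of \<open>S n\<close>
  with those of \<open>A\<close>, and identifies \<open>a \<otimes> b\<close> with the product \<open>a b\<close> for the pairs
  \<open>(a, b) \<in> Q\<close>.
\<close>

definition level_space :: "('k, 'a) module \<Rightarrow> (nat \<Rightarrow> 'a set) \<Rightarrow> nat \<Rightarrow> ('k, 'a) module" where
  "level_space A S n = A\<lparr>carrier := S (2 * n - 1)\<rparr>"

definition level_rels ::
  "('k::comm_ring_1, 'a) module \<Rightarrow> (nat \<Rightarrow> 'a set) \<Rightarrow> nat \<Rightarrow> ('a \<times> 'a) set
    \<Rightarrow> ('a word \<Rightarrow>\<^sub>0 'k) set set" where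
  "level_rels A S n Q =
    (let T = tensor_alg (level_space A S n); g = tensor_gen (level_space A S n) in
      {(c \<odot>\<^bsub>T\<^esub> \<one>\<^bsub>T\<^esub>) \<ominus>\<^bsub>T\<^esub> g (c \<odot>\<^bsub>A\<^esub> \<one>\<^bsub>A\<^esub>) | c. True} \<union>
      {((g a \<otimes>\<^bsub>T\<^esub> g b) \<ominus>\<^bsub>T\<^esub> (g b \<otimes>\<^bsub>T\<^esub> g a)) \<ominus>\<^bsub>T\<^esub> g ((a \<otimes>\<^bsub>A\<^esub> b) \<ominus>\<^bsub>A\<^esub> (b \<otimes>\<^bsub>A\<^esub> a)) | a b.
        a \<in> S n \<and> b \<in> S n} \<union>
      {(g a \<otimes>\<^bsub>T\<^esub> g b) \<ominus>\<^bsub>T\<^esub> g (a \<otimes>\<^bsub>A\<^esub> b) | a b. (a, b) \<in> Q})"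

definition level_ideal ::
  "('k::comm_ring_1, 'a) module \<Rightarrow> (nat \<Rightarrow> 'a set) \<Rightarrow> nat \<Rightarrow> ('a \<times> 'a) set
    \<Rightarrow> ('a word \<Rightarrow>\<^sub>0 'k) set set" where
  "level_ideal A S n Q = genideal (tensor_alg (level_space A S n)) (level_rels A S n Q)"

definition level_alg ::
  "('k::comm_ring_1, 'a) module \<Rightarrow> (nat \<Rightarrow> 'a set) \<Rightarrow> nat \<Rightarrow> ('a \<times> 'a) set
    \<Rightarrow> ('k, ('a word \<Rightarrow>\<^sub>0 'k) set set) module" where
  "level_alg A S n Q = quot_alg (tensor_alg (level_space A S n)) (level_ideal A S n Q)"

definition level_class ::
  "('k::comm_ring_1, 'a) module \<Rightarrow> (nat \<Rightarrow> 'a set) \<Rightarrow> nat \<Rightarrow> ('a \<times> 'a) set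
    \<Rightarrow> ('a word \<Rightarrow>\<^sub>0 'k) \<Rightarrow> ('a word \<Rightarrow>\<^sub>0 'k) set set" where
  "level_class A S n Q f =
    level_ideal A S n Q +>\<^bsub>tensor_alg (level_space A S n)\<^esub> tensor_class (level_space A S n) f"


section \<open>Distributions\<close>

text \<open>
  The enveloping algebra of \<open>sl\<^sub>2\<close> over the rationals, by its presentation on the standard
  basis, and its Kostant form. The generators \<open>kost_H n\<close> of the latter are redundant.
\<close>

datatype sl2 = sl2_E | sl2_F | sl2_H

type_synonym sl2_free = "sl2 word \<Rightarrow>\<^sub>0 rat"

definition sl2_rels :: "sl2_free set" where
  "sl2_rels = (let E = letter sl2_E; F = letter sl2_F; H = letter sl2_H in
    {E * F - F * E - H, H * E - E * H - 2 * E, H * F - F * H + 2 * F})"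

definition env_ideal :: "sl2_free set" where
  "env_ideal = genideal (free_alg UNIV) sl2_rels"

definition env_alg :: "(rat, sl2_free set) module" where
  "env_alg = quot_alg (free_alg UNIV) env_ideal"

definition env_class :: "sl2_free \<Rightarrow> sl2_free set" where
  "env_class f = env_ideal +>\<^bsub>free_alg UNIV\<^esub> f"

definition kost_E :: "nat \<Rightarrow> sl2_free set" where
  "kost_E n = env_class (free_const (1 / fact n) * letter sl2_E ^ n)"

definition kost_F :: "nat \<Rightarrow> sl2_free set" where
  "kost_F n = env_class (free_const (1 / fact n) * letter sl2_F ^ n)"

definition kost_H :: "nat \<Rightarrow> sl2_free set" where
  "kost_H n = env_class
    (free_const (1 / fact n) * prod_list (map (\<lambda>i. letter sl2_H - of_nat i) [0..<n]))"

definition kostant :: "(rat, sl2_free set) module" where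
  "kostant = env_alg\<lparr>carrier := generate_ring env_alg (range kost_E \<union> range kost_F \<union> range kost_H)\<rparr>"

text \<open>
  Reduction modulo \<open>p\<close>. A scalar \<open>c\<close> of \<open>k = F\<^sub>p\<close> acts as any natural number representing it.
\<close>

definition dist_ideal :: "nat \<Rightarrow> sl2_free set set" where
  "dist_ideal p = {add_pow kostant p x | x. x \<in> carrier kostant}"

definition dist_alg :: "('k::{field,finite}, sl2_free set set) module" where
  "dist_alg = ring.extend (kostant Quot dist_ideal CARD('k))
    (module.fields (\<lambda>c Y. add_pow (kostant Quot dist_ideal CARD('k)) (SOME n::nat. of_nat n = c) Y))"

definition dist_class :: "'k::{field,finite} itself \<Rightarrow> sl2_free set \<Rightarrow> sl2_free set set" where
  "dist_class _ x = dist_ideal CARD('k) +>\<^bsub>kostant\<^esub> x"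

definition dist_E :: "'k::{field,finite} itself \<Rightarrow> nat \<Rightarrow> sl2_free set set" where
  "dist_E k n = dist_class k (kost_E n)"

definition dist_F :: "'k::{field,finite} itself \<Rightarrow> nat \<Rightarrow> sl2_free set set" where
  "dist_F k n = dist_class k (kost_F n)"

definition dist_H :: "'k::{field,finite} itself \<Rightarrow> nat \<Rightarrow> sl2_free set set" where
  "dist_H k n = dist_class k (kost_H n)"

definition dist_filt :: "'k::{field,finite} itself \<Rightarrow> nat \<Rightarrow> sl2_free set set set" where
  "dist_filt k n = (let A = (dist_alg :: ('k, _) module) in
    lin_span A {dist_E k a \<otimes>\<^bsub>A\<^esub> dist_H k b \<otimes>\<^bsub>A\<^esub> dist_F k c | a b c. a + b + c \<le> n})"

definition U_pairs :: "'k::{field,finite} itself \<Rightarrow> nat \<Rightarrow> (sl2_free set set \<times> sl2_free set set) set" where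
  "U_pairs k m = dist_filt k (CARD('k) ^ m - 1) \<times> dist_filt k (CARD('k) ^ m)"

type_synonym 'k U_elem = "(sl2_free set set word \<Rightarrow>\<^sub>0 'k) set set"

definition U_alg :: "nat \<Rightarrow> ('k::{field,finite}, 'k U_elem) module" where
  "U_alg m = level_alg dist_alg (dist_filt TYPE('k)) (CARD('k) ^ m) (U_pairs TYPE('k) m)"

definition U_gen :: "nat \<Rightarrow> sl2_free set set \<Rightarrow> 'k::{field,finite} U_elem" where
  "U_gen m \<mu> = level_class dist_alg (dist_filt TYPE('k)) (CARD('k) ^ m) (U_pairs TYPE('k) m) (letter \<mu>)"

definition U_E :: "nat \<Rightarrow> nat \<Rightarrow> 'k::{field,finite} U_elem" where
  "U_E m i = U_gen m (dist_E TYPE('k) i)"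

definition U_F :: "nat \<Rightarrow> nat \<Rightarrow> 'k::{field,finite} U_elem" where
  "U_F m i = U_gen m (dist_F TYPE('k) i)"

definition U_H :: "nat \<Rightarrow> nat \<Rightarrow> 'k::{field,finite} U_elem" where
  "U_H m i = U_gen m (dist_H TYPE('k) i)"

definition Delta_T :: "nat \<Rightarrow> 'k::{field,finite} U_elem" where
  "Delta_T m = finsum (U_alg m) (\<lambda>i. ((-1) ^ i) \<odot>\<^bsub>U_alg m\<^esub> U_H m i) {..<CARD('k)}"


section \<open>The projective line\<close>

text \<open>
  The scheme \<open>P\<^sup>1\<close> is described inside its function field \<open>k(t)\<close>: a point is represented by
  its local ring, and the two affine lines \<open>Spec k[t]\<close> and \<open>Spec k[1/t]\<close> are thereby glued,
  since a point of the overlap has the same local ring in both. The topology has the standard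
  open sets \<open>D(h)\<close> of the two lines as a basis, and \<open>O(U)\<close> is the intersection of the local
  rings of the points of \<open>U\<close>. This is correct for nonempty \<open>U\<close> only, so empty open sets are
  excluded below wherever \<open>O(U)\<close> is used.
\<close>

type_synonym 'k ratfun = "'k poly fract"
type_synonym 'k point = "'k ratfun set"

definition const :: "'k::field \<Rightarrow> 'k ratfun" where
  "const c = to_fract [:c:]"

definition coord_t :: "'k::field ratfun" where
  "coord_t = to_fract [:0, 1:]"

definition coords :: "'k::field ratfun set" where
  "coords = {coord_t, inverse coord_t}"

definition eval_at :: "'k::field ratfun \<Rightarrow> 'k poly \<Rightarrow> 'k ratfun" where
  "eval_at \<tau> a = poly (map_poly const a) \<tau>"

definition chart_ring :: "'k::field ratfun \<Rightarrow> 'k ratfun set" where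
  "chart_ring \<tau> = range (eval_at \<tau>)"

definition chart :: "'k::field ratfun \<Rightarrow> 'k point set" where
  "chart \<tau> = {{a / b | a b. a \<in> chart_ring \<tau> \<and> b \<in> chart_ring \<tau> - P} | P.
    primeideal P (ring_of_type_algebra\<lparr>carrier := chart_ring \<tau>\<rparr>)}"

definition P1 :: "'k::field point set" where
  "P1 = (\<Union>\<tau>\<in>coords. chart \<tau>)"

definition basic_open :: "'k::field ratfun \<Rightarrow> 'k ratfun \<Rightarrow> 'k point set" where
  "basic_open \<tau> h = {x \<in> chart \<tau>. inverse h \<in> x}"

definition zariski_open :: "'k::field point set \<Rightarrow> bool" where
  "zariski_open U \<longleftrightarrow> U \<subseteq> P1 \<and>
    (\<forall>x\<in>U. \<exists>\<tau>\<in>coords. \<exists>h\<in>chart_ring \<tau>. h \<noteq> 0 \<and> x \<in> basic_open \<tau> h \<and> basic_open \<tau> h \<subseteq> U)"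

definition opens :: "'k::field point set \<Rightarrow> 'k point set set" where
  "opens U = {V. zariski_open V \<and> V \<noteq> {} \<and> V \<subseteq> U}"

definition regular :: "'k::field point set \<Rightarrow> 'k ratfun set" where
  "regular U = \<Inter>U"


section \<open>Differential operators\<close>

text \<open>
  As the restriction maps of \<open>O\<close> are inclusions of subrings of \<open>k(t)\<close>, whose union over the
  nonempty open subsets of \<open>U\<close> is \<open>k(t)\<close>, a \<open>k\<close>-linear endomorphism of the sheaf \<open>O\<close> on \<open>U\<close>
  is the same thing as a \<open>k\<close>-linear map \<open>k(t) \<Rightarrow> k(t)\<close> preserving \<open>O(V)\<close> for all nonempty open
  \<open>V \<subseteq> U\<close>.
\<close>

type_synonym 'k operator = "'k ratfun \<Rightarrow> 'k ratfun"

definition op_alg :: "('k::field, 'k operator) module" where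
  "op_alg =
    \<lparr>carrier = {P. (\<forall>f g. P (f + g) = P f + P g) \<and> (\<forall>c f. P (const c * f) = const c * P f)},
     monoid.mult = (\<circ>), one = id, ring.zero = (\<lambda>f. 0), add = (\<lambda>P Q f. P f + Q f),
     module.smult = (\<lambda>c P f. const c * P f)\<rparr>"

definition sheaf_endo :: "'k::field point set \<Rightarrow> 'k operator set" where
  "sheaf_endo U = {P \<in> carrier op_alg. \<forall>V\<in>opens U. P ` regular V \<subseteq> regular V}"

definition commut :: "'k::field operator \<Rightarrow> 'k ratfun \<Rightarrow> 'k operator" where
  "commut P f = (\<lambda>g. P (f * g) - f * P g)"

primrec diff_ops :: "nat \<Rightarrow> 'k::field point set \<Rightarrow> 'k operator set" where
  "diff_ops 0 U = {P \<in> sheaf_endo U. \<forall>V\<in>opens U. \<forall>f\<in>regular V. commut P f = (\<lambda>g. 0)}"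
| "diff_ops (Suc n) U = {P \<in> sheaf_endo U. \<forall>V\<in>opens U. \<forall>f\<in>regular V. commut P f \<in> diff_ops n V}"

definition D_sections :: "'k::field point set \<Rightarrow> ('k, 'k operator) module" where
  "D_sections U = op_alg\<lparr>carrier := (\<Union>n. diff_ops n U)\<rparr>"

text \<open>
  The divided-power derivations of \<open>k(t) = k(\<tau>)\<close>: the function \<open>hasse \<tau> r f\<close> is the
  coefficient of \<open>s\<^sup>r\<close> in the Taylor expansion \<open>f(\<tau> + s) \<in> k(t)[[s]]\<close>, hence \<open>hasse \<tau> r\<close> maps
  \<open>\<tau>\<^sup>j\<close> to \<open>j choose r\<close> times \<open>\<tau>\<^bsup>j - r\<^esup>\<close>.
\<close>

definition shift_at :: "'k::field ratfun \<Rightarrow> 'k poly \<Rightarrow> 'k ratfun fps" where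
  "shift_at \<tau> a = poly (map_poly (\<lambda>c. fps_const (const c)) a) (fps_const \<tau> + fps_X)"

definition taylor :: "'k::field ratfun \<Rightarrow> 'k ratfun \<Rightarrow> 'k ratfun fps" where
  "taylor \<tau> f = (THE h. \<exists>a b. eval_at \<tau> b \<noteq> 0 \<and> f = eval_at \<tau> a / eval_at \<tau> b \<and>
    h = shift_at \<tau> a * inverse (shift_at \<tau> b))"

definition hasse :: "'k::field ratfun \<Rightarrow> nat \<Rightarrow> 'k operator" where
  "hasse \<tau> r f = fps_nth (taylor \<tau> f) r"


section \<open>Differential operators of level m\<close>

text \<open>
  The construction of \<open>D\<^sup>(\<^sup>m\<^sup>)\<close> from the tensor algebra of \<open>D\<^bsup>2p^m - 1\<^esup>\<close> commutes with filtered
  colimits, so the stalk at \<open>x\<close> of the quotient presheaf is this construction applied to the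
  filtered stalk of the differential operators at \<open>x\<close>.
\<close>

definition stalk_filt :: "'k::field point \<Rightarrow> nat \<Rightarrow> 'k operator set" where
  "stalk_filt x n = \<Union>{diff_ops n V | V. zariski_open V \<and> x \<in> V}"

definition D_pairs :: "nat \<Rightarrow> 'k::{field,finite} point \<Rightarrow> ('k operator \<times> 'k operator) set" where
  "D_pairs m x = stalk_filt x (CARD('k) ^ m) \<times> stalk_filt x (CARD('k) ^ m - 1)"

type_synonym 'k D_germ = "('k operator word \<Rightarrow>\<^sub>0 'k) set set"

definition Dm_stalk :: "nat \<Rightarrow> 'k::{field,finite} point \<Rightarrow> ('k, 'k D_germ) module" where
  "Dm_stalk m x = level_alg op_alg (stalk_filt x) (CARD('k) ^ m) (D_pairs m x)"

definition Dm_germ :: "nat \<Rightarrow> 'k::{field,finite} point \<Rightarrow> ('k operator word \<Rightarrow>\<^sub>0 'k) \<Rightarrow> 'k D_germ" where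
  "Dm_germ m x a = level_class op_alg (stalk_filt x) (CARD('k) ^ m) (D_pairs m x) a"

text \<open>
  Sections over \<open>U\<close> of the associated sheaf: families of germs that are locally given by a
  section of the presheaf of tensor algebras. The ring structure is pointwise.
\<close>

definition Dm_sections :: "nat \<Rightarrow> 'k::{field,finite} point set \<Rightarrow> ('k, 'k point \<Rightarrow> 'k D_germ) module" where
  "Dm_sections m U =
    \<lparr>carrier = {s \<in> extensional U. \<forall>x\<in>U. \<exists>V\<in>opens U. x \<in> V \<and>
       (\<exists>a \<in> carrier (free_alg (diff_ops (2 * CARD('k) ^ m - 1) V)). \<forall>y\<in>V. s y = Dm_germ m y a)},
     monoid.mult = (\<lambda>s s'. \<lambda>x\<in>U. s x \<otimes>\<^bsub>Dm_stalk m x\<^esub> s' x),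
     one = (\<lambda>x\<in>U. \<one>\<^bsub>Dm_stalk m x\<^esub>),
     ring.zero = (\<lambda>x\<in>U. \<zero>\<^bsub>Dm_stalk m x\<^esub>),
     add = (\<lambda>s s'. \<lambda>x\<in>U. s x \<oplus>\<^bsub>Dm_stalk m x\<^esub> s' x),
     module.smult = (\<lambda>c s. \<lambda>x\<in>U. c \<odot>\<^bsub>Dm_stalk m x\<^esub> s x)\<rparr>"

text \<open>
  The section of \<open>D\<^sup>(\<^sup>m\<^sup>)\<close> over \<open>U\<close> defined by a differential operator of order at most
  \<open>2 p\<^sup>m - 1\<close> on \<open>U\<close>.
\<close>

definition Dm_of :: "nat \<Rightarrow> 'k::{field,finite} point set \<Rightarrow> 'k operator \<Rightarrow> ('k point \<Rightarrow> 'k D_germ)" where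
  "Dm_of m U P = (\<lambda>x\<in>U. Dm_germ m x (letter P))"

definition Dm_fun :: "nat \<Rightarrow> 'k::{field,finite} point set \<Rightarrow> 'k ratfun \<Rightarrow> ('k point \<Rightarrow> 'k D_germ)" where
  "Dm_fun m U f = Dm_of m U (\<lambda>g. f * g)"

definition Dm_partial :: "nat \<Rightarrow> 'k::{field,finite} ratfun \<Rightarrow> nat \<Rightarrow> ('k point \<Rightarrow> 'k D_germ)" where
  "Dm_partial m \<tau> l = (let q = CARD('k) ^ m; A = Dm_sections m (chart \<tau>) in
    Dm_of m (chart \<tau>) (hasse \<tau> (l mod q)) \<otimes>\<^bsub>A\<^esub>
    (Dm_of m (chart \<tau>) (hasse \<tau> q) [^]\<^bsub>A\<^esub> (l div q)))"

text \<open>The Dwork operator on the chart with coordinate \<open>\<tau>\<close>, as a section of level \<open>m\<close>.\<close>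

definition dwork :: "nat \<Rightarrow> 'k::{field,finite} ratfun \<Rightarrow> ('k point \<Rightarrow> 'k D_germ)" where
  "dwork m \<tau> = finsum (Dm_sections m (chart \<tau>))
    (\<lambda>r. Dm_of m (chart \<tau>) (\<lambda>g. (- \<tau>) ^ r * hasse \<tau> r g)) {..<CARD('k)}"

definition chart_expansion ::
  "nat \<Rightarrow> 'k::{field,finite} ratfun \<Rightarrow> nat \<Rightarrow> (nat \<Rightarrow> 'k ratfun) \<Rightarrow> ('k point \<Rightarrow> 'k D_germ)" where
  "chart_expansion m \<tau> N f = (let A = Dm_sections m (chart \<tau>) in
    finsum A (\<lambda>l. Dm_fun m (chart \<tau>) (f l) \<otimes>\<^bsub>A\<^esub> Dm_partial m \<tau> l) {..N})"

definition garnier_expansion ::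
  "nat \<Rightarrow> 'k::{field,finite} ratfun \<Rightarrow> nat \<Rightarrow> (nat \<Rightarrow> 'k ratfun) \<Rightarrow> ('k point \<Rightarrow> 'k D_germ)" where
  "garnier_expansion m \<tau> N f = (let A = Dm_sections (Suc m) (chart \<tau>) in
    finsum A (\<lambda>l. Dm_fun (Suc m) (chart \<tau>) (f l ^ CARD('k)) \<otimes>\<^bsub>A\<^esub>
      Dm_partial (Suc m) \<tau> (l * CARD('k)) \<otimes>\<^bsub>A\<^esub> dwork (Suc m) \<tau>) {..N})"


section \<open>The four maps of the diagram\<close>

text \<open>
  Each predicate determines its map uniquely on the source algebra: \<open>dist_alg\<close> and \<open>U_alg m\<close> are
  generated by the elements on which the values are prescribed, and every section of \<open>D\<^sup>(\<^sup>m\<^sup>)\<close>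
  has an expansion on each of the two charts.
\<close>

definition is_rho :: "(sl2_free set set \<Rightarrow> 'k::{field,finite} operator) \<Rightarrow> bool" where
  "is_rho \<rho> \<longleftrightarrow> \<rho> \<in> alg_hom dist_alg (D_sections P1) \<and>
    (\<forall>n. \<rho> (dist_E TYPE('k) n) = hasse coord_t n \<and>
         \<rho> (dist_F TYPE('k) n) = hasse (inverse coord_t) n)"

definition is_rho_level ::
  "(sl2_free set set \<Rightarrow> 'k::{field,finite} operator) \<Rightarrow> nat
    \<Rightarrow> ('k U_elem \<Rightarrow> 'k point \<Rightarrow> 'k D_germ) \<Rightarrow> bool" where
  "is_rho_level \<rho> m \<rho>m \<longleftrightarrow> \<rho>m \<in> alg_hom (U_alg m) (Dm_sections m P1) \<and>
    (\<forall>\<mu>\<in>dist_filt TYPE('k) (2 * CARD('k) ^ m - 1). \<rho>m (U_gen m \<mu>) = Dm_of m P1 (\<rho> \<mu>))"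

definition is_phi :: "nat \<Rightarrow> ('k::{field,finite} U_elem \<Rightarrow> 'k U_elem) \<Rightarrow> bool" where
  "is_phi m \<phi> \<longleftrightarrow> (let A = U_alg m; B = U_alg (Suc m); p = CARD('k); \<Delta> = Delta_T (Suc m) in
    \<phi> \<in> nonunital_alg_hom A B \<and> \<phi> \<one>\<^bsub>A\<^esub> = \<Delta> \<and>
    (\<forall>i\<le>p ^ m.
      \<phi> (U_E m i) = U_E (Suc m) (i * p) \<otimes>\<^bsub>B\<^esub> \<Delta> \<and>
      \<phi> (U_F m i) = U_F (Suc m) (i * p) \<otimes>\<^bsub>B\<^esub> \<Delta> \<and>
      \<phi> (U_H m i) = U_H (Suc m) (i * p) \<otimes>\<^bsub>B\<^esub> \<Delta>))"

definition is_garnier ::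
  "nat \<Rightarrow> (('k::{field,finite} point \<Rightarrow> 'k D_germ) \<Rightarrow> ('k point \<Rightarrow> 'k D_germ)) \<Rightarrow> bool" where
  "is_garnier m \<gamma> \<longleftrightarrow> \<gamma> \<in> nonunital_ring_hom (Dm_sections m P1) (Dm_sections (Suc m) P1) \<and>
    (\<forall>P\<in>carrier (Dm_sections m P1). \<forall>\<tau>\<in>coords. \<forall>N f.
      (\<forall>l\<le>N. f l \<in> chart_ring \<tau>) \<longrightarrow>
      restrict P (chart \<tau>) = chart_expansion m \<tau> N f \<longrightarrow>
      restrict (\<gamma> P) (chart \<tau>) = garnier_expansion m \<tau> N f)"

end

theory Submission
  imports Defs
begin

text \<open>
  The elements \<open>E^[i]\<close> and \<open>F^[i]\<close> with \<open>i \<le> p^m\<close> generate \<open>U^(m)\<close>, so the diagram need only be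
  checked on them. The Dwork operator is the projection of \<open>k(t)\<close> onto \<open>k(t)^p\<close> that kills
  \<open>t^j g^p\<close> for \<open>0 < j < p\<close>; this description is the same in both charts, and \<open>\<rho>(\<Delta>\<^sub>T)\<close> satisfies
  it because \<open>H\<close> acts on \<open>t^j g^p\<close> by \<open>-2 j\<close>. As Taylor expansion is a ring morphism, taking
  \<open>p\<close>-th powers gives \<open>\<partial>^[np] (g^p) = (\<partial>^[n] g)^p\<close>. Hence both ways around the diagram send
  \<open>E^[i]\<close> to the operator \<open>g \<mapsto> (\<partial>^[i] h)^p\<close>, where \<open>h^p\<close> is the projection of \<open>g\<close>, and likewise
  for \<open>F^[i]\<close>. All these operators have order below \<open>2 p^(m+1)\<close>, so the relations of
  \<open>D^(m+1)\<close> turn the identity of operators into one of sections.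
\<close>

section \<open>Associative algebras, quotients and tensor algebras\<close>

text \<open>The algebras of level m are known only through generators and relations, and with q =
  p^m these replace a product of two generators by a single generator only when one factor has order
  at most q and the other at most q - 1; two factors of order q can only be commuted. That the
  \<open>E^[i]\<close> and \<open>F^[i]\<close> with i \<le> q generate is therefore not formal. A
  Kostant monomial of order up to 2 q - 1 has to be cut into a piece of order q and a rest, and
  cutting divided powers costs binomial coefficients that must stay nonzero modulo p. The same
  restriction demands that commutators lose one order, both for distributions and for differential
  operators, since otherwise their values would not be generators. Divisions by integers are carried
  out over the rationals, and only the resulting integral identities are reduced modulo p. On the
  geometric side, the expansion of a divided power derivation in the other coordinate comes from
  substituting one Taylor series into another, and sections are compared germ by germ. The
  hypothesis p > 2 makes the eigenvalues -2 j nonzero for 0 < j < p.\<close>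

locale assoc_alg = ring A for A :: "('k::comm_ring_1, 'a) module" (structure) +
  assumes smult_closed [simp, intro]: "x \<in> carrier A \<Longrightarrow> c \<odot> x \<in> carrier A"
    and smult_l_distr: "x \<in> carrier A \<Longrightarrow> (c + d) \<odot> x = c \<odot> x \<oplus> d \<odot> x"
    and smult_r_distr: "x \<in> carrier A \<Longrightarrow> y \<in> carrier A \<Longrightarrow> c \<odot> (x \<oplus> y) = c \<odot> x \<oplus> c \<odot> y"
    and smult_assoc: "x \<in> carrier A \<Longrightarrow> (c * d) \<odot> x = c \<odot> (d \<odot> x)"
    and smult_one [simp]: "x \<in> carrier A \<Longrightarrow> 1 \<odot> x = x"
    and smult_mult: "x \<in> carrier A \<Longrightarrow> y \<in> carrier A \<Longrightarrow> c \<odot> (x \<otimes> y) = (c \<odot> x) \<otimes> y"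
begin

lemma smult_l_zero [simp]:
  assumes "x \<in> carrier A"
  shows "0 \<odot> x = \<zero>"
proof -
  have "0 \<odot> x \<oplus> 0 \<odot> x = 0 \<odot> x \<oplus> \<zero>"
    using smult_l_distr[OF assms, of 0 0] assms by simp
  then show ?thesis using add.l_cancel[of "0 \<odot> x" "0 \<odot> x" \<zero>] assms by simp
qed

lemma smult_minus_one:
  assumes "x \<in> carrier A"
  shows "(- 1) \<odot> x = \<ominus> x"
proof (rule minus_equality[symmetric])
  show "(- 1) \<odot> x \<oplus> x = \<zero>"
    using smult_l_distr[OF assms, of "-1" 1] assms by simp
qed (simp_all add: assms)

text \<open>An ideal is closed under multiplication by elements, and the scalar \<open>c\<close>
  acts as left multiplication by \<open>c\<close> times the unit.\<close>

lemma smult_in_ideal: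
  assumes "ideal I A" "x \<in> I"
  shows "c \<odot> x \<in> I"
proof -
  interpret I: ideal I A by fact
  have "x \<in> carrier A" using assms(2) I.a_Hcarr by simp
  then have "c \<odot> x = (c \<odot> \<one>) \<otimes> x" using smult_mult[of \<one> x c] by simp
  then show ?thesis using I.I_l_closed[OF assms(2)] by simp
qed

end

lemma quot_alg_simps:
  "carrier (quot_alg A I) = carrier (A Quot I)"
  "monoid.mult (quot_alg A I) = monoid.mult (A Quot I)"
  "one (quot_alg A I) = one (A Quot I)"
  "ring.zero (quot_alg A I) = ring.zero (A Quot I)"
  "add (quot_alg A I) = add (A Quot I)"
  "module.smult (quot_alg A I) = (\<lambda>c Y. \<Union>x\<in>Y. I +>\<^bsub>A\<^esub> (c \<odot>\<^bsub>A\<^esub> x))"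
  by (simp_all add: quot_alg_def ring.defs module.defs)

text \<open>A quotient algebra carries a scalar multiplication, so its record is not the factor ring
  itself. The ring axioms transfer because they see only the five fields compared here.\<close>

lemma ring_cong:
  assumes "ring R" "carrier S = carrier R" "monoid.mult S = monoid.mult R" "one S = one R"
    "ring.zero S = ring.zero R" "add S = add R"
  shows "ring S"
proof -
  interpret R: ring R by (rule assms(1))
  have "abelian_group S"
  proof (rule abelian_groupI, unfold assms(2-))
    fix x assume "x \<in> carrier R"
    then show "\<exists>y\<in>carrier R. y \<oplus>\<^bsub>R\<^esub> x = \<zero>\<^bsub>R\<^esub>"
      using R.l_neg R.a_inv_closed by blast
  qed (simp_all add: R.a_assoc R.a_comm R.a_lcomm)
  moreover have "Group.monoid S"
    by (rule monoidI, unfold assms(2-)) (simp_all add: R.m_assoc)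
  ultimately show ?thesis
    by (rule ringI, unfold assms(2-)) (simp_all add: R.l_distr R.r_distr)
qed

context assoc_alg begin

text \<open>The scalar multiplication of the quotient is a union over all representatives of a
  class. It is a single class because ideals are stable under scalars.\<close>

lemma quot_smult:
  assumes "ideal I A" "x \<in> carrier A"
  shows "c \<odot>\<^bsub>quot_alg A I\<^esub> (I +> x) = I +> (c \<odot> x)"
proof -
  interpret I: ideal I A by fact
  have *: "I +> (c \<odot> y) = I +> (c \<odot> x)" if y: "y \<in> I +> x" for y
  proof -
    obtain i where i: "i \<in> I" "y = i \<oplus> x" using y by (auto simp: a_r_coset_def')
    then have "c \<odot> y = c \<odot> i \<oplus> c \<odot> x" using assms(2) I.a_Hcarr by (simp add: smult_r_distr)
    moreover have "c \<odot> i \<in> I" using smult_in_ideal[OF assms(1) i(1)] .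
    moreover have "c \<odot> i \<oplus> c \<odot> x \<ominus> c \<odot> x = c \<odot> i"
      using i(1) I.a_Hcarr assms(2) by (simp add: a_minus_def a_assoc r_neg)
    ultimately show ?thesis
      using quotient_eq_iff_same_a_r_cos[OF assms(1), of "c \<odot> y" "c \<odot> x"] i(1) I.a_Hcarr assms(2) by simp
  qed
  have "I +> x \<noteq> {}" using I.a_rcos_self[OF assms(2)] by blast
  then show ?thesis unfolding quot_alg_simps by (rule SUP_eq_const) (rule *)
qed

lemma quot_proj:
  assumes "ideal I A"
  shows "x \<in> carrier A \<Longrightarrow> I +> x \<in> carrier (quot_alg A I)"
    and "x \<in> carrier A \<Longrightarrow> y \<in> carrier A \<Longrightarrow> (I +> x) \<oplus>\<^bsub>quot_alg A I\<^esub> (I +> y) = I +> (x \<oplus> y)"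
    and "x \<in> carrier A \<Longrightarrow> y \<in> carrier A \<Longrightarrow> (I +> x) \<otimes>\<^bsub>quot_alg A I\<^esub> (I +> y) = I +> (x \<otimes> y)"
    and "x \<in> carrier A \<Longrightarrow> c \<odot>\<^bsub>quot_alg A I\<^esub> (I +> x) = I +> (c \<odot> x)"
    and "\<one>\<^bsub>quot_alg A I\<^esub> = I +> \<one>"
    and "Y \<in> carrier (quot_alg A I) \<Longrightarrow> \<exists>x\<in>carrier A. Y = I +> x"
    and "x \<in> carrier A \<Longrightarrow> y \<in> carrier A \<Longrightarrow> x \<ominus> y \<in> I \<Longrightarrow> I +> x = I +> y"
proof -
  interpret I: ideal I A by fact
  show "x \<in> carrier A \<Longrightarrow> I +> x \<in> carrier (quot_alg A I)"
    by (auto simp: quot_alg_simps FactRing_def A_RCOSETS_def')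
  show "x \<in> carrier A \<Longrightarrow> y \<in> carrier A \<Longrightarrow> (I +> x) \<oplus>\<^bsub>quot_alg A I\<^esub> (I +> y) = I +> (x \<oplus> y)"
    "x \<in> carrier A \<Longrightarrow> y \<in> carrier A \<Longrightarrow> (I +> x) \<otimes>\<^bsub>quot_alg A I\<^esub> (I +> y) = I +> (x \<otimes> y)"
    "\<one>\<^bsub>quot_alg A I\<^esub> = I +> \<one>"
    using I.rcos_ring_hom by (auto simp: quot_alg_simps ring_hom_def)
  show "x \<in> carrier A \<Longrightarrow> c \<odot>\<^bsub>quot_alg A I\<^esub> (I +> x) = I +> (c \<odot> x)"
    by (rule quot_smult[OF assms])
  show "Y \<in> carrier (quot_alg A I) \<Longrightarrow> \<exists>x\<in>carrier A. Y = I +> x"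
    by (auto simp: quot_alg_simps FactRing_def A_RCOSETS_def')
  show "x \<in> carrier A \<Longrightarrow> y \<in> carrier A \<Longrightarrow> x \<ominus> y \<in> I \<Longrightarrow> I +> x = I +> y"
    using quotient_eq_iff_same_a_r_cos[OF assms] by simp
qed

lemma quot_assoc_alg:
  assumes "ideal I A"
  shows "assoc_alg (quot_alg A I)"
proof -
  interpret I: ideal I A by fact
  interpret Q: ring "quot_alg A I"
    by (rule ring_cong[OF I.quotient_is_ring]) (simp_all add: quot_alg_simps)
  note q = quot_proj[OF assms]
  show ?thesis
  proof unfold_locales
    fix Y c d assume "Y \<in> carrier (quot_alg A I)"
    then obtain x where x: "x \<in> carrier A" "Y = I +> x" using q(6) by blast
    show "c \<odot>\<^bsub>quot_alg A I\<^esub> Y \<in> carrier (quot_alg A I)"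
      by (simp add: q x)
    show "(c + d) \<odot>\<^bsub>quot_alg A I\<^esub> Y = c \<odot>\<^bsub>quot_alg A I\<^esub> Y \<oplus>\<^bsub>quot_alg A I\<^esub> d \<odot>\<^bsub>quot_alg A I\<^esub> Y"
      "(c * d) \<odot>\<^bsub>quot_alg A I\<^esub> Y = c \<odot>\<^bsub>quot_alg A I\<^esub> (d \<odot>\<^bsub>quot_alg A I\<^esub> Y)"
      "1 \<odot>\<^bsub>quot_alg A I\<^esub> Y = Y"
      by (simp_all add: q x smult_l_distr smult_assoc)
  next
    fix Y Z c assume "Y \<in> carrier (quot_alg A I)" "Z \<in> carrier (quot_alg A I)"
    then obtain x y where x: "x \<in> carrier A" "Y = I +> x" and y: "y \<in> carrier A" "Z = I +> y"
      using q(6) by blast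
    show "c \<odot>\<^bsub>quot_alg A I\<^esub> (Y \<oplus>\<^bsub>quot_alg A I\<^esub> Z) = c \<odot>\<^bsub>quot_alg A I\<^esub> Y \<oplus>\<^bsub>quot_alg A I\<^esub> c \<odot>\<^bsub>quot_alg A I\<^esub> Z"
      "c \<odot>\<^bsub>quot_alg A I\<^esub> (Y \<otimes>\<^bsub>quot_alg A I\<^esub> Z) = (c \<odot>\<^bsub>quot_alg A I\<^esub> Y) \<otimes>\<^bsub>quot_alg A I\<^esub> Z"
      using x y by (simp_all add: q smult_r_distr smult_mult)
  qed
qed

end

lemma free_alg_simps:
  "carrier (free_alg V) = {f. \<forall>w\<in>Poly_Mapping.keys f. set (letters w) \<subseteq> V}"
  "f \<otimes>\<^bsub>free_alg V\<^esub> g = f * g"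
  "f \<oplus>\<^bsub>free_alg V\<^esub> g = f + g"
  "\<one>\<^bsub>free_alg V\<^esub> = 1"
  "\<zero>\<^bsub>free_alg V\<^esub> = 0"
  "c \<odot>\<^bsub>free_alg V\<^esub> f = free_const c * f"
  by (simp_all add: free_alg_def ring.defs module.defs ring_of_type_algebra_def)

lemma free_const_simps:
  "free_const (c + d) = free_const c + free_const d"
  "free_const (c * d) = free_const c * free_const d"
  "free_const 1 = 1" "free_const 0 = 0"
  by (simp_all add: free_const_def single_add mult_single)

lemma letters_plus [simp]: "letters (u + v) = letters u @ letters v"
  by (simp add: plus_word_def)

lemma letters_zero [simp]: "letters 0 = []"
  by (simp add: zero_word_def)

lemma free_alg_carrier_closed:
  fixes f g :: "'a word \<Rightarrow>\<^sub>0 'k::comm_ring_1"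
  assumes "f \<in> carrier (free_alg V)" "g \<in> carrier (free_alg V)"
  shows "f + g \<in> carrier (free_alg V)" "f * g \<in> carrier (free_alg V)" "- f \<in> carrier (free_alg V)"
    "f - g \<in> carrier (free_alg V)"
proof -
  have *: "f + h \<in> carrier (free_alg V)" if "h \<in> carrier (free_alg V)" for h :: "'a word \<Rightarrow>\<^sub>0 'k"
    using assms that Poly_Mapping.keys_add[of f h] by (force simp: free_alg_simps)
  have **: "- h \<in> carrier (free_alg V)" if "h \<in> carrier (free_alg V)" for h :: "'a word \<Rightarrow>\<^sub>0 'k"
    using that by (simp add: free_alg_simps)
  show "f + g \<in> carrier (free_alg V)" by (rule *[OF assms(2)])
  show "- f \<in> carrier (free_alg V)" by (rule **[OF assms(1)])
  show "f - g \<in> carrier (free_alg V)" using *[OF **[OF assms(2)]] by simp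
  have "set (letters w) \<subseteq> V" if w: "w \<in> Poly_Mapping.keys (f * g)" for w
  proof -
    obtain u v where "w = u + v" "u \<in> Poly_Mapping.keys f" "v \<in> Poly_Mapping.keys g"
      using w keys_mult[of f g] by blast
    then show ?thesis using assms by (simp add: free_alg_simps)
  qed
  then show "f * g \<in> carrier (free_alg V)" by (simp add: free_alg_simps)
qed

lemma free_const_in_carrier [simp]: "free_const c \<in> carrier (free_alg V)"
  by (auto simp: free_alg_simps free_const_def)

lemma letter_in_carrier: "x \<in> V \<Longrightarrow> letter x \<in> carrier (free_alg V)"
  by (auto simp: free_alg_simps letter_def)

lemma one_zero_in_free_alg [simp]: "1 \<in> carrier (free_alg V)" "0 \<in> carrier (free_alg V)"
  using free_const_in_carrier[of 1 V] free_const_in_carrier[of 0 V] by (simp_all add: free_const_simps)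

lemma free_assoc_alg: "assoc_alg (free_alg V :: ('k::comm_ring_1, 'a word \<Rightarrow>\<^sub>0 'k) module)"
proof -
  have r: "ring (free_alg V :: ('k, 'a word \<Rightarrow>\<^sub>0 'k) module)"
  proof (rule ringI)
    show "abelian_group (free_alg V :: ('k, 'a word \<Rightarrow>\<^sub>0 'k) module)"
    proof (rule abelian_groupI)
      fix f :: "'a word \<Rightarrow>\<^sub>0 'k" assume "f \<in> carrier (free_alg V)"
      then show "\<exists>g\<in>carrier (free_alg V). g \<oplus>\<^bsub>free_alg V\<^esub> f = \<zero>\<^bsub>free_alg V\<^esub>"
        using free_alg_carrier_closed(3) by (intro bexI[of _ "- f"]) (simp_all add: free_alg_simps(2-))
    qed (simp_all add: free_alg_simps(2-) free_alg_carrier_closed ac_simps)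
    show "Group.monoid (free_alg V :: ('k, 'a word \<Rightarrow>\<^sub>0 'k) module)"
      by (rule monoidI) (auto simp: free_alg_simps(2-) free_alg_carrier_closed algebra_simps)
  qed (auto simp: free_alg_simps(2-) algebra_simps)
  show ?thesis
    by (intro assoc_alg.intro r assoc_alg_axioms.intro)
      (auto simp: free_alg_simps(2-) free_const_simps free_alg_carrier_closed algebra_simps)
qed

lemma free_alg_a_inv: "f \<in> carrier (free_alg V) \<Longrightarrow> \<ominus>\<^bsub>free_alg V\<^esub> f = - f"
proof -
  interpret assoc_alg "free_alg V" by (rule free_assoc_alg)
  assume "f \<in> carrier (free_alg V)"
  then show ?thesis using minus_equality[of "- f" f]
    by (simp add: free_alg_simps(2-) free_alg_carrier_closed)
qed

lemma free_alg_minus: "f \<in> carrier (free_alg V) \<Longrightarrow> g \<in> carrier (free_alg V) \<Longrightarrow> f \<ominus>\<^bsub>free_alg V\<^esub> g = f - g"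
  by (simp add: a_minus_def free_alg_a_inv free_alg_simps(2-))

text \<open>An element is the finite sum of its monomials, and a monomial is a constant times a
  product of letters. Membership in the carrier is proved alongside, as the rules for sums and
  products ask for it.\<close>

lemma free_alg_induct [consumes 1, case_names const letter add mult]:
  fixes f :: "'a word \<Rightarrow>\<^sub>0 'k::comm_ring_1"
  assumes f: "f \<in> carrier (free_alg V)"
    and const: "\<And>c. P (free_const c)"
    and letter: "\<And>x. x \<in> V \<Longrightarrow> P (letter x)"
    and add: "\<And>f g. f \<in> carrier (free_alg V) \<Longrightarrow> g \<in> carrier (free_alg V) \<Longrightarrow> P f \<Longrightarrow> P g \<Longrightarrow> P (f + g)"
    and mult: "\<And>f g. f \<in> carrier (free_alg V) \<Longrightarrow> g \<in> carrier (free_alg V) \<Longrightarrow> P f \<Longrightarrow> P g \<Longrightarrow> P (f * g)"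
  shows "P f"
proof -
  have wd: "P (Poly_Mapping.single (Word xs) 1) \<and> Poly_Mapping.single (Word xs) (1::'k) \<in> carrier (free_alg V)"
    if "set xs \<subseteq> V" for xs
    using that
  proof (induction xs)
    case Nil
    show ?case using const[of 1] free_const_in_carrier[of 1 V] by (simp add: free_const_def zero_word_def)
  next
    case (Cons x xs)
    have "Poly_Mapping.single (Word (x # xs)) 1 = letter x * Poly_Mapping.single (Word xs) (1::'k)"
      by (simp add: letter_def mult_single plus_word_def)
    moreover have "x \<in> V" "set xs \<subseteq> V" using Cons.prems by auto
    ultimately show ?case
      using Cons.IH mult[OF letter_in_carrier _ letter] free_alg_carrier_closed(2)[OF letter_in_carrier] by metis
  qed
  have sg: "P (Poly_Mapping.single w c) \<and> Poly_Mapping.single w c \<in> carrier (free_alg V)"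
    if "set (letters w) \<subseteq> V" for w and c :: 'k
  proof -
    have "Poly_Mapping.single w c = free_const c * Poly_Mapping.single (Word (letters w)) 1"
      by (simp add: free_const_def mult_single)
    then show ?thesis
      using wd[OF that] mult[OF free_const_in_carrier _ const] free_alg_carrier_closed(2)[OF free_const_in_carrier]
      by metis
  qed
  have "P (\<Sum>w\<in>W. Poly_Mapping.single w (Poly_Mapping.lookup f w)) \<and> (\<Sum>w\<in>W. Poly_Mapping.single w (Poly_Mapping.lookup f w)) \<in> carrier (free_alg V)"
    if "finite W" "W \<subseteq> Poly_Mapping.keys f" for W
    using that
  proof (induction W)
    case empty
    show ?case using const[of 0] by (simp add: free_const_simps)
  next
    case (insert w W)
    have "set (letters w) \<subseteq> V" using f insert by (auto simp: free_alg_simps)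
    then show ?case using insert sg[of w "Poly_Mapping.lookup f w"] add free_alg_carrier_closed(1)
      by (metis (no_types, lifting) insert_subset sum.insert)
  qed
  from this[OF _ subset_refl] have "P (\<Sum>w\<in>Poly_Mapping.keys f. Poly_Mapping.single w (Poly_Mapping.lookup f w))"
    by simp
  moreover have "(\<Sum>w\<in>Poly_Mapping.keys f. Poly_Mapping.single w (Poly_Mapping.lookup f w)) = f"
    by (rule poly_mapping_eqI) (simp add: lookup_sum lookup_single when_def in_keys_iff)
  ultimately show ?thesis by simp
qed


section \<open>The algebra of level m attached to a filtered algebra\<close>

text \<open>Shared by \<open>U^(m)\<close> and by the stalks of \<open>D^(m)\<close>. The
  assumptions say that the defining relations can be written in the tensor algebra of
  \<open>S (2 * n - 1)\<close>. The bound for commutators of two elements of \<open>S n\<close> is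
  the one with content: the filtration has to drop by one.\<close>

locale level_data =
  fixes A :: "('k::comm_ring_1, 'a) module" (structure)
    and S :: "nat \<Rightarrow> 'a set" and n :: nat and Q :: "('a \<times> 'a) set"
  assumes S_add: "x \<in> S (2 * n - 1) \<Longrightarrow> y \<in> S (2 * n - 1) \<Longrightarrow> x \<oplus> y \<in> S (2 * n - 1)"
    and S_smult: "x \<in> S (2 * n - 1) \<Longrightarrow> c \<odot> x \<in> S (2 * n - 1)"
    and S_one: "\<one> \<in> S (2 * n - 1)"
    and S_n: "x \<in> S n \<Longrightarrow> x \<in> S (2 * n - 1)"
    and S_commutator: "x \<in> S n \<Longrightarrow> y \<in> S n \<Longrightarrow> (x \<otimes> y) \<ominus> (y \<otimes> x) \<in> S (2 * n - 1)"
    and S_Q: "(x, y) \<in> Q \<Longrightarrow> x \<in> S (2 * n - 1) \<and> y \<in> S (2 * n - 1) \<and> x \<otimes> y \<in> S (2 * n - 1)"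
begin

text \<open>Keeps the simplifier from turning the recurring bound \<open>2 * n - 1\<close> into
  \<open>2 * n - Suc 0\<close>.\<close>

declare One_nat_def [simp del]

abbreviation "V \<equiv> level_space A S n"
abbreviation "F \<equiv> free_alg (S (2 * n - 1)) :: ('k, 'a word \<Rightarrow>\<^sub>0 'k) module"
abbreviation "T \<equiv> tensor_alg V"
abbreviation "U \<equiv> level_alg A S n Q"
abbreviation "cls \<equiv> level_class A S n Q"
abbreviation "gen a \<equiv> level_class A S n Q (letter a)"

lemma carrier_V [simp]: "carrier V = S (2 * n - 1)"
  by (simp add: level_space_def)

lemma V_simps [simp]: "x \<oplus>\<^bsub>V\<^esub> y = x \<oplus> y" "c \<odot>\<^bsub>V\<^esub> x = c \<odot> x"
  by (simp_all add: level_space_def)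

sublocale F: assoc_alg F by (rule free_assoc_alg)

lemma linearity_rels_subset: "linearity_rels V \<subseteq> carrier F"
  unfolding linearity_rels_def
  by (auto intro!: free_alg_carrier_closed letter_in_carrier free_const_in_carrier S_add S_smult)

lemma linearity_ideal: "ideal (linearity_ideal V) F"
  unfolding linearity_ideal_def carrier_V by (rule F.genideal_ideal[OF linearity_rels_subset])

lemma T_eq: "T = quot_alg F (linearity_ideal V)"
  by (simp add: tensor_alg_def)

sublocale T: assoc_alg T
  unfolding T_eq by (rule F.quot_assoc_alg[OF linearity_ideal])

lemma tensor_class_eq: "tensor_class V f = linearity_ideal V +>\<^bsub>F\<^esub> f"
  by (simp add: tensor_class_def)

lemma tensor_class_simps:
  assumes "f \<in> carrier F" "g \<in> carrier F"
  shows "tensor_class V f \<in> carrier T"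
    "tensor_class V f \<oplus>\<^bsub>T\<^esub> tensor_class V g = tensor_class V (f + g)"
    "tensor_class V f \<otimes>\<^bsub>T\<^esub> tensor_class V g = tensor_class V (f * g)"
    "c \<odot>\<^bsub>T\<^esub> tensor_class V f = tensor_class V (free_const c * f)"
  unfolding T_eq tensor_class_eq
  using F.quot_proj(1-4)[OF linearity_ideal] assms by (simp_all add: free_alg_simps(2-))

lemma tensor_one: "\<one>\<^bsub>T\<^esub> = tensor_class V 1"
  unfolding T_eq tensor_class_eq using F.quot_proj(5)[OF linearity_ideal] by (simp add: free_alg_simps(2-))

lemma tensor_surj: "y \<in> carrier T \<Longrightarrow> \<exists>f\<in>carrier F. y = tensor_class V f"
  unfolding T_eq tensor_class_eq by (rule F.quot_proj(6)[OF linearity_ideal])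

lemma tensor_gen_add:
  assumes "x \<in> S (2 * n - 1)" "y \<in> S (2 * n - 1)"
  shows "tensor_gen V (x \<oplus> y) = tensor_gen V x \<oplus>\<^bsub>T\<^esub> tensor_gen V y"
proof -
  have "letter (x \<oplus> y) - letter x - letter y \<in> linearity_ideal V"
    unfolding linearity_ideal_def carrier_V
    by (rule subsetD[OF F.genideal_self[OF linearity_rels_subset]])
      (use assms in \<open>auto simp: linearity_rels_def\<close>)
  then have "letter (x \<oplus> y) \<ominus>\<^bsub>F\<^esub> (letter x + letter y) \<in> linearity_ideal V"
    using assms by (subst free_alg_minus) (simp_all add: free_alg_carrier_closed letter_in_carrier S_add diff_diff_eq)
  then show ?thesis
    using assms F.quot_proj(7)[OF linearity_ideal, of "letter (x \<oplus> y)" "letter x + letter y"]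
      tensor_class_simps(2)[of "letter x" "letter y"]
    by (simp add: tensor_gen_def free_alg_carrier_closed letter_in_carrier S_add tensor_class_eq)
qed

lemma tensor_gen_smult:
  assumes "x \<in> S (2 * n - 1)"
  shows "tensor_gen V (c \<odot> x) = c \<odot>\<^bsub>T\<^esub> tensor_gen V x"
proof -
  have "letter (c \<odot> x) - free_const c * letter x \<in> linearity_ideal V"
    unfolding linearity_ideal_def carrier_V
    by (rule subsetD[OF F.genideal_self[OF linearity_rels_subset]])
      (use assms in \<open>auto simp: linearity_rels_def\<close>)
  then have "letter (c \<odot> x) \<ominus>\<^bsub>F\<^esub> (free_const c * letter x) \<in> linearity_ideal V"
    using assms by (subst free_alg_minus) (simp_all add: free_alg_carrier_closed letter_in_carrier S_smult)
  then show ?thesis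
    using assms F.quot_proj(7)[OF linearity_ideal, of "letter (c \<odot> x)" "free_const c * letter x"]
      tensor_class_simps(4)[of "letter x" "letter x" c]
    by (simp add: tensor_gen_def free_alg_carrier_closed letter_in_carrier S_smult tensor_class_eq)
qed

lemma tensor_gen_closed: "x \<in> S (2 * n - 1) \<Longrightarrow> tensor_gen V x \<in> carrier T"
  by (simp add: tensor_gen_def tensor_class_simps(1)[OF letter_in_carrier letter_in_carrier])

lemma level_rels_subset: "level_rels A S n Q \<subseteq> carrier T"
  unfolding level_rels_def Let_def
  by (auto intro!: tensor_gen_closed S_one S_smult dest: S_n S_Q intro: S_commutator)

lemma level_ideal: "ideal (level_ideal A S n Q) T"
  unfolding level_ideal_def by (rule T.genideal_ideal[OF level_rels_subset])

lemma level_rels_in_ideal: "x \<in> level_rels A S n Q \<Longrightarrow> x \<in> level_ideal A S n Q"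
  unfolding level_ideal_def using T.genideal_self[OF level_rels_subset] by blast

lemma U_eq: "U = quot_alg T (level_ideal A S n Q)"
  by (simp add: level_alg_def)

sublocale U: assoc_alg U
  unfolding U_eq by (rule T.quot_assoc_alg[OF level_ideal])

lemma cls_eq: "cls f = level_ideal A S n Q +>\<^bsub>T\<^esub> tensor_class V f"
  by (simp add: level_class_def)

lemma gen_eq: "gen a = level_ideal A S n Q +>\<^bsub>T\<^esub> tensor_gen V a"
  by (simp add: cls_eq tensor_gen_def)

lemma cls_simps:
  assumes "f \<in> carrier F" "g \<in> carrier F"
  shows "cls f \<in> carrier U"
    "cls f \<oplus>\<^bsub>U\<^esub> cls g = cls (f + g)"
    "cls f \<otimes>\<^bsub>U\<^esub> cls g = cls (f * g)"
    "c \<odot>\<^bsub>U\<^esub> cls f = cls (free_const c * f)"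
  unfolding U_eq cls_eq
  using T.quot_proj(1-4)[OF level_ideal] assms by (simp_all add: tensor_class_simps)

lemma cls_one: "cls 1 = \<one>\<^bsub>U\<^esub>"
  unfolding U_eq cls_eq using T.quot_proj(5)[OF level_ideal] by (simp add: tensor_one)

lemma cls_surj: "y \<in> carrier U \<Longrightarrow> \<exists>f\<in>carrier F. y = cls f"
  unfolding U_eq cls_eq using T.quot_proj(6)[OF level_ideal] tensor_surj by blast

lemma cls_const: "cls (free_const c) = c \<odot>\<^bsub>U\<^esub> \<one>\<^bsub>U\<^esub>"
  using cls_simps(4)[of 1 1 c] by (simp add: cls_one)

lemma gen_closed [simp]: "a \<in> S (2 * n - 1) \<Longrightarrow> gen a \<in> carrier U"
  by (rule cls_simps(1)[OF letter_in_carrier letter_in_carrier])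

lemma gen_add: "a \<in> S (2 * n - 1) \<Longrightarrow> b \<in> S (2 * n - 1) \<Longrightarrow> gen (a \<oplus> b) = gen a \<oplus>\<^bsub>U\<^esub> gen b"
  unfolding U_eq gen_eq using T.quot_proj(2)[OF level_ideal] by (simp add: tensor_gen_add tensor_gen_closed)

lemma gen_smult: "a \<in> S (2 * n - 1) \<Longrightarrow> gen (c \<odot> a) = c \<odot>\<^bsub>U\<^esub> gen a"
  unfolding U_eq gen_eq using T.quot_proj(4)[OF level_ideal] by (simp add: tensor_gen_smult tensor_gen_closed)

lemma T_diff_in_ideal:
  assumes "x \<ominus>\<^bsub>T\<^esub> y \<in> level_rels A S n Q" "x \<in> carrier T" "y \<in> carrier T"
  shows "level_ideal A S n Q +>\<^bsub>T\<^esub> x = level_ideal A S n Q +>\<^bsub>T\<^esub> y"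
  by (rule T.quot_proj(7)[OF level_ideal assms(2,3) level_rels_in_ideal[OF assms(1)]])

lemma gen_one: "gen (c \<odot> \<one>) = c \<odot>\<^bsub>U\<^esub> \<one>\<^bsub>U\<^esub>"
proof -
  have "level_ideal A S n Q +>\<^bsub>T\<^esub> (c \<odot>\<^bsub>T\<^esub> \<one>\<^bsub>T\<^esub>) = gen (c \<odot> \<one>)"
    unfolding gen_eq
    by (rule T_diff_in_ideal) (auto simp: level_rels_def Let_def intro!: tensor_gen_closed S_smult S_one)
  then show ?thesis
    unfolding U_eq using T.quot_proj(4,5)[OF level_ideal] by simp
qed

lemma gen_mult:
  assumes "(a, b) \<in> Q"
  shows "gen a \<otimes>\<^bsub>U\<^esub> gen b = gen (a \<otimes> b)"
proof -
  note ab = S_Q[OF assms]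
  have "level_ideal A S n Q +>\<^bsub>T\<^esub> (tensor_gen V a \<otimes>\<^bsub>T\<^esub> tensor_gen V b) = gen (a \<otimes> b)"
    unfolding gen_eq
    by (rule T_diff_in_ideal) (use ab assms in \<open>auto simp: level_rels_def Let_def intro!: tensor_gen_closed\<close>)
  then show ?thesis
    unfolding U_eq gen_eq using T.quot_proj(3)[OF level_ideal] ab tensor_gen_closed by simp
qed

lemma gen_commutator:
  assumes "a \<in> S n" "b \<in> S n"
  shows "gen a \<otimes>\<^bsub>U\<^esub> gen b = gen b \<otimes>\<^bsub>U\<^esub> gen a \<oplus>\<^bsub>U\<^esub> gen ((a \<otimes> b) \<ominus> (b \<otimes> a))"
proof -
  let ?t = "tensor_gen V" and ?I = "level_ideal A S n Q"
  note ab = tensor_gen_closed[OF S_n[OF assms(1)]] tensor_gen_closed[OF S_n[OF assms(2)]]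
    tensor_gen_closed[OF S_commutator[OF assms]]
  have "?I +>\<^bsub>T\<^esub> (?t a \<otimes>\<^bsub>T\<^esub> ?t b \<ominus>\<^bsub>T\<^esub> ?t b \<otimes>\<^bsub>T\<^esub> ?t a) = gen ((a \<otimes> b) \<ominus> (b \<otimes> a))"
    unfolding gen_eq
    by (rule T_diff_in_ideal) (use ab assms in \<open>auto simp: level_rels_def Let_def\<close>)
  moreover have "?t b \<otimes>\<^bsub>T\<^esub> ?t a \<oplus>\<^bsub>T\<^esub> (?t a \<otimes>\<^bsub>T\<^esub> ?t b \<ominus>\<^bsub>T\<^esub> ?t b \<otimes>\<^bsub>T\<^esub> ?t a) = ?t a \<otimes>\<^bsub>T\<^esub> ?t b"
    using ab by (simp add: a_minus_def T.a_comm T.a_lcomm T.r_neg)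
  ultimately have "(?I +>\<^bsub>T\<^esub> (?t b \<otimes>\<^bsub>T\<^esub> ?t a)) \<oplus>\<^bsub>U\<^esub> gen ((a \<otimes> b) \<ominus> (b \<otimes> a)) = ?I +>\<^bsub>T\<^esub> (?t a \<otimes>\<^bsub>T\<^esub> ?t b)"
    unfolding U_eq using T.quot_proj(2)[OF level_ideal, of "?t b \<otimes>\<^bsub>T\<^esub> ?t a" "?t a \<otimes>\<^bsub>T\<^esub> ?t b \<ominus>\<^bsub>T\<^esub> ?t b \<otimes>\<^bsub>T\<^esub> ?t a"] ab
    by simp
  then show ?thesis
    using T.quot_proj(3)[OF level_ideal] ab by (simp add: U_eq gen_eq)
qed

lemma U_induct [consumes 1, case_names one gen add mult smult]:
  assumes u: "u \<in> carrier U"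
    and one: "P \<one>\<^bsub>U\<^esub>"
    and gen: "\<And>a. a \<in> S (2 * n - 1) \<Longrightarrow> P (gen a)"
    and add: "\<And>x y. x \<in> carrier U \<Longrightarrow> y \<in> carrier U \<Longrightarrow> P x \<Longrightarrow> P y \<Longrightarrow> P (x \<oplus>\<^bsub>U\<^esub> y)"
    and mult: "\<And>x y. x \<in> carrier U \<Longrightarrow> y \<in> carrier U \<Longrightarrow> P x \<Longrightarrow> P y \<Longrightarrow> P (x \<otimes>\<^bsub>U\<^esub> y)"
    and smult: "\<And>c x. x \<in> carrier U \<Longrightarrow> P x \<Longrightarrow> P (c \<odot>\<^bsub>U\<^esub> x)"
  shows "P u"
proof -
  obtain f where f: "f \<in> carrier F" "u = cls f" using cls_surj[OF u] by blast
  have "P (cls f)"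
    using f(1)
  proof (induction rule: free_alg_induct)
    case (const c)
    show ?case unfolding cls_const by (rule smult[OF U.one_closed one])
  next
    case (letter a)
    then show ?case by (rule gen)
  next
    case (add f g)
    then show ?case using assms(4) cls_simps(1,2) by metis
  next
    case (mult f g)
    then show ?case using assms(5) cls_simps(1,3) by metis
  qed
  then show ?thesis using f by simp
qed

end

section \<open>The enveloping algebra of sl2\<close>

lemma env_ideal: "ideal env_ideal (free_alg UNIV)"
proof -
  interpret assoc_alg "free_alg UNIV :: (rat, sl2_free) module" by (rule free_assoc_alg)
  show ?thesis unfolding env_ideal_def by (rule genideal_ideal) (simp add: free_alg_simps)
qed

interpretation Q: assoc_alg "free_alg UNIV :: (rat, sl2_free) module" by (rule free_assoc_alg)
interpretation Env: assoc_alg env_alg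
  unfolding env_alg_def by (rule Q.quot_assoc_alg[OF env_ideal])

lemma free_alg_UNIV [simp]: "f \<in> carrier (free_alg UNIV)"
  by (simp add: free_alg_simps)

lemma env_class_simps:
  "env_class f \<in> carrier env_alg"
  "env_class f \<oplus>\<^bsub>env_alg\<^esub> env_class g = env_class (f + g)"
  "env_class f \<otimes>\<^bsub>env_alg\<^esub> env_class g = env_class (f * g)"
  "\<one>\<^bsub>env_alg\<^esub> = env_class 1"
  unfolding env_alg_def env_class_def
  using Q.quot_proj(1,2,3,5)[OF env_ideal] by (simp_all add: free_alg_simps(2-))

lemma env_class_zero: "\<zero>\<^bsub>env_alg\<^esub> = env_class 0"
proof -
  have "env_class 0 \<oplus>\<^bsub>env_alg\<^esub> env_class 0 = env_class 0 \<oplus>\<^bsub>env_alg\<^esub> \<zero>\<^bsub>env_alg\<^esub>"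
    by (simp add: env_class_simps)
  then show ?thesis
    using Env.add.l_cancel[of "env_class 0" "env_class 0" "\<zero>\<^bsub>env_alg\<^esub>"] by (simp add: env_class_simps(1))
qed

lemma env_class_a_inv: "\<ominus>\<^bsub>env_alg\<^esub> env_class f = env_class (- f)"
  by (rule Env.minus_equality) (simp_all add: env_class_simps env_class_zero)

lemma env_class_rel: "f - g \<in> sl2_rels \<Longrightarrow> env_class f = env_class g"
  unfolding env_class_def
proof (rule Q.quot_proj(7)[OF env_ideal])
  assume *: "f - g \<in> sl2_rels"
  have "sl2_rels \<subseteq> env_ideal" unfolding env_ideal_def by (rule Q.genideal_self) (simp add: free_alg_simps)
  with * show "f \<ominus>\<^bsub>free_alg UNIV\<^esub> g \<in> env_ideal" by (auto simp: free_alg_minus)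
qed simp_all

lemma sl2_rels_no_const: "r \<in> sl2_rels \<Longrightarrow> Poly_Mapping.lookup r 0 = 0"
  by (auto simp: sl2_rels_def Let_def letter_def mult_single lookup_add lookup_minus lookup_single when_def
      plus_word_def zero_word_def mult_2)

text \<open>The relations have no constant term, so they lie in the ideal \<open>?J\<close> of
  elements without constant term, which omits 1. This nontriviality is what the class
  \<open>ring_1\<close> asks of the type \<open>usl2\<close>.\<close>

lemma one_notin_env_ideal: "1 \<notin> env_ideal"
proof -
  let ?J = "{f :: sl2_free. 0 \<notin> Poly_Mapping.keys f}"
  have word0: "u = 0" if "u + v = 0" for u v :: "sl2 word"
    using that by (cases u; cases v) (simp add: plus_word_def zero_word_def)
  have word0': "v = 0" if "u + v = 0" for u v :: "sl2 word"
    using that by (cases u; cases v) (simp add: plus_word_def zero_word_def)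
  have mult: "f * g \<in> ?J" if "f \<in> ?J \<or> g \<in> ?J" for f g
    using that keys_mult[of f g] word0 word0' by fastforce
  have "ideal ?J (free_alg UNIV)"
  proof (rule idealI)
    show "ring (free_alg UNIV :: (rat, sl2_free) module)" by (rule Q.ring_axioms)
    show "subgroup ?J (add_monoid (free_alg UNIV))"
    proof (rule Q.add.subgroupI)
      show "\<ominus>\<^bsub>free_alg UNIV\<^esub> f \<in> ?J" if "f \<in> ?J" for f
        using that by (simp add: free_alg_a_inv)
      show "f \<oplus>\<^bsub>free_alg UNIV\<^esub> g \<in> ?J" if "f \<in> ?J" "g \<in> ?J" for f g
        using that Poly_Mapping.keys_add[of f g] by (auto simp: free_alg_simps(2-))
    qed (auto intro: exI[of _ 0])
  qed (use mult in \<open>auto simp: free_alg_simps(2-)\<close>)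
  moreover have "sl2_rels \<subseteq> ?J" using sl2_rels_no_const by (auto simp: in_keys_iff)
  ultimately have "env_ideal \<subseteq> ?J" unfolding env_ideal_def by (rule Q.genideal_minimal)
  moreover have "(1 :: sl2_free) \<notin> ?J" by (simp add: in_keys_iff)
  ultimately show ?thesis by blast
qed

text \<open>The enveloping algebra over the rationals as a type of class \<open>ring_1\<close>, so
  that the long computations below are free of carrier conditions.\<close>

typedef usl2 = "carrier env_alg"
  morphisms rep_usl2 abs_usl2
  using Env.zero_closed by blast

lemmas rep_usl2_carrier [simp] = rep_usl2
lemmas rep_abs_usl2 [simp] = abs_usl2_inverse

instantiation usl2 :: ring_1
begin

definition "0 = abs_usl2 \<zero>\<^bsub>env_alg\<^esub>"
definition "1 = abs_usl2 \<one>\<^bsub>env_alg\<^esub>"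
definition "x + y = abs_usl2 (rep_usl2 x \<oplus>\<^bsub>env_alg\<^esub> rep_usl2 y)"
definition "x * y = abs_usl2 (rep_usl2 x \<otimes>\<^bsub>env_alg\<^esub> rep_usl2 y)"
definition "- x = abs_usl2 (\<ominus>\<^bsub>env_alg\<^esub> rep_usl2 x)"
definition "x - y = x + - (y :: usl2)"

lemma rep_usl2_simps:
  "rep_usl2 0 = \<zero>\<^bsub>env_alg\<^esub>" "rep_usl2 1 = \<one>\<^bsub>env_alg\<^esub>"
  "rep_usl2 (x + y) = rep_usl2 x \<oplus>\<^bsub>env_alg\<^esub> rep_usl2 y"
  "rep_usl2 (x * y) = rep_usl2 x \<otimes>\<^bsub>env_alg\<^esub> rep_usl2 y"
  "rep_usl2 (- x) = \<ominus>\<^bsub>env_alg\<^esub> rep_usl2 x"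
  by (simp_all add: zero_usl2_def one_usl2_def plus_usl2_def times_usl2_def uminus_usl2_def)

definition usl2_class :: "sl2_free \<Rightarrow> usl2" where "usl2_class f = abs_usl2 (env_class f)"

lemma rep_cl: "rep_usl2 (usl2_class f) = env_class f"
  by (simp add: usl2_class_def env_class_simps)

lemma usl2_class_simps:
  "usl2_class (f + g) = usl2_class f + usl2_class g" "usl2_class (f * g) = usl2_class f * usl2_class g" "usl2_class 1 = 1" "usl2_class 0 = 0" "usl2_class (- f) = - usl2_class f"
  by (simp_all add: rep_usl2_inject[symmetric] rep_cl rep_usl2_simps env_class_simps env_class_zero env_class_a_inv)

instance
proof
  fix a b c :: usl2
  show "a + b + c = a + (b + c)" "a + b = b + a" "0 + a = a" "- a + a = 0"
    by (simp_all add: rep_usl2_inject[symmetric] rep_usl2_simps Env.a_assoc Env.a_comm Env.a_lcomm Env.r_neg)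
  show "a - b = a + - b" by (simp add: minus_usl2_def)
  show "a * b * c = a * (b * c)" "1 * a = a" "a * 1 = a" "(a + b) * c = a * c + b * c" "a * (b + c) = a * b + a * c"
    by (simp_all add: rep_usl2_inject[symmetric] rep_usl2_simps Env.m_assoc Env.l_distr Env.r_distr)
  have "env_class 0 \<noteq> env_class 1"
    using Q.quotient_eq_iff_same_a_r_cos[OF env_ideal, of 1 0] one_notin_env_ideal
    by (auto simp: env_class_def free_alg_minus)
  then show "(0 :: usl2) \<noteq> 1"
    by (simp add: rep_usl2_inject[symmetric] rep_usl2_simps env_class_zero env_class_simps)
qed

end


text \<open>The class \<open>ring_1\<close> has no scalar multiplication; rational scalars enter as
  central elements of the ring.\<close>

definition usl2_scalar :: "rat \<Rightarrow> usl2" where "usl2_scalar c = usl2_class (free_const c)"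

lemma usl2_scalar_simps: "usl2_scalar (c + d) = usl2_scalar c + usl2_scalar d" "usl2_scalar (c * d) = usl2_scalar c * usl2_scalar d" "usl2_scalar 1 = 1" "usl2_scalar 0 = 0"
  by (simp_all add: usl2_scalar_def free_const_simps usl2_class_simps)

lemma usl2_scalar_of_nat: "usl2_scalar (of_nat n) = of_nat n"
  by (induction n) (simp_all add: usl2_scalar_simps)

lemma free_const_commute: "free_const c * f = f * free_const (c::rat)"
proof -
  have 1: "free_const c * free_const d = free_const d * free_const (c::rat)" for d
    by (simp add: mult.commute free_const_simps(2)[symmetric])
  have "f \<in> carrier (free_alg UNIV)" by simp
  then show ?thesis
  proof (induction rule: free_alg_induct)
    case (const d) show ?case by (rule 1)
  next
    case (letter x) show ?case by (simp add: free_const_def letter_def mult_single)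
  next
    case (add f g) then show ?case by (simp add: algebra_simps)
  next
    case (mult f g) then show ?case by (metis mult.assoc)
  qed
qed

lemma usl2_class_surj: "\<exists>f. x = usl2_class f"
proof -
  have "\<exists>f\<in>carrier (free_alg UNIV). rep_usl2 x = env_class f"
    using Q.quot_proj(6)[OF env_ideal] rep_usl2[of x] unfolding env_alg_def env_class_def by blast
  then show ?thesis by (metis rep_cl rep_usl2_inject)
qed

lemma usl2_scalar_commute: "usl2_scalar c * x = x * usl2_scalar c"
  using usl2_class_surj[of x] by (auto simp: usl2_scalar_def usl2_class_simps(2)[symmetric] free_const_commute)

lemma usl2_scalar_left_commute: "x * (usl2_scalar c * y) = usl2_scalar c * (x * y)"
  by (metis mult.assoc usl2_scalar_commute)

text \<open>The rational scalars make positive integers invertible. Identities between divided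
  powers are proved by multiplying with the index, applying a recursion without denominators, and
  cancelling here.\<close>

lemma usl2_cancel:
  assumes "of_nat (Suc n) * x = of_nat (Suc n) * (y :: usl2)"
  shows "x = y"
proof -
  have "usl2_scalar (1 / of_nat (Suc n)) * of_nat (Suc n) = 1"
    by (simp only: usl2_scalar_of_nat[symmetric] usl2_scalar_simps(2)[symmetric]) (simp add: usl2_scalar_simps)
  then show ?thesis using assms by (metis mult.assoc mult_1)
qed

lemma of_nat_left_commute: "x * (of_nat n * y) = of_nat n * (x * (y::'a::semiring_1))"
  by (metis mult.assoc mult_of_nat_commute)

section \<open>Divided powers and their commutation relations\<close>

definition "uE = usl2_class (letter sl2_E)"
definition "uF = usl2_class (letter sl2_F)"
definition "uH = usl2_class (letter sl2_H)"

lemma usl2_class_rel: "f - g \<in> sl2_rels \<Longrightarrow> usl2_class f = usl2_class g"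
  by (simp add: usl2_class_def env_class_rel)

lemma uEF: "uE * uF = uF * uE + uH"
proof -
  have "(letter sl2_E * letter sl2_F :: sl2_free) - (letter sl2_F * letter sl2_E + letter sl2_H) \<in> sl2_rels"
    by (simp add: sl2_rels_def Let_def algebra_simps)
  from usl2_class_rel[OF this] show ?thesis by (simp add: uE_def uF_def uH_def usl2_class_simps)
qed

lemma uHE: "uH * uE = uE * uH + 2 * uE"
proof -
  have "(letter sl2_H * letter sl2_E :: sl2_free) - (letter sl2_E * letter sl2_H + 2 * letter sl2_E) \<in> sl2_rels"
    by (simp add: sl2_rels_def Let_def algebra_simps)
  from usl2_class_rel[OF this] show ?thesis by (simp add: uE_def uF_def uH_def usl2_class_simps mult_2)
qed

lemma uHF: "uH * uF = uF * uH - 2 * uF"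
proof -
  have "(letter sl2_H * letter sl2_F + 2 * letter sl2_F :: sl2_free) - (letter sl2_F * letter sl2_H) \<in> sl2_rels"
    by (simp add: sl2_rels_def Let_def algebra_simps)
  from usl2_class_rel[OF this] have "uH * uF + 2 * uF = uF * uH"
    by (simp add: uE_def uF_def uH_def usl2_class_simps mult_2)
  then show ?thesis by (simp add: eq_diff_eq)
qed

definition dE :: "nat \<Rightarrow> usl2" where "dE n = usl2_scalar (1 / fact n) * uE ^ n"
definition dF :: "nat \<Rightarrow> usl2" where "dF n = usl2_scalar (1 / fact n) * uF ^ n"
text \<open>The binomial coefficient of H + z over n. Shifts are unavoidable: moving a polynomial in
  H past \<open>E^[n]\<close> or \<open>F^[n]\<close> replaces H by H + 2 n or H - 2 n.\<close>

definition hb :: "int \<Rightarrow> nat \<Rightarrow> usl2" where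
  "hb z n = usl2_scalar (1 / fact n) * prod_list (map (\<lambda>i. uH + of_int z - of_nat i) [0..<n])"

lemma usl2_class_power: "usl2_class f ^ n = usl2_class (f ^ n)"
  by (induction n) (simp_all add: usl2_class_simps)

lemma usl2_class_of_nat: "usl2_class (of_nat n) = of_nat n"
  by (induction n) (simp_all add: usl2_class_simps)

lemma usl2_class_prod_list: "prod_list (map (\<lambda>i. usl2_class (f i)) is) = usl2_class (prod_list (map f is))"
  by (induction "is") (simp_all add: usl2_class_simps)

lemma rep_dE: "rep_usl2 (dE n) = kost_E n"
  by (simp add: dE_def kost_E_def uE_def usl2_scalar_def usl2_class_power usl2_class_simps(2)[symmetric] rep_cl)

lemma rep_dF: "rep_usl2 (dF n) = kost_F n"
  by (simp add: dF_def kost_F_def uF_def usl2_scalar_def usl2_class_power usl2_class_simps(2)[symmetric] rep_cl)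

lemma usl2_class_diff: "usl2_class (f - g) = usl2_class f - usl2_class g"
  using usl2_class_simps(1)[of f "- g"] by (simp add: usl2_class_simps)

lemma rep_hb: "rep_usl2 (hb 0 n) = kost_H n"
proof -
  have "uH + of_int 0 - of_nat i = usl2_class (letter sl2_H - of_nat i)" for i
    by (simp add: uH_def usl2_class_diff usl2_class_of_nat)
  then show ?thesis
    by (simp add: hb_def kost_H_def usl2_scalar_def usl2_class_prod_list usl2_class_simps(2)[symmetric] rep_cl)
qed

lemma usl2_scalar_fact_Suc: "of_nat (Suc n) * usl2_scalar (1 / fact (Suc n)) = usl2_scalar (1 / fact n)"
  by (simp only: usl2_scalar_of_nat[symmetric] usl2_scalar_simps(2)[symmetric]) (simp add: fact_Suc del: of_nat_Suc)

lemma d_0 [simp]: "dE 0 = 1" "dF 0 = 1" "hb z 0 = 1"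
  by (simp_all add: dE_def dF_def hb_def usl2_scalar_simps)

lemma dE_Suc: "of_nat (Suc n) * dE (Suc n) = uE * dE n"
  unfolding dE_def by (subst mult.assoc[symmetric], subst usl2_scalar_fact_Suc) (simp add: usl2_scalar_commute mult.assoc power_commutes)

lemma dE_Suc': "of_nat (Suc n) * dE (Suc n) = dE n * uE"
  unfolding dE_def by (subst mult.assoc[symmetric], subst usl2_scalar_fact_Suc) (simp add: mult.assoc power_commutes)

lemma dF_Suc: "of_nat (Suc n) * dF (Suc n) = uF * dF n"
  unfolding dF_def by (subst mult.assoc[symmetric], subst usl2_scalar_fact_Suc) (simp add: usl2_scalar_commute mult.assoc power_commutes)

lemma dF_Suc': "of_nat (Suc n) * dF (Suc n) = dF n * uF"
  unfolding dF_def by (subst mult.assoc[symmetric], subst usl2_scalar_fact_Suc) (simp add: mult.assoc power_commutes)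

lemma hb_Suc: "of_nat (Suc n) * hb z (Suc n) = hb z n * (uH + of_int z - of_nat n)"
  unfolding hb_def by (subst mult.assoc[symmetric], subst usl2_scalar_fact_Suc) (simp add: mult.assoc)

lemma hb_commute:
  assumes "x * uH = uH * x"
  shows "x * hb z n = hb z n * x"
proof (induction n)
  case (Suc n)
  have "of_nat (Suc n) * (x * hb z (Suc n)) = x * (hb z n * (uH + of_int z - of_nat n))"
    by (simp only: of_nat_left_commute[symmetric] hb_Suc)
  also have "\<dots> = hb z n * ((uH + of_int z - of_nat n) * x)"
    using mult_of_int_commute[of z x] mult_of_nat_commute[of n x]
    by (simp add: mult.assoc[symmetric] Suc) (simp add: mult.assoc algebra_simps assms)
  also have "\<dots> = of_nat (Suc n) * (hb z (Suc n) * x)"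
    by (simp only: mult.assoc[symmetric] hb_Suc)
  finally show ?case by (rule usl2_cancel)
qed simp

lemma hb_uH: "hb z n * uH = uH * hb z n"
  using hb_commute[of uH] by simp

text \<open>An element of weight k turns any polynomial f(H) on its left into f(H + k) on its right;
  the recursion \<open>hb_Suc\<close> carries this from H to the binomials.\<close>

lemma hb_shift_through:
  assumes "uH * x = x * (uH + of_int k)"
  shows "hb z m * x = x * hb (z + k) m"
proof (induction m)
  case (Suc m)
  have "of_nat (Suc m) * (hb z (Suc m) * x) = hb z m * ((uH + of_int z - of_nat m) * x)"
    by (simp only: mult.assoc[symmetric] hb_Suc)
  also have "(uH + of_int z - of_nat m) * x = x * (uH + of_int (z + k) - of_nat m)"
    using assms mult_of_int_commute[of z x] mult_of_nat_commute[of m x] by (simp add: algebra_simps)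
  also have "hb z m * (x * (uH + of_int (z + k) - of_nat m)) = x * (hb (z + k) m * (uH + of_int (z + k) - of_nat m))"
    by (simp only: mult.assoc[symmetric] Suc)
  also have "\<dots> = of_nat (Suc m) * (x * hb (z + k) (Suc m))"
    by (simp only: hb_Suc[symmetric] of_nat_left_commute)
  finally show ?case by (rule usl2_cancel)
qed simp

lemma uH_uE: "(uH + of_int k) * uE = uE * (uH + of_int (k + 2))"
  using mult_of_int_commute[of k uE]
  by (simp add: distrib_left distrib_right uHE mult_2 mult_2_right add.assoc)

lemma uH_uF: "(uH + of_int k) * uF = uF * (uH + of_int (k - 2))"
  using mult_of_int_commute[of k uF]
  by (simp add: distrib_left distrib_right right_diff_distrib uHF mult_2 mult_2_right)

lemma uH_dE: "uH * dE n = dE n * (uH + of_int (2 * int n))"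
proof (induction n)
  case (Suc n)
  have "of_nat (Suc n) * (uH * dE (Suc n)) = uH * dE n * uE"
    by (simp only: of_nat_left_commute[symmetric] dE_Suc' mult.assoc)
  also have "\<dots> = dE n * uE * (uH + of_int (2 * int (Suc n)))"
    unfolding Suc mult.assoc uH_uE by (simp add: algebra_simps)
  also have "\<dots> = of_nat (Suc n) * (dE (Suc n) * (uH + of_int (2 * int (Suc n))))"
    by (simp only: dE_Suc'[symmetric] mult.assoc)
  finally show ?case by (rule usl2_cancel)
qed simp

lemma uH_dF: "uH * dF n = dF n * (uH + of_int (- 2 * int n))"
proof (induction n)
  case (Suc n)
  have "of_nat (Suc n) * (uH * dF (Suc n)) = uH * dF n * uF"
    by (simp only: of_nat_left_commute[symmetric] dF_Suc' mult.assoc)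
  also have "\<dots> = dF n * uF * (uH + of_int (- 2 * int (Suc n)))"
    unfolding Suc mult.assoc uH_uF by (simp add: algebra_simps)
  also have "\<dots> = of_nat (Suc n) * (dF (Suc n) * (uH + of_int (- 2 * int (Suc n))))"
    by (simp only: dF_Suc'[symmetric] mult.assoc)
  finally show ?case by (rule usl2_cancel)
qed simp

lemma hb_dE: "hb z m * dE n = dE n * hb (z + 2 * int n) m"
  by (rule hb_shift_through[OF uH_dE])

lemma hb_dF: "hb z m * dF n = dF n * hb (z - 2 * int n) m"
  using hb_shift_through[OF uH_dF, of z m n] by simp

lemma usl2_scalar_power_product: "usl2_scalar (1 / fact a) * x ^ a * (usl2_scalar (1 / fact b) * x ^ b)
    = of_nat ((a + b) choose a) * (usl2_scalar (1 / fact (a + b)) * x ^ (a + b))"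
proof -
  have "usl2_scalar (1 / fact a) * x ^ a * (usl2_scalar (1 / fact b) * x ^ b) = usl2_scalar (1 / fact a) * usl2_scalar (1 / fact b) * x ^ (a + b)"
    unfolding power_add mult.assoc by (subst usl2_scalar_left_commute[of "x ^ a"]) (rule refl)
  also have "usl2_scalar (1 / fact a) * usl2_scalar (1 / fact b) = of_nat ((a + b) choose a) * usl2_scalar (1 / fact (a + b))"
    by (simp only: usl2_scalar_of_nat[symmetric] usl2_scalar_simps(2)[symmetric]) (simp add: binomial_fact)
  finally show ?thesis by (simp add: mult.assoc)
qed

lemma dE_mult: "dE a * dE b = of_nat ((a + b) choose a) * dE (a + b)"
  unfolding dE_def by (rule usl2_scalar_power_product)

lemma dF_mult: "dF a * dF b = of_nat ((a + b) choose a) * dF (a + b)"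
  unfolding dF_def by (rule usl2_scalar_power_product)

lemma shift_commute: "(y + 1) * (y - of_nat n) = (y - of_nat n) * (y + (1 :: 'a::ring_1))"
  by (simp add: algebra_simps mult_of_nat_commute)

text \<open>Splits off the first factor of the falling factorial, where \<open>hb_Suc\<close> splits
  off the last. Comparing the two yields Pascal's rule.\<close>

lemma hb_front: "of_nat (Suc n) * hb (z + 1) (Suc n) = hb z n * (uH + of_int z + 1)"
proof (induction n)
  case 0
  show ?case using hb_Suc[of 0 "z + 1"] by (simp add: algebra_simps)
next
  case (Suc n)
  have "of_nat (Suc n) * (of_nat (Suc (Suc n)) * hb (z + 1) (Suc (Suc n)))
      = of_nat (Suc n) * hb (z + 1) (Suc n) * (uH + of_int (z + 1) - of_nat (Suc n))"
    by (simp only: hb_Suc[of "Suc n" "z + 1"] mult.assoc)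
  also have "\<dots> = hb z n * (uH + of_int z + 1) * (uH + of_int (z + 1) - of_nat (Suc n))"
    by (simp only: Suc)
  also have "(uH + of_int (z + 1) - of_nat (Suc n)) = uH + of_int z - of_nat n"
    by simp
  also have "hb z n * (uH + of_int z + 1) * (uH + of_int z - of_nat n) = hb z n * (uH + of_int z - of_nat n) * (uH + of_int z + 1)"
    using shift_commute[of "uH + of_int z" n] by (simp only: mult.assoc)
  also have "\<dots> = of_nat (Suc n) * (hb z (Suc n) * (uH + of_int z + 1))"
    by (simp only: hb_Suc[symmetric] mult.assoc)
  finally show ?case by (rule usl2_cancel)
qed

lemma hb_Pascal: "hb (z + 1) (Suc n) = hb z (Suc n) + hb z n"
proof (rule usl2_cancel[of n])
  show "of_nat (Suc n) * hb (z + 1) (Suc n) = of_nat (Suc n) * (hb z (Suc n) + hb z n)"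
    unfolding hb_front distrib_left hb_Suc[of n z] by (simp add: algebra_simps mult_of_nat_commute)
qed

text \<open>With the shift by \<open>a\<close> the factors of the second falling factorial begin
  where those of the first end, so together they form a single one; the factorials leave a binomial
  coefficient.\<close>

lemma hb_mult: "hb z a * hb (z - int a) b = of_nat ((a + b) choose a) * hb z (a + b)"
proof (induction b)
  case (Suc b)
  have "of_nat (Suc b) * (hb z a * hb (z - int a) (Suc b)) = hb z a * hb (z - int a) b * (uH + of_int (z - int a) - of_nat b)"
    by (simp only: of_nat_left_commute[symmetric] hb_Suc mult.assoc)
  also have "\<dots> = of_nat ((a + b) choose a) * (hb z (a + b) * (uH + of_int z - of_nat (a + b)))"
    unfolding Suc by (simp add: mult.assoc diff_diff_eq algebra_simps)
  also have "\<dots> = of_nat (((a + b) choose a) * Suc (a + b)) * hb z (Suc (a + b))"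
    by (simp only: hb_Suc[symmetric] mult.assoc of_nat_mult)
  also have "((a + b) choose a) * Suc (a + b) = Suc b * ((a + Suc b) choose a)"
    using Suc_times_binomial_eq[of "a + b" b] binomial_symmetric[of a "a + b"] binomial_symmetric[of a "a + Suc b"]
    by (simp add: mult.commute)
  finally have *: "of_nat (Suc b) * (hb z a * hb (z - int a) (Suc b)) = of_nat (Suc b * ((a + Suc b) choose a)) * hb z (Suc (a + b))" .
  show ?case
    by (rule usl2_cancel[of b]) (use * in \<open>simp only: of_nat_mult mult.assoc add_Suc_right\<close>)
qed simp

text \<open>Passing E through the c + 1 factors F produces the terms H, H - 2, ..., H - 2 c once all
  H are moved to the right. Their sum is (c + 1) (H - c), and c + 1 is absorbed by the
  factorial.\<close>

lemma uE_dF: "uE * dF (Suc c) = dF (Suc c) * uE + dF c * (uH - of_nat c)"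
proof (induction c)
  case 0
  show ?case using uEF dF_Suc[of 0] by simp
next
  case (Suc c)
  have "of_nat (Suc (Suc c)) * (uE * dF (Suc (Suc c))) = uE * dF (Suc c) * uF"
    by (simp only: of_nat_left_commute[symmetric] dF_Suc' mult.assoc)
  also have "\<dots> = dF (Suc c) * (uE * uF) + dF c * ((uH - of_nat c) * uF)"
    unfolding Suc by (simp only: distrib_right mult.assoc)
  also have "(uH - of_nat c) * uF = uF * (uH - of_nat c - 2)"
    by (simp add: algebra_simps uHF mult_of_nat_commute mult_2 mult_2_right)
  also have "dF c * (uF * (uH - of_nat c - 2)) = of_nat (Suc c) * (dF (Suc c) * (uH - of_nat c - 2))"
    by (simp only: mult.assoc[symmetric] dF_Suc')
  also have "dF (Suc c) * (uE * uF) + of_nat (Suc c) * (dF (Suc c) * (uH - of_nat c - 2))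
      = dF (Suc c) * uF * uE + of_nat (Suc (Suc c)) * (dF (Suc c) * (uH - of_nat (Suc c)))"
  proof -
    have *: "x * (uH - of_nat c - 2) = x * uH - of_nat (c + 2) * x" "x * (uH - of_nat (Suc c)) = x * uH - of_nat (Suc c) * x" for x
      using mult_of_nat_commute[of c x] by (simp_all add: algebra_simps mult_2 mult_2_right)
    show ?thesis unfolding uEF * by (simp add: algebra_simps)
  qed
  also have "\<dots> = of_nat (Suc (Suc c)) * (dF (Suc (Suc c)) * uE + dF (Suc c) * (uH - of_nat (Suc c)))"
    by (simp only: dF_Suc'[symmetric] distrib_left mult.assoc)
  finally show ?case by (rule usl2_cancel)
qed

section \<open>Kostant's straightening formula\<close>

text \<open>The k-th summand of Kostant's formula for \<open>E^[a] F^[c]\<close>. It is extended by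
  zero so that sums can run to \<open>a\<close> whatever \<open>c\<close> is.\<close>

definition EF_term :: "nat \<Rightarrow> nat \<Rightarrow> nat \<Rightarrow> usl2" where
  "EF_term a c k = (if k \<le> a \<and> k \<le> c
    then dF (c - k) * hb (2 * int k - int a - int c) k * dE (a - k) else 0)"

text \<open>Adds the two contributions to the k-th term in the induction for
  \<open>EF_formula\<close>. The factor in H is y + (a + 1), where y extends the falling factorial
  by one factor; what remains is Pascal's rule multiplied by a + 1.\<close>

lemma hb_Suc_combine:
  assumes "k \<ge> 1" "k \<le> a + 1"
  shows "of_nat (a + 1 - k) * hb z k + (uH + of_int z + of_nat a - of_nat k + 2) * hb z (k - 1)
    = of_nat (Suc a) * hb (z + 1) k"
proof -
  obtain j where k: "k = Suc j" using assms(1) by (cases k) auto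
  define y where "y = uH + of_int z - of_nat j"
  have "y * uH = uH * y"
    using mult_of_nat_commute[of j uH] mult_of_int_commute[of z uH] by (simp add: y_def algebra_simps)
  from hb_commute[OF this] have 1: "y * hb z j = of_nat (Suc j) * hb z (Suc j)"
    by (simp only: hb_Suc y_def)
  have "uH + of_int z + of_nat a - of_nat k + 2 = y + of_nat (Suc a)"
    by (simp add: y_def k)
  then have "of_nat (a + 1 - k) * hb z k + (uH + of_int z + of_nat a - of_nat k + 2) * hb z (k - 1)
      = of_nat (a - j) * hb z (Suc j) + of_nat (Suc j) * hb z (Suc j) + of_nat (Suc a) * hb z j"
    by (simp only: distrib_right 1 k) (simp add: 1 algebra_simps)
  also have "\<dots> = of_nat (a - j + Suc j) * hb z (Suc j) + of_nat (Suc a) * hb z j"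
    by (simp only: of_nat_add distrib_right)
  also have "a - j + Suc j = Suc a" using assms k by simp
  finally show ?thesis by (simp only: k hb_Pascal distrib_left)
qed

lemma EF_formula: "dE a * dF c = (\<Sum>k\<le>a. EF_term a c k)"
proof (induction a)
  case 0
  show ?case by (simp add: EF_term_def)
next
  case (Suc a)
  \<comment> \<open>Multiplying a summand by E from the left gives two pieces. In \<open>A\<close>
    the E passes the power of F and joins the power of E; in \<open>B\<close> it is consumed by the
    commutator, which lowers the power of F and raises the index by one.\<close>
  define A where "A k = (if k \<le> a \<and> k \<le> c then
      dF (c - k) * (of_nat (a + 1 - k) * hb (2 * int k - int a - int c - 2) k) * dE (a + 1 - k) else 0)" for k
  define B where "B k = (if 1 \<le> k \<and> k \<le> a + 1 \<and> k \<le> c then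
      dF (c - k) * ((uH - of_nat (c - k)) * hb (2 * int k - int a - int c - 2) (k - 1)) * dE (a + 1 - k) else 0)" for k
  have step: "uE * EF_term a c k = A k + B (Suc k)" if "k \<le> a" for k
  proof (cases "k \<le> c")
    case True
    have hE: "uE * hb z k = hb (z - 2) k * uE" for z
      using hb_dE[of "z - 2" k 1] dE_Suc[of 0] by simp
    have eq: "uE * dF (c - k) = dF (c - k) * uE + (if k < c then dF (c - Suc k) * (uH - of_nat (c - Suc k)) else 0)"
      using uE_dF[of "c - Suc k"] True by (cases "k = c") (simp_all add: Suc_diff_Suc)
    have Ee: "uE * dE (a - k) = of_nat (a + 1 - k) * dE (a + 1 - k)"
      using dE_Suc[of "a - k"] that by (simp add: Suc_diff_le)
    have "uE * EF_term a c k = uE * dF (c - k) * hb (2 * int k - int a - int c) k * dE (a - k)"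
      using that True by (simp add: EF_term_def mult.assoc)
    also have "\<dots> = dF (c - k) * (uE * hb (2 * int k - int a - int c) k) * dE (a - k) +
        (if k < c then dF (c - Suc k) * (uH - of_nat (c - Suc k)) else 0) * hb (2 * int k - int a - int c) k * dE (a - k)"
      by (simp only: eq distrib_right mult.assoc)
    also have "dF (c - k) * (uE * hb (2 * int k - int a - int c) k) * dE (a - k) = A k"
      using that True by (simp only: A_def hE mult.assoc Ee of_nat_left_commute simp_thms if_True)
    also have "(if k < c then dF (c - Suc k) * (uH - of_nat (c - Suc k)) else 0) * hb (2 * int k - int a - int c) k * dE (a - k) = B (Suc k)"
    proof -
      have "2 * int (Suc k) - int a - int c - 2 = 2 * int k - int a - int c" by simp
      then show ?thesis unfolding B_def using that by (simp only:) (simp add: mult.assoc)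
    qed
    finally show ?thesis .
  qed (use that in \<open>simp add: EF_term_def A_def B_def\<close>)
  have combine: "A k + B k = of_nat (Suc a) * EF_term (Suc a) c k" if "k \<le> Suc a" for k
  proof (cases "k \<le> c")
    case True
    let ?z = "2 * int k - int a - int c - 2"
    show ?thesis
    proof (cases "k = 0")
      case True
      then show ?thesis using of_nat_left_commute[of "dF c" "Suc a" "dE (Suc a)"]
        by (simp add: A_def B_def EF_term_def mult.assoc)
    next
      case False
      have A: "A k = dF (c - k) * (of_nat (a + 1 - k) * hb ?z k) * dE (a + 1 - k)"
        using True that by (cases "k = Suc a") (simp_all add: A_def)
      have B: "B k = dF (c - k) * ((uH - of_nat (c - k)) * hb ?z (k - 1)) * dE (a + 1 - k)"
        using False True that by (simp add: B_def)
      have z: "uH - of_nat (c - k) = uH + of_int ?z + of_nat a - of_nat k + 2"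
      proof -
        have "?z = - int (c - k) - int a + int k - 2" using True by simp
        then show ?thesis
          by (simp only: of_int_diff of_int_add of_int_minus of_int_of_nat_eq of_int_numeral) simp
      qed
      have "A k + B k = dF (c - k) * (of_nat (a + 1 - k) * hb ?z k + (uH - of_nat (c - k)) * hb ?z (k - 1)) * dE (a + 1 - k)"
        unfolding A B by (simp only: distrib_left distrib_right)
      also have "\<dots> = dF (c - k) * (of_nat (Suc a) * hb (?z + 1) k) * dE (a + 1 - k)"
        unfolding z using hb_Suc_combine[of k a ?z] False that by simp
      also have "\<dots> = of_nat (Suc a) * EF_term (Suc a) c k"
        using True that by (simp add: EF_term_def mult.assoc of_nat_left_commute[of "dF (c - k)"] algebra_simps)
      finally show ?thesis .
    qed
  qed (use that in \<open>simp add: EF_term_def A_def B_def\<close>)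
  have "of_nat (Suc a) * (dE (Suc a) * dF c) = uE * (dE a * dF c)"
    by (simp only: mult.assoc[symmetric] dE_Suc)
  also have "\<dots> = (\<Sum>k\<le>a. A k + B (Suc k))"
    unfolding Suc sum_distrib_left by (rule sum.cong) (simp_all add: step)
  also have "\<dots> = (\<Sum>k\<le>a. A k) + (\<Sum>k\<le>a. B (Suc k))"
    by (rule sum.distrib)
  \<comment> \<open>Both sums are brought to the range up to \<open>Suc a\<close>:
    \<open>A (Suc a)\<close> and \<open>B 0\<close> vanish by definition.\<close>
  also have "(\<Sum>k\<le>a. A k) = (\<Sum>k\<le>Suc a. A k)"
    by (simp add: A_def)
  also have "(\<Sum>k\<le>a. B (Suc k)) = (\<Sum>k\<le>Suc a. B k)"
    using sum.atMost_Suc_shift[of B a] by (simp add: B_def)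
  also have "(\<Sum>k\<le>Suc a. A k) + (\<Sum>k\<le>Suc a. B k) = (\<Sum>k\<le>Suc a. of_nat (Suc a) * EF_term (Suc a) c k)"
    by (simp only: sum.distrib[symmetric]) (rule sum.cong, simp_all add: combine del: sum.atMost_Suc)
  also have "\<dots> = of_nat (Suc a) * (\<Sum>k\<le>Suc a. EF_term (Suc a) c k)"
    by (simp only: sum_distrib_left)
  finally show ?case by (rule usl2_cancel)
qed

section \<open>The order filtration on the integral form\<close>

text \<open>
  The degree is an integer so that the commutator of elements of degrees \<open>n\<close> and \<open>m\<close> has
  degree \<open>n + m - 1\<close> also for \<open>n = m = 0\<close>, where it vanishes.
\<close>

inductive_set Hspan :: "int \<Rightarrow> int \<Rightarrow> usl2 set" for w n :: int where
  zero: "0 \<in> Hspan w n"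
| gen: "int j \<le> n \<Longrightarrow> hb w j \<in> Hspan w n"
| diff: "x \<in> Hspan w n \<Longrightarrow> y \<in> Hspan w n \<Longrightarrow> x - y \<in> Hspan w n"

text \<open>The integral span of the Kostant monomials of degree at most \<open>n\<close>, taken
  inside the rational enveloping algebra; its reduction modulo p is the filtration of the
  distributions. Closure under differences yields sums, negatives and multiples by natural numbers
  from one rule.\<close>

inductive_set Kf :: "int \<Rightarrow> usl2 set" for n :: int where
  zero: "0 \<in> Kf n"
| gen: "int (a + b + c) \<le> n \<Longrightarrow> dE a * hb 0 b * dF c \<in> Kf n"
| diff: "x \<in> Kf n \<Longrightarrow> y \<in> Kf n \<Longrightarrow> x - y \<in> Kf n"

definition diff_closed :: "'a::ring_1 set \<Rightarrow> bool" where
  "diff_closed S \<longleftrightarrow> 0 \<in> S \<and> (\<forall>x\<in>S. \<forall>y\<in>S. x - y \<in> S)"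

lemma diff_closed_imp:
  assumes "diff_closed S"
  shows "x \<in> S \<Longrightarrow> - x \<in> S"
    and "x \<in> S \<Longrightarrow> y \<in> S \<Longrightarrow> x + y \<in> S"
    and "x \<in> S \<Longrightarrow> of_nat k * x \<in> S"
    and "(\<And>i. i \<in> I \<Longrightarrow> f i \<in> S) \<Longrightarrow> sum f I \<in> S"
proof -
  note z = assms[unfolded diff_closed_def, THEN conjunct1]
  note d = assms[unfolded diff_closed_def, THEN conjunct2, rule_format]
  have m: "- x \<in> S" if "x \<in> S" for x using d[OF z that] by simp
  then show "x \<in> S \<Longrightarrow> - x \<in> S" .
  have a: "x + y \<in> S" if "x \<in> S" "y \<in> S" for x y using d[OF that(1) m[OF that(2)]] by simp
  then show "x \<in> S \<Longrightarrow> y \<in> S \<Longrightarrow> x + y \<in> S" .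
  show "of_nat k * x \<in> S" if "x \<in> S"
    using that by (induction k) (simp_all add: z a distrib_right)
  show "sum f I \<in> S" if "\<And>i. i \<in> I \<Longrightarrow> f i \<in> S"
    using that by (induction I rule: infinite_finite_induct) (simp_all add: z a)
qed

lemma diff_closed_Hspan: "diff_closed (Hspan w n)"
  by (auto simp: diff_closed_def intro: Hspan.intros)

lemma diff_closed_Kf: "diff_closed (Kf n)"
  by (auto simp: diff_closed_def intro: Kf.intros)

lemmas Hspan_closed = diff_closed_imp[OF diff_closed_Hspan]
lemmas Kf_closed = diff_closed_imp[OF diff_closed_Kf]

lemma of_nat_pull: "(of_nat i * x) * y * (of_nat j * z) = of_nat i * (of_nat j * (x * y * (z::'a::semiring_1)))"
  using of_nat_left_commute[of "x * y" j z] by (simp add: mult.assoc)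

lemma Hspan_mono: "x \<in> Hspan w n \<Longrightarrow> n \<le> m \<Longrightarrow> x \<in> Hspan w m"
  by (induction rule: Hspan.induct) (auto intro: Hspan.intros)

lemma Kf_mono: "x \<in> Kf n \<Longrightarrow> n \<le> m \<Longrightarrow> x \<in> Kf m"
  by (induction rule: Kf.induct) (auto intro: Kf.intros)

text \<open>Pascal's rule changes the shift by one at the price of a binomial of lower degree. The
  induction is on the degree and, inside it, on the distance from z to w in both directions. Hence
  \<open>Hspan\<close> does not depend on its base point.\<close>

lemma hb_in_Hspan: "hb z n \<in> Hspan w n" and hb_diff_in_Hspan: "hb z n - hb w n \<in> Hspan w (int n - 1)"
proof -
  have "hb z n - hb w n \<in> Hspan w (int n - 1)" for z
  proof (induction n arbitrary: z)
    case 0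
    show ?case by (simp add: Hspan.zero)
  next
    case (Suc n)
    have in_span: "hb z n \<in> Hspan w (int n)" for z
    proof -
      have "hb z n - hb w n \<in> Hspan w (int n)" using Hspan_mono[OF Suc] by simp
      then have "(hb z n - hb w n) + hb w n \<in> Hspan w (int n)" by (rule Hspan_closed(2)) (simp add: Hspan.gen)
      then show ?thesis by simp
    qed
    show ?case
    proof (induction z rule: int_induct[of _ w])
      case base
      show ?case by (simp add: Hspan.zero)
    next
      case (step1 i)
      have "hb (i + 1) (Suc n) - hb w (Suc n) = (hb i (Suc n) - hb w (Suc n)) + hb i n"
        by (simp add: hb_Pascal)
      then show ?case using Hspan_closed(2)[OF step1(2), of "hb i n"] in_span[of i] by (simp only:) simp
    next
      case (step2 i)
      have "hb (i - 1) (Suc n) - hb w (Suc n) = (hb i (Suc n) - hb w (Suc n)) - hb (i - 1) n"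
        using hb_Pascal[of "i - 1" n] by simp
      then show ?case using Hspan.diff[OF step2(2), of "hb (i - 1) n"] in_span[of "i - 1"] by (simp only:) simp
    qed
  qed
  from this[of z] show *: "hb z n - hb w n \<in> Hspan w (int n - 1)" .
  have "(hb z n - hb w n) + hb w n \<in> Hspan w (int n)"
    by (rule Hspan_closed(2)[OF Hspan_mono[OF *]]) (simp_all add: Hspan.gen)
  then show "hb z n \<in> Hspan w n" by simp
qed

lemma Hspan_base: "x \<in> Hspan w n \<Longrightarrow> x \<in> Hspan v n"
proof (induction rule: Hspan.induct)
  case (gen j)
  then show ?case using Hspan_mono[OF hb_in_Hspan] by simp
qed (auto intro: Hspan.intros)

text \<open>The base point can be moved to z - k, where \<open>hb_mult\<close> evaluates the product
  with each spanning binomial.\<close>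

lemma hb_mult_Hspan:
  assumes "x \<in> Hspan w n"
  shows "hb z k * x \<in> Hspan v (int k + n)"
proof -
  have "x \<in> Hspan (z - int k) n" using assms by (rule Hspan_base)
  then have "hb z k * x \<in> Hspan z (int k + n)"
  proof (induction rule: Hspan.induct)
    case (gen j)
    show ?case unfolding hb_mult by (rule Hspan_closed(3), rule Hspan.gen) (use gen in simp)
  qed (auto simp: right_diff_distrib intro: Hspan.intros)
  then show ?thesis by (rule Hspan_base)
qed

text \<open>The shifts affect only lower terms, so the leading coefficient is that of the unshifted
  product. This is what lets commutators lose a degree.\<close>

lemma hb_hb_leading:
  "hb z a * hb w b - of_nat ((a + b) choose a) * hb 0 (a + b) \<in> Hspan 0 (int (a + b) - 1)"
proof -
  have "hb z a * (hb w b - hb (z - int a) b) \<in> Hspan 0 (int a + (int b - 1))"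
    by (rule hb_mult_Hspan[OF hb_diff_in_Hspan])
  moreover have "of_nat ((a + b) choose a) * (hb z (a + b) - hb 0 (a + b)) \<in> Hspan 0 (int (a + b) - 1)"
    by (rule Hspan_closed(3)[OF hb_diff_in_Hspan])
  ultimately have "hb z a * (hb w b - hb (z - int a) b) + of_nat ((a + b) choose a) * (hb z (a + b) - hb 0 (a + b))
      \<in> Hspan 0 (int (a + b) - 1)"
    by (intro Hspan_closed(2)) (simp_all add: add_diff_eq)
  then show ?thesis by (simp add: right_diff_distrib hb_mult)
qed

lemma Kf_EHF:
  assumes "x \<in> Hspan w n" "int a + n + int c \<le> m"
  shows "dE a * x * dF c \<in> Kf m"
proof -
  have "x \<in> Hspan 0 n" using assms(1) by (rule Hspan_base)
  then show ?thesis
  proof (induction rule: Hspan.induct)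
    case (gen j)
    then show ?case using assms(2) by (intro Kf.gen) simp
  qed (auto simp: right_diff_distrib left_diff_distrib intro: Kf.intros)
qed

text \<open>The H-factors pass the outer powers of E and F with a shift, equal letters then stand
  side by side, and their products are integral multiples of divided powers.\<close>

lemma Kf_sandwich:
  assumes "y \<in> Kf n"
  shows "dE a * hb z b * y * hb w b' * dF c \<in> Kf (int a + int b + n + int b' + int c)"
  using assms
proof (induction rule: Kf.induct)
  case (gen a1 b1 c1)
  have "dE a * hb z b * (dE a1 * hb 0 b1 * dF c1) * hb w b' * dF c
      = dE a * (hb z b * dE a1) * hb 0 b1 * (dF c1 * hb w b') * dF c"
    by (simp only: mult.assoc)
  also have "dF c1 * hb w b' = hb (w + 2 * int c1) b' * dF c1"
    using hb_dF[of "w + 2 * int c1" b' c1] by simp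
  also have "hb z b * dE a1 = dE a1 * hb (z + 2 * int a1) b" by (rule hb_dE)
  also have "dE a * (dE a1 * hb (z + 2 * int a1) b) * hb 0 b1 * (hb (w + 2 * int c1) b' * dF c1) * dF c
     = (dE a * dE a1) * (hb (z + 2 * int a1) b * (hb 0 b1 * hb (w + 2 * int c1) b')) * (dF c1 * dF c)"
    by (simp only: mult.assoc)
  also have "\<dots> = of_nat ((a + a1) choose a) * (of_nat ((c1 + c) choose c1) * (dE (a + a1) *
      (hb (z + 2 * int a1) b * (hb 0 b1 * hb (w + 2 * int c1) b')) * dF (c1 + c)))"
    unfolding dE_mult dF_mult by (rule of_nat_pull)
  finally show ?case
    using gen by (auto intro!: Kf_closed(3) Kf_EHF[OF hb_mult_Hspan[OF hb_mult_Hspan[OF hb_in_Hspan]]])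
qed (auto simp: right_diff_distrib left_diff_distrib intro: Kf.intros)

text \<open>\<open>EF_formula\<close> has F on the left, which is the wrong order here. Its k-th
  term contains a product of F and E of total degree a + c - 2 k and a binomial of degree k. By
  induction on a + c the terms with k > 0 have degree at most a + c - 1, and the term k = 0 is the
  product being reordered.\<close>

lemma FE_commutator: "dF c * dE a - dE a * dF c \<in> Kf (int a + int c - 1)"
  and FE_in_Kf: "dF c * dE a \<in> Kf (int a + int c)"
proof -
  have "dF c * dE a - dE a * dF c \<in> Kf (int a + int c - 1) \<and> dF c * dE a \<in> Kf (int a + int c)"
  proof (induction "a + c" arbitrary: a c rule: less_induct)
    case less
    have *: "EF_term a c (Suc k) \<in> Kf (int a + int c - 1)" for k
    proof (cases "Suc k \<le> a \<and> Suc k \<le> c")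
      case True
      have "EF_term a c (Suc k) = dE 0 * hb 0 0 * (dF (c - Suc k) * dE (a - Suc k)) *
          hb (2 * int (Suc k) - int a - int c + 2 * int (a - Suc k)) (Suc k) * dF 0"
        using True by (simp only: EF_term_def if_True simp_thms hb_dE mult.assoc d_0 mult_1 mult_1_right)
      moreover have "dF (c - Suc k) * dE (a - Suc k) \<in> Kf (int (a - Suc k) + int (c - Suc k))"
        using less[of "a - Suc k" "c - Suc k"] True by auto
      ultimately have "EF_term a c (Suc k) \<in> Kf (int 0 + int 0 + (int (a - Suc k) + int (c - Suc k)) + int (Suc k) + int 0)"
        using Kf_sandwich by metis
      then show ?thesis by (rule Kf_mono) (use True in simp)
    qed (auto simp: EF_term_def Kf.zero)
    have "dE a * dF c = dF c * dE a + (\<Sum>k<a. EF_term a c (Suc k))"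
      unfolding EF_formula lessThan_Suc_atMost[symmetric] sum.lessThan_Suc_shift by (simp add: EF_term_def)
    then have 1: "dF c * dE a - dE a * dF c = - (\<Sum>k<a. EF_term a c (Suc k))" by simp
    have 2: "dF c * dE a - dE a * dF c \<in> Kf (int a + int c - 1)"
      unfolding 1 by (intro Kf_closed(1) Kf_closed(4) *)
    have "dE a * hb 0 0 * dF c \<in> Kf (int a + int c)" by (rule Kf.gen) simp
    then have "(dF c * dE a - dE a * dF c) + dE a * dF c \<in> Kf (int a + int c)"
      by (intro Kf_closed(2) Kf_mono[OF 2]) simp_all
    then show ?case using 2 by simp
  qed
  then show "dF c * dE a - dE a * dF c \<in> Kf (int a + int c - 1)" "dF c * dE a \<in> Kf (int a + int c)" by auto
qed

text \<open>The subtracted term is the product in the commutative divided power algebra on E, H and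
  F, which is symmetric in the two factors. There are two sources of error, both of lower
  degree.\<close>

lemma Kf_gen_product:
  "dE a * hb 0 b * dF c * (dE a' * hb 0 b' * dF c')
    - of_nat (((a + a') choose a) * ((b + b') choose b) * ((c + c') choose c)) *
        (dE (a + a') * hb 0 (b + b') * dF (c + c'))
    \<in> Kf (int (a + b + c) + int (a' + b' + c') - 1)"
    (is "?p - ?q \<in> Kf ?n")
proof -
  let ?A = "of_nat ((a + a') choose a)" and ?B = "of_nat ((b + b') choose b)" and ?C = "of_nat ((c + c') choose c)"
  \<comment> \<open>The error of exchanging F and E in the middle; the second error, treated next,
    comes from multiplying the two shifted binomials.\<close>
  have "dE a * hb 0 b * (dF c * dE a' - dE a' * dF c) * hb 0 b' * dF c'
      \<in> Kf (int a + int b + (int a' + int c - 1) + int b' + int c')"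
    by (rule Kf_sandwich[OF FE_commutator])
  then have 1: "dE a * hb 0 b * (dF c * dE a' - dE a' * dF c) * hb 0 b' * dF c' \<in> Kf ?n"
    by (rule Kf_mono) simp
  let ?h = "hb (0 + 2 * int a') b * hb (0 + 2 * int c) b'"
  have "dE (a + a') * (?h - ?B * hb 0 (b + b')) * dF (c + c') \<in> Kf ?n"
    by (rule Kf_EHF[OF hb_hb_leading]) simp
  then have 2: "?A * (?C * (dE (a + a') * (?h - ?B * hb 0 (b + b')) * dF (c + c'))) \<in> Kf ?n"
    by (intro Kf_closed(3))
  have "?p = dE a * hb 0 b * (dF c * dE a' - dE a' * dF c) * hb 0 b' * dF c'
      + dE a * (hb 0 b * dE a') * (dF c * hb 0 b') * dF c'"
    by (simp add: right_diff_distrib left_diff_distrib mult.assoc)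
  also have "dF c * hb 0 b' = hb (0 + 2 * int c) b' * dF c"
    using hb_dF[of "0 + 2 * int c" b' c] by simp
  also have "hb 0 b * dE a' = dE a' * hb (0 + 2 * int a') b" by (rule hb_dE)
  also have "dE a * (dE a' * hb (0 + 2 * int a') b) * (hb (0 + 2 * int c) b' * dF c) * dF c'
      = (dE a * dE a') * ?h * (dF c * dF c')"
    by (simp only: mult.assoc)
  also have "\<dots> = ?A * (?C * (dE (a + a') * ?h * dF (c + c')))"
    unfolding dE_mult dF_mult by (rule of_nat_pull)
  finally have p: "?p = dE a * hb 0 b * (dF c * dE a' - dE a' * dF c) * hb 0 b' * dF c'
      + ?A * (?C * (dE (a + a') * ?h * dF (c + c')))" .
  have q: "?q = ?A * (?C * (dE (a + a') * (?B * hb 0 (b + b')) * dF (c + c')))"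
  proof -
    have "dE (a + a') * (?B * hb 0 (b + b')) * dF (c + c') = ?B * (dE (a + a') * hb 0 (b + b') * dF (c + c'))"
      using of_nat_left_commute[of "dE (a + a')" _ "hb 0 (b + b')"] by (simp add: mult.assoc)
    moreover have "((a + a') choose a) * ((b + b') choose b) * ((c + c') choose c) =
        ((a + a') choose a) * ((c + c') choose c) * ((b + b') choose b)" by simp
    ultimately show ?thesis by (simp only: of_nat_mult mult.assoc)
  qed
  have "?p - ?q = dE a * hb 0 b * (dF c * dE a' - dE a' * dF c) * hb 0 b' * dF c'
      + ?A * (?C * (dE (a + a') * (?h - ?B * hb 0 (b + b')) * dF (c + c')))"
    unfolding p q by (simp add: right_diff_distrib left_diff_distrib)
  then show ?thesis using Kf_closed(2)[OF 1 2] by simp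
qed

lemma Kf_mult:
  assumes "x \<in> Kf n" "y \<in> Kf m"
  shows "x * y \<in> Kf (n + m)"
  using assms(1)
proof (induction rule: Kf.induct)
  case (gen a b c)
  show ?case
    using assms(2)
  proof (induction rule: Kf.induct)
    case (gen a' b' c')
    let ?p = "dE a * hb 0 b * dF c * (dE a' * hb 0 b' * dF c')"
    let ?q = "of_nat (((a + a') choose a) * ((b + b') choose b) * ((c + c') choose c)) *
        (dE (a + a') * hb 0 (b + b') * dF (c + c'))"
    have "?p - ?q \<in> Kf (n + m)"
      by (rule Kf_mono[OF Kf_gen_product]) (use gen \<open>int (a + b + c) \<le> n\<close> in simp)
    moreover have "?q \<in> Kf (n + m)"
      by (intro Kf_closed(3) Kf.gen) (use gen \<open>int (a + b + c) \<le> n\<close> in simp)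
    ultimately have "(?p - ?q) + ?q \<in> Kf (n + m)" by (rule Kf_closed(2))
    then show ?case by simp
  qed (auto simp: right_diff_distrib intro: Kf.intros)
qed (auto simp: left_diff_distrib intro: Kf.intros)

text \<open>Both products have the same leading term by the symmetry of
  \<open>Kf_gen_product\<close>, so it cancels.\<close>

lemma Kf_commutator:
  assumes "x \<in> Kf n" "y \<in> Kf m"
  shows "x * y - y * x \<in> Kf (n + m - 1)"
  using assms(1)
proof (induction rule: Kf.induct)
  case (gen a b c)
  show ?case
    using assms(2)
  proof (induction rule: Kf.induct)
    case (gen a' b' c')
    let ?x = "dE a * hb 0 b * dF c" and ?y = "dE a' * hb 0 b' * dF c'"
    let ?q = "of_nat (((a + a') choose a) * ((b + b') choose b) * ((c + c') choose c)) *
        (dE (a + a') * hb 0 (b + b') * dF (c + c'))"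
    have sym: "(i + j) choose i = (j + i) choose j" for i j :: nat
      using binomial_symmetric[of i "i + j"] by (simp add: add.commute)
    have q: "?q = of_nat (((a' + a) choose a') * ((b' + b) choose b') * ((c' + c) choose c')) *
        (dE (a' + a) * hb 0 (b' + b) * dF (c' + c))"
      by (simp only: sym[of a a'] sym[of b b'] sym[of c c']) (simp only: add.commute[of a a'] add.commute[of b b'] add.commute[of c c'])
    have 1: "?x * ?y - ?q \<in> Kf (n + m - 1)"
      by (rule Kf_mono[OF Kf_gen_product]) (use gen \<open>int (a + b + c) \<le> n\<close> in simp)
    have 2: "?y * ?x - ?q \<in> Kf (n + m - 1)"
      unfolding q by (rule Kf_mono[OF Kf_gen_product]) (use gen \<open>int (a + b + c) \<le> n\<close> in simp)
    show ?case using Kf.diff[OF 1 2] by simp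
  next
    case (diff y z)
    then show ?case using Kf.diff[OF diff(3,4)] by (simp add: algebra_simps)
  qed (simp add: Kf.zero)
next
  case (diff x z)
  then show ?case using Kf.diff[OF diff(3,4)] by (simp add: algebra_simps)
qed (simp add: Kf.zero)

section \<open>Distributions and generators of U\<close>

text \<open>Translation by 1 permutes the field, so it does not change the sum of all elements;
  hence the cardinality is zero in the field and the characteristic divides it.\<close>

lemma prime_card_CHAR:
  assumes "Factorial_Ring.prime CARD('k::{field,finite})"
  shows "CHAR('k) = CARD('k)"
proof -
  have "(\<Sum>x\<in>UNIV. x) = (\<Sum>x\<in>UNIV. x + (1::'k))"
    by (rule sum.reindex_bij_witness[of _ "\<lambda>x. x + 1" "\<lambda>x. x - 1"]) auto
  then have "of_nat CARD('k) = (0::'k)" by (simp add: sum.distrib)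
  then have "CHAR('k) dvd CARD('k)" by (simp add: of_nat_eq_0_iff_char_dvd)
  moreover have "CHAR('k) \<noteq> 1" using of_nat_CHAR[where ?'a = 'k] by (metis of_nat_1 zero_neq_one)
  ultimately show ?thesis using assms by (auto simp: prime_nat_iff)
qed

lemma of_nat_eq_0_iff_card:
  assumes "Factorial_Ring.prime CARD('k::{field,finite})"
  shows "(of_nat n :: 'k) = 0 \<longleftrightarrow> CARD('k) dvd n"
  by (simp add: of_nat_eq_0_iff_char_dvd prime_card_CHAR[OF assms])

lemma of_nat_eqD_card:
  assumes "Factorial_Ring.prime CARD('k::{field,finite})" "(of_nat n :: 'k) = of_nat N" "n \<le> N"
  shows "\<exists>t. N = n + CARD('k) * t"
proof -
  have "(of_nat (N - n) :: 'k) = 0" using assms(2,3) by (simp add: of_nat_diff)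
  then obtain t where "N - n = CARD('k) * t" using of_nat_eq_0_iff_card[OF assms(1)] by (auto elim: dvdE)
  then show ?thesis using assms(3) by (intro exI[of _ t]) simp
qed

text \<open>The numbers below p have distinct images and there are p of them. Every scalar thus acts
  by repeated addition, which reduces linearity over the field to additivity.\<close>

lemma of_nat_surj_card:
  assumes "Factorial_Ring.prime CARD('k::{field,finite})"
  shows "\<exists>n. of_nat n = (c :: 'k)"
proof -
  have "inj_on (of_nat :: nat \<Rightarrow> 'k) {..<CARD('k)}"
  proof (rule linorder_inj_onI')
    fix i j assume *: "i \<in> {..<CARD('k)}" "j \<in> {..<CARD('k)}" "i < j"
    show "(of_nat i :: 'k) \<noteq> of_nat j"
    proof
      assume "(of_nat i :: 'k) = of_nat j"
      then obtain t where "j = i + CARD('k) * t" using of_nat_eqD_card[OF assms, of i j] * by auto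
      then show False using * by (cases t) auto
    qed
  qed
  then have "card (of_nat ` {..<CARD('k)} :: 'k set) = CARD('k)" by (simp add: card_image)
  then have "of_nat ` {..<CARD('k)} = (UNIV :: 'k set)" by (simp add: card_eq_UNIV_imp_eq_UNIV)
  then show ?thesis by (metis UNIV_I imageE)
qed

text \<open>Compares coefficients in (1 + X)^(p a + a0) = (1 + X^p)^a (1 + X)^a0. Since a0 and x0
  are below p, only the term with exponent p x of the first factor contributes: a smaller one leaves
  a degree above a0, a larger one overshoots.\<close>

lemma Lucas_step:
  assumes p: "Factorial_Ring.prime CARD('k::{field,finite})" and "a0 < CARD('k)" "x0 < CARD('k)"
  shows "(of_nat ((CARD('k) * a + a0) choose (CARD('k) * x + x0)) :: 'k) = of_nat (a choose x) * of_nat (a0 choose x0)"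
proof -
  let ?p = "CARD('k)" and ?f = "[:1, 1:] :: 'k poly"
  let ?n = "?p * x + x0"
  have c: "coeff (?f ^ n) i = of_nat (n choose i)" for n i
  proof (cases "i \<le> n")
    case False
    then have "degree (?f ^ n) < i" using degree_power_le[of ?f n] by simp
    then show ?thesis using False by (simp add: coeff_eq_0 binomial_eq_0)
  qed (simp add: coeff_linear_poly_power)
  have fp: "?f ^ ?p = monom 1 ?p + 1"
  proof -
    have "(monom 1 1 + 1 :: 'k poly) ^ ?p = monom 1 1 ^ ?p + 1 ^ ?p"
      by (rule freshmans_dream) (simp_all add: prime_card_CHAR[OF p] p)
    moreover have "?f = monom 1 1 + 1" by (simp add: monom_Suc one_pCons)
    ultimately show ?thesis by (simp add: monom_power)
  qed
  have "?f ^ (?p * a + a0) = (monom 1 ?p + 1) ^ a * ?f ^ a0"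
    by (simp only: power_add power_mult fp)
  also have "\<dots> = (\<Sum>i\<le>a. monom (of_nat (a choose i)) (?p * i) * ?f ^ a0)"
    by (simp add: binomial_ring monom_power sum_distrib_right of_nat_monom mult_monom)
  finally have "of_nat ((?p * a + a0) choose ?n) =
      (\<Sum>i\<le>a. coeff (monom (of_nat (a choose i)) (?p * i) * ?f ^ a0) ?n)"
    by (simp only: c[symmetric] coeff_sum)
  also have "\<dots> = (\<Sum>i\<le>a. if i = x then of_nat (a choose i) * of_nat (a0 choose x0) else (0::'k))"
  proof (rule sum.cong[OF refl])
    fix i
    consider "i = x" | "i < x" | "i > x" by linarith
    then show "coeff (monom (of_nat (a choose i)) (?p * i) * ?f ^ a0) ?n =
        (if i = x then of_nat (a choose i) * of_nat (a0 choose x0) else (0::'k))"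
    proof cases
      case 2
      then obtain j where "x = i + Suc j" using less_imp_Suc_add by fastforce
      then have "?n - ?p * i > a0" using assms by (simp add: algebra_simps)
      then show ?thesis using 2 by (simp add: coeff_monom_mult c binomial_eq_0)
    next
      case 3
      then obtain j where "i = x + Suc j" using less_imp_Suc_add by fastforce
      then have "\<not> ?p * i \<le> ?n" using assms by (simp add: algebra_simps)
      then show ?thesis using 3 by (simp add: coeff_monom_mult)
    qed (simp add: coeff_monom_mult c)
  qed
  also have "\<dots> = of_nat (a choose x) * of_nat (a0 choose x0)"
    by (simp add: sum.delta binomial_eq_0)
  finally show ?thesis .
qed

text \<open>
  The splitting proceeds digit by digit in base \<open>p\<close>, which keeps the binomial coefficients
  nonzero by Lucas' congruence.
\<close>

lemma split_order:
  assumes p: "Factorial_Ring.prime CARD('k::{field,finite})"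
    and "CARD('k) ^ m \<le> a + b + c" "a + b + c < 2 * CARD('k) ^ m"
  shows "\<exists>x y z. x \<le> a \<and> y \<le> b \<and> z \<le> c \<and> x + y + z = CARD('k) ^ m \<and>
    (of_nat (a choose x) :: 'k) \<noteq> 0 \<and> (of_nat (b choose y) :: 'k) \<noteq> 0 \<and> (of_nat (c choose z) :: 'k) \<noteq> 0"
  using assms(2,3)
proof (induction m arbitrary: a b c)
  case 0
  then show ?case by (intro exI[of _ a] exI[of _ b] exI[of _ c]) auto
next
  case (Suc m)
  let ?p = "CARD('k)"
  have p1: "?p > 1" using p by (rule prime_gt_1_nat)
  define a' a0 b' b0 c' c0 where d: "a' = a div ?p" "a0 = a mod ?p" "b' = b div ?p" "b0 = b mod ?p" "c' = c div ?p" "c0 = c mod ?p"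
  have e: "a = ?p * a' + a0" "b = ?p * b' + b0" "c = ?p * c' + c0" and l: "a0 < ?p" "b0 < ?p" "c0 < ?p"
    using p1 by (simp_all add: d)
  have "?p * (a' + b' + c') < ?p * (2 * ?p ^ m)"
    using Suc.prems(2) e by (simp add: algebra_simps)
  then have s: "a' + b' + c' < 2 * ?p ^ m" using p1 by (simp only: mult_less_cancel1)
  \<comment> \<open>For a0 < p the factorial of a0 is prime to p, and so are the binomial
    coefficients dividing it.\<close>
  have unit: "(of_nat (a0 choose x) :: 'k) \<noteq> 0" if "x \<le> a0" "a0 < ?p" for a0 x
    using that prime_dvd_fact_iff[OF p, of a0] binomial_fact_lemma[of x a0]
    by (metis dvd_mult of_nat_eq_0_iff_card[OF p] leD)
  \<comment> \<open>If the parts without the last digit already have sum at least p^m, they are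
    split by induction and the last digits stay behind. Otherwise they are taken whole, and the last
    digits supply the missing amount \<open>r\<close>.\<close>
  show ?case
  proof (cases "?p ^ m \<le> a' + b' + c'")
    case True
    then obtain x y z where xyz: "x \<le> a'" "y \<le> b'" "z \<le> c'" "x + y + z = ?p ^ m"
      "(of_nat (a' choose x) :: 'k) \<noteq> 0" "(of_nat (b' choose y) :: 'k) \<noteq> 0" "(of_nat (c' choose z) :: 'k) \<noteq> 0"
      using Suc.IH[OF True s] by blast
    have "?p * x + ?p * y + ?p * z = ?p ^ Suc m"
      using xyz(4) by (simp add: distrib_left[symmetric])
    moreover have "?p * x \<le> a" "?p * y \<le> b" "?p * z \<le> c"
      using e xyz(1-3) by (simp_all add: trans_le_add1)
    moreover have "(of_nat (a choose (?p * x)) :: 'k) \<noteq> 0" "(of_nat (b choose (?p * y)) :: 'k) \<noteq> 0"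
      "(of_nat (c choose (?p * z)) :: 'k) \<noteq> 0"
      using Lucas_step[OF p l(1), of 0 a' x] Lucas_step[OF p l(2), of 0 b' y] Lucas_step[OF p l(3), of 0 c' z]
        e xyz(5-7) p1 by simp_all
    ultimately show ?thesis by blast
  next
    case False
    define r where "r = ?p ^ Suc m - ?p * (a' + b' + c')"
    have "?p * (a' + b' + c') \<le> ?p ^ Suc m" using False by simp
    then have r: "r + ?p * (a' + b' + c') = ?p ^ Suc m" by (simp add: r_def)
    moreover have "?p ^ Suc m \<le> ?p * (a' + b' + c') + (a0 + b0 + c0)"
      using Suc.prems(1) e by (simp add: algebra_simps)
    ultimately have "r \<le> a0 + b0 + c0" by linarith
    then obtain x y z where xyz: "x \<le> a0" "y \<le> b0" "z \<le> c0" "x + y + z = r"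
    proof -
      assume *: "\<And>x y z. x \<le> a0 \<Longrightarrow> y \<le> b0 \<Longrightarrow> z \<le> c0 \<Longrightarrow> x + y + z = r \<Longrightarrow> thesis"
      show thesis
        using \<open>r \<le> a0 + b0 + c0\<close> by (intro *[of "min a0 r" "min b0 (r - min a0 r)" "r - min a0 r - min b0 (r - min a0 r)"]) auto
    qed
    have "(?p * a' + x) + (?p * b' + y) + (?p * c' + z) = ?p ^ Suc m"
      using r xyz(4) by (simp add: algebra_simps)
    moreover have "?p * a' + x \<le> a" "?p * b' + y \<le> b" "?p * c' + z \<le> c"
      using e xyz(1-3) by simp_all
    moreover have "(of_nat (a choose (?p * a' + x)) :: 'k) \<noteq> 0" "(of_nat (b choose (?p * b' + y)) :: 'k) \<noteq> 0"
      "(of_nat (c choose (?p * c' + z)) :: 'k) \<noteq> 0"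
      using Lucas_step[OF p l(1), of x a' a'] Lucas_step[OF p l(2), of y b' b'] Lucas_step[OF p l(3), of z c' c']
        e xyz(1-3) l unit by simp_all
    ultimately show ?thesis by blast
  qed
qed

section \<open>The Kostant form and its reduction modulo p\<close>

definition Kost :: "usl2 set" where "Kost = {x. rep_usl2 x \<in> carrier kostant}"

lemma kostant_gens_subset: "range kost_E \<union> range kost_F \<union> range kost_H \<subseteq> carrier env_alg"
  by (auto simp: kost_E_def kost_F_def kost_H_def env_class_simps)

lemma ring_kostant: "ring kostant"
  unfolding kostant_def by (rule Env.generate_ring_is_ring[OF kostant_gens_subset])

interpretation Kos: ring kostant by (rule ring_kostant)

lemma kostant_simps:
  "x \<oplus>\<^bsub>kostant\<^esub> y = x \<oplus>\<^bsub>env_alg\<^esub> y" "x \<otimes>\<^bsub>kostant\<^esub> y = x \<otimes>\<^bsub>env_alg\<^esub> y"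
  "\<one>\<^bsub>kostant\<^esub> = \<one>\<^bsub>env_alg\<^esub>" "\<zero>\<^bsub>kostant\<^esub> = \<zero>\<^bsub>env_alg\<^esub>"
  by (simp_all add: kostant_def)

lemma rep_kostant:
  "rep_usl2 0 = \<zero>\<^bsub>kostant\<^esub>" "rep_usl2 1 = \<one>\<^bsub>kostant\<^esub>"
  "rep_usl2 (x + y) = rep_usl2 x \<oplus>\<^bsub>kostant\<^esub> rep_usl2 y"
  "rep_usl2 (x * y) = rep_usl2 x \<otimes>\<^bsub>kostant\<^esub> rep_usl2 y"
  by (simp_all add: kostant_simps rep_usl2_simps)

lemma Kost_basic: "dE n \<in> Kost" "dF n \<in> Kost" "hb 0 n \<in> Kost"
  by (auto simp: Kost_def rep_dE rep_dF rep_hb kostant_def intro!: generate_ring.incl)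

lemma Kost_closed:
  "0 \<in> Kost" "1 \<in> Kost" "x \<in> Kost \<Longrightarrow> y \<in> Kost \<Longrightarrow> x + y \<in> Kost"
  "x \<in> Kost \<Longrightarrow> y \<in> Kost \<Longrightarrow> x * y \<in> Kost"
  by (simp_all add: Kost_def rep_kostant)

lemma Kost_uminus: "x \<in> Kost \<Longrightarrow> - x \<in> Kost"
  by (auto simp: Kost_def rep_usl2_simps kostant_def intro: generate_ring.a_inv)

lemma Kost_diff: "x \<in> Kost \<Longrightarrow> y \<in> Kost \<Longrightarrow> x - y \<in> Kost"
  using Kost_closed(3)[OF _ Kost_uminus[of y]] by simp

lemma Kost_of_nat: "x \<in> Kost \<Longrightarrow> of_nat n * x \<in> Kost"
  by (induction n) (simp_all add: Kost_closed distrib_right)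

lemma Kf_Kost: "x \<in> Kf n \<Longrightarrow> x \<in> Kost"
  by (induction rule: Kf.induct) (auto intro: Kost_closed Kost_basic Kost_diff)

lemma kostant_rep: "y \<in> carrier kostant \<Longrightarrow> \<exists>x\<in>Kost. y = rep_usl2 x"
proof -
  assume *: "y \<in> carrier kostant"
  then have "y \<in> carrier env_alg"
    using Env.generate_ring_incl[OF kostant_gens_subset] by (auto simp: kostant_def)
  then show ?thesis using * by (intro bexI[of _ "abs_usl2 y"]) (simp_all add: Kost_def)
qed

lemma kostant_add_pow: "add_pow kostant (n::nat) (rep_usl2 x) = rep_usl2 (of_nat n * x)"
  by (induction n) (simp_all add: add_pow_def nat_pow_def rep_kostant distrib_right
      kostant_simps rep_usl2_simps Env.a_comm)

lemma dist_ideal_eq: "dist_ideal p = {rep_usl2 (of_nat p * x) | x. x \<in> Kost}"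
proof -
  have "carrier kostant = rep_usl2 ` Kost"
    using kostant_rep by (auto simp: Kost_def)
  then show ?thesis by (simp add: dist_ideal_def Setcompr_eq_image image_image kostant_add_pow)
qed

lemma kostant_a_inv: "x \<in> Kost \<Longrightarrow> \<ominus>\<^bsub>kostant\<^esub> rep_usl2 x = rep_usl2 (- x)"
  by (rule Kos.minus_equality)
    (use Kost_uminus[of x] in \<open>simp_all add: rep_kostant(3)[symmetric] rep_kostant(1) Kost_def\<close>)

lemma dist_ideal: "ideal (dist_ideal p) kostant"
proof (rule idealI[OF ring_kostant])
  show "subgroup (dist_ideal p) (add_monoid kostant)"
  proof (rule Kos.add.subgroupI)
    show "dist_ideal p \<subseteq> carrier kostant"
      using Kost_of_nat by (auto simp: dist_ideal_eq Kost_def)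
    show "dist_ideal p \<noteq> {}" by (auto simp: dist_ideal_eq intro: Kost_closed)
    fix y z assume y: "y \<in> dist_ideal p" and z: "z \<in> dist_ideal p"
    obtain u where u: "u \<in> Kost" "y = rep_usl2 (of_nat p * u)" using y by (auto simp: dist_ideal_eq)
    obtain v where v: "v \<in> Kost" "z = rep_usl2 (of_nat p * v)" using z by (auto simp: dist_ideal_eq)
    have "\<ominus>\<^bsub>kostant\<^esub> y = rep_usl2 (of_nat p * (- u))"
      using kostant_a_inv[OF Kost_of_nat[OF u(1)]] u by simp
    then show "\<ominus>\<^bsub>kostant\<^esub> y \<in> dist_ideal p" using Kost_uminus[OF u(1)] unfolding dist_ideal_eq by blast
    have "y \<oplus>\<^bsub>kostant\<^esub> z = rep_usl2 (of_nat p * (u + v))"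
      by (simp add: u v distrib_left rep_kostant)
    then show "y \<oplus>\<^bsub>kostant\<^esub> z \<in> dist_ideal p" using Kost_closed(3)[OF u(1) v(1)] unfolding dist_ideal_eq by blast
  qed
  fix y z assume y: "y \<in> dist_ideal p" and z: "z \<in> carrier kostant"
  obtain u where u: "u \<in> Kost" "y = rep_usl2 (of_nat p * u)" using y by (auto simp: dist_ideal_eq)
  obtain v where v: "v \<in> Kost" "z = rep_usl2 v" using kostant_rep[OF z] by blast
  have "z \<otimes>\<^bsub>kostant\<^esub> y = rep_usl2 (of_nat p * (v * u))" "y \<otimes>\<^bsub>kostant\<^esub> z = rep_usl2 (of_nat p * (u * v))"
    by (simp_all only: u v rep_kostant(4)[symmetric] of_nat_left_commute mult.assoc)
  then show "z \<otimes>\<^bsub>kostant\<^esub> y \<in> dist_ideal p" "y \<otimes>\<^bsub>kostant\<^esub> z \<in> dist_ideal p"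
    using Kost_closed(4)[OF u(1) v(1)] Kost_closed(4)[OF v(1) u(1)] unfolding dist_ideal_eq by blast+
qed

definition dist_of :: "'k::{field,finite} itself \<Rightarrow> usl2 \<Rightarrow> sl2_free set set" where
  "dist_of k x = dist_class k (rep_usl2 x)"

lemma dist_gens: "dist_E k n = dist_of k (dE n)" "dist_F k n = dist_of k (dF n)" "dist_H k n = dist_of k (hb 0 n)"
  by (simp_all add: dist_of_def dist_E_def dist_F_def dist_H_def rep_dE rep_dF rep_hb)

locale prime_card =
  fixes k :: "'k::{field,finite} itself"
  assumes p: "Factorial_Ring.prime CARD('k)" and k: "k = TYPE('k)"
begin

abbreviation "A \<equiv> dist_alg :: ('k, sl2_free set set) module"

lemma A_simps:
  "carrier A = carrier (kostant Quot dist_ideal CARD('k))"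
  "monoid.mult A = monoid.mult (kostant Quot dist_ideal CARD('k))"
  "one A = one (kostant Quot dist_ideal CARD('k))"
  "ring.zero A = ring.zero (kostant Quot dist_ideal CARD('k))"
  "add A = add (kostant Quot dist_ideal CARD('k))"
  "module.smult A c x = add_pow (kostant Quot dist_ideal CARD('k)) (SOME n::nat. of_nat n = c) x"
  by (simp_all add: dist_alg_def ring.defs module.defs)

sublocale Di: ideal "dist_ideal CARD('k)" kostant by (rule dist_ideal)

sublocale A: ring A
  by (rule ring_cong[OF Di.quotient_is_ring]) (simp_all add: A_simps)

lemma dist_of_eq: "dist_of k x = dist_ideal CARD('k) +>\<^bsub>kostant\<^esub> rep_usl2 x"
  by (simp add: dist_of_def dist_class_def)

lemma dist_of_closed: "x \<in> Kost \<Longrightarrow> dist_of k x \<in> carrier A"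
  by (auto simp: A_simps dist_of_eq FactRing_def A_RCOSETS_def' Kost_def)

lemma dist_of_add: "x \<in> Kost \<Longrightarrow> y \<in> Kost \<Longrightarrow> dist_of k x \<oplus>\<^bsub>A\<^esub> dist_of k y = dist_of k (x + y)"
  using Di.rcos_ring_hom by (simp add: A_simps dist_of_eq ring_hom_def Kost_def rep_kostant)

lemma dist_of_mult: "x \<in> Kost \<Longrightarrow> y \<in> Kost \<Longrightarrow> dist_of k x \<otimes>\<^bsub>A\<^esub> dist_of k y = dist_of k (x * y)"
  using Di.rcos_ring_hom by (simp add: A_simps dist_of_eq ring_hom_def Kost_def rep_kostant)

lemma dist_of_one: "\<one>\<^bsub>A\<^esub> = dist_of k 1"
  using Di.rcos_ring_hom by (simp add: A_simps dist_of_eq ring_hom_def rep_kostant)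

lemma dist_of_zero: "\<zero>\<^bsub>A\<^esub> = dist_of k 0"
  using dist_of_add[of 0 0] dist_of_closed[of 0] Kost_closed(1) A.add.l_cancel[of "dist_of k 0" "dist_of k 0" "\<zero>\<^bsub>A\<^esub>"] by simp

lemma dist_of_uminus: "x \<in> Kost \<Longrightarrow> \<ominus>\<^bsub>A\<^esub> dist_of k x = dist_of k (- x)"
  by (rule A.minus_equality) (simp_all add: dist_of_add dist_of_zero dist_of_closed Kost_uminus)

lemma dist_of_diff: "x \<in> Kost \<Longrightarrow> y \<in> Kost \<Longrightarrow> dist_of k x \<ominus>\<^bsub>A\<^esub> dist_of k y = dist_of k (x - y)"
  by (simp add: a_minus_def dist_of_uminus dist_of_add Kost_uminus)

lemma dist_of_p:
  assumes "x \<in> Kost"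
  shows "dist_of k (of_nat CARD('k) * x) = dist_of k 0"
proof -
  let ?y = "rep_usl2 (of_nat CARD('k) * x)"
  have y: "?y \<in> carrier kostant" using Kost_of_nat[OF assms] by (simp add: Kost_def)
  have "?y \<ominus>\<^bsub>kostant\<^esub> \<zero>\<^bsub>kostant\<^esub> = ?y" using y by (simp add: a_minus_def)
  moreover have "?y \<in> dist_ideal CARD('k)" using assms by (auto simp: dist_ideal_eq)
  ultimately have "?y \<ominus>\<^bsub>kostant\<^esub> \<zero>\<^bsub>kostant\<^esub> \<in> dist_ideal CARD('k)" by simp
  then show ?thesis
    unfolding dist_of_eq rep_kostant(1)
    using Kos.quotient_eq_iff_same_a_r_cos[OF dist_ideal y Kos.zero_closed] by blast
qed

lemma dist_of_add_p: "x \<in> Kost \<Longrightarrow> dist_of k (of_nat (n + CARD('k) * t) * x) = dist_of k (of_nat n * x)"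
proof -
  assume x: "x \<in> Kost"
  have "of_nat (n + CARD('k) * t) * x = of_nat n * x + of_nat CARD('k) * (of_nat t * x)"
    by (simp add: distrib_right mult.assoc)
  then show ?thesis
    using dist_of_add[of "of_nat n * x" "of_nat CARD('k) * (of_nat t * x)"] dist_of_p[of "of_nat t * x"] x Kost_of_nat
      dist_of_add[of "of_nat n * x" 0] Kost_closed(1)
    by simp
qed

lemma dist_of_cong: "x \<in> Kost \<Longrightarrow> (of_nat n :: 'k) = of_nat N \<Longrightarrow> dist_of k (of_nat n * x) = dist_of k (of_nat N * x)"
  using of_nat_eqD_card[OF p, of n N] of_nat_eqD_card[OF p, of N n] dist_of_add_p by (metis nat_le_linear)

text \<open>A scalar acts through a representative chosen by \<open>SOME\<close>. Any two
  representatives differ by a multiple of p, which acts as zero on the quotient.\<close>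

lemma dist_of_smult: "x \<in> Kost \<Longrightarrow> of_nat n \<odot>\<^bsub>A\<^esub> dist_of k x = dist_of k (of_nat n * x)"
proof -
  assume x: "x \<in> Kost"
  have "add_pow (kostant Quot dist_ideal CARD('k)) (N::nat) (dist_of k x) = dist_of k (of_nat N * x)" for N
  proof (induction N)
    case 0
    show ?case by (simp add: add_pow_def nat_pow_def A_simps(4)[symmetric] dist_of_zero)
  next
    case (Suc N)
    have "add_pow (kostant Quot dist_ideal CARD('k)) (Suc N) (dist_of k x) = add_pow (kostant Quot dist_ideal CARD('k)) N (dist_of k x) \<oplus>\<^bsub>A\<^esub> dist_of k x"
      by (simp add: add_pow_def nat_pow_def A_simps(5))
    then show ?case using x by (simp add: Suc dist_of_add Kost_of_nat distrib_right add.commute)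
  qed
  then have "of_nat n \<odot>\<^bsub>A\<^esub> dist_of k x = dist_of k (of_nat (SOME N. (of_nat N :: 'k) = of_nat n) * x)"
    by (simp add: A_simps(6))
  also have "\<dots> = dist_of k (of_nat n * x)"
    by (rule dist_of_cong[OF x]) (rule someI[of "\<lambda>N. (of_nat N :: 'k) = of_nat n" n], rule refl)
  finally show ?thesis .
qed

text \<open>The span over the prime field is the reduction of the integral span, as every scalar is
  the image of a natural number. The filtration so inherits the multiplicative properties of
  \<open>Kf\<close>.\<close>

lemma dist_filt_eq: "dist_filt k n = dist_of k ` Kf (int n)"
proof
  let ?K = "ring_of_type_algebra :: 'k ring"
  let ?B = "{dist_E k a \<otimes>\<^bsub>A\<^esub> dist_H k b \<otimes>\<^bsub>A\<^esub> dist_F k c | a b c. a + b + c \<le> n}"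
  have B: "dist_E k a \<otimes>\<^bsub>A\<^esub> dist_H k b \<otimes>\<^bsub>A\<^esub> dist_F k c = dist_of k (dE a * hb 0 b * dF c)" for a b c
    by (simp add: dist_gens dist_of_mult Kost_basic Kost_closed)
  have filt: "dist_filt k n = \<Inter>{N. submodule N ?K A \<and> ?B \<subseteq> N}"
    by (simp add: dist_filt_def lin_span_def)
  have sub: "submodule (dist_of k ` Kf (int n)) ?K A"
  proof (intro submodule.intro subgroup.intro submodule_axioms.intro)
    show "dist_of k ` Kf (int n) \<subseteq> carrier (add_monoid A)" using dist_of_closed Kf_Kost by auto
    show "x \<otimes>\<^bsub>add_monoid A\<^esub> y \<in> dist_of k ` Kf (int n)" if "x \<in> dist_of k ` Kf (int n)" "y \<in> dist_of k ` Kf (int n)" for x y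
      using that by (auto simp: dist_of_add Kf_Kost intro: Kf_closed(2))
    show "\<one>\<^bsub>add_monoid A\<^esub> \<in> dist_of k ` Kf (int n)" by (auto simp: dist_of_zero intro: Kf.zero)
    show "inv\<^bsub>add_monoid A\<^esub> x \<in> dist_of k ` Kf (int n)" if "x \<in> dist_of k ` Kf (int n)" for x
      using that by (auto simp: a_inv_def[symmetric] dist_of_uminus Kf_Kost intro: Kf_closed(1))
    show "c \<odot>\<^bsub>A\<^esub> x \<in> dist_of k ` Kf (int n)" if "x \<in> dist_of k ` Kf (int n)" for c x
    proof -
      obtain N where "c = of_nat N" using of_nat_surj_card[OF p] by metis
      then show ?thesis using that by (auto simp: dist_of_smult Kf_Kost intro: Kf_closed(3))
    qed
  qed
  have "?B \<subseteq> dist_of k ` Kf (int n)" by (auto simp: B intro!: imageI Kf.gen)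
  with sub show "dist_filt k n \<subseteq> dist_of k ` Kf (int n)" unfolding filt by blast
  show "dist_of k ` Kf (int n) \<subseteq> dist_filt k n"
    unfolding filt
  proof clarify
    fix x N assume x: "x \<in> Kf (int n)" and N: "submodule N ?K A" and BN: "?B \<subseteq> N"
    interpret N: submodule N ?K A by (rule N)
    from x show "dist_of k x \<in> N"
    proof (induction rule: Kf.induct)
      case zero
      show ?case using N.one_closed by (simp add: dist_of_zero)
    next
      case (gen a b c)
      then have "a + b + c \<le> n" by simp
      then have "dist_of k (dE a * hb 0 b * dF c) \<in> ?B" unfolding B[symmetric] by blast
      then show ?case using BN by blast
    next
      case (diff x y)
      have "dist_of k x \<ominus>\<^bsub>A\<^esub> dist_of k y \<in> N"
        using N.m_closed[OF diff(3) N.m_inv_closed[OF diff(4)]] by (simp add: a_minus_def a_inv_def)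
      then show ?case using diff by (simp add: dist_of_diff Kf_Kost)
    qed
  qed
qed

end

lemma Kf_basic: "dE n \<in> Kf (int n)" "dF n \<in> Kf (int n)" "hb z n \<in> Kf (int n)" "1 \<in> Kf 0"
  using Kf.gen[of n 0 0 "int n"] Kf.gen[of 0 0 n "int n"] Kf_EHF[OF hb_in_Hspan, of 0 n 0 "int n" z]
    Kf.gen[of 0 0 0 0] by simp_all

section \<open>Generators of the level algebra of distributions\<close>

locale U_level = prime_card k for k :: "'k::{field,finite} itself" +
  fixes m q :: nat
  assumes q: "q = CARD('k) ^ m"
begin

lemma q_pos: "q \<ge> 1" "q > 0"
  using prime_gt_0_nat[OF p] by (simp_all add: q Suc_le_eq)

text \<open>Both bounds meet 2 q - 1 exactly: commutators of order q + q - 1 by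
  \<open>Kf_commutator\<close>, and products of order (q - 1) + q by \<open>Kf_mult\<close>.\<close>

sublocale level_data A "dist_filt k" q "U_pairs k m"
proof
  let ?S = "dist_filt k (2 * q - 1)"
  note S = dist_filt_eq
  show "x \<oplus>\<^bsub>A\<^esub> y \<in> ?S" if "x \<in> ?S" "y \<in> ?S" for x y
    using that by (auto simp: S dist_of_add Kf_Kost intro!: imageI Kf_closed(2))
  show "c \<odot>\<^bsub>A\<^esub> x \<in> ?S" if "x \<in> ?S" for c x
  proof -
    obtain N where "c = of_nat N" using of_nat_surj_card[OF p] by metis
    then show ?thesis using that by (auto simp: S dist_of_smult Kf_Kost intro!: imageI Kf_closed(3))
  qed
  show "\<one>\<^bsub>A\<^esub> \<in> ?S"
    unfolding S dist_of_one by (rule imageI, rule Kf_mono[OF Kf_basic(4)]) simp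
  show "x \<in> ?S" if "x \<in> dist_filt k q" for x
  proof -
    obtain u where u: "u \<in> Kf (int q)" "x = dist_of k u" using \<open>x \<in> dist_filt k q\<close> by (auto simp: S)
    have "u \<in> Kf (int (2 * q - 1))" by (rule Kf_mono[OF u(1)]) simp
    then show ?thesis by (simp only: S u(2) imageI)
  qed
  show "x \<otimes>\<^bsub>A\<^esub> y \<ominus>\<^bsub>A\<^esub> y \<otimes>\<^bsub>A\<^esub> x \<in> ?S" if "x \<in> dist_filt k q" "y \<in> dist_filt k q" for x y
  proof -
    obtain u v where uv: "u \<in> Kf (int q)" "v \<in> Kf (int q)" "x = dist_of k u" "y = dist_of k v"
      using \<open>x \<in> dist_filt k q\<close> \<open>y \<in> dist_filt k q\<close> by (auto simp: S)
    have "x \<otimes>\<^bsub>A\<^esub> y \<ominus>\<^bsub>A\<^esub> y \<otimes>\<^bsub>A\<^esub> x = dist_of k (u * v - v * u)"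
      using uv by (simp add: dist_of_mult dist_of_diff Kf_Kost Kost_closed)
    moreover have "u * v - v * u \<in> Kf (int (2 * q - 1))"
      by (rule Kf_mono[OF Kf_commutator[OF uv(1,2)]]) (use q_pos in simp)
    ultimately show ?thesis by (simp only: S imageI)
  qed
  show "x \<in> ?S \<and> y \<in> ?S \<and> x \<otimes>\<^bsub>A\<^esub> y \<in> ?S" if "(x, y) \<in> U_pairs k m" for x y
  proof -
    obtain u v where uv: "u \<in> Kf (int (q - 1))" "v \<in> Kf (int q)" "x = dist_of k u" "y = dist_of k v"
      using \<open>(x, y) \<in> U_pairs k m\<close> by (auto simp: S U_pairs_def q)
    have "x \<otimes>\<^bsub>A\<^esub> y = dist_of k (u * v)" using uv by (simp add: dist_of_mult Kf_Kost)
    moreover have "u * v \<in> Kf (int (2 * q - 1))"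
      by (rule Kf_mono[OF Kf_mult[OF uv(1,2)]]) (use q_pos in simp)
    moreover have "u \<in> Kf (int (2 * q - 1))" "v \<in> Kf (int (2 * q - 1))"
      by (rule Kf_mono[OF uv(1)], simp) (rule Kf_mono[OF uv(2)], simp)
    ultimately show ?thesis by (simp only: S uv(3,4) imageI simp_thms)
  qed
qed

lemma U_alg_eq: "U_alg m = U" and U_gen_eq: "U_gen m a = gen a"
  by (simp_all add: U_alg_def U_gen_def k q)

abbreviation "G x \<equiv> gen (dist_of k x)"

lemma dist_of_in_S: "x \<in> Kf (int (2 * q - 1)) \<Longrightarrow> dist_of k x \<in> dist_filt k (2 * q - 1)"
  by (simp add: dist_filt_eq)

lemma G_closed: "x \<in> Kf (int (2 * q - 1)) \<Longrightarrow> G x \<in> carrier U"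
  by (simp only: gen_closed dist_of_in_S)

lemma G_add: "x \<in> Kf (int (2 * q - 1)) \<Longrightarrow> y \<in> Kf (int (2 * q - 1)) \<Longrightarrow> G (x + y) = G x \<oplus>\<^bsub>U\<^esub> G y"
  by (simp only: gen_add[symmetric] dist_of_in_S dist_of_add Kf_Kost)

lemma G_of_nat: "x \<in> Kf (int (2 * q - 1)) \<Longrightarrow> G (of_nat n * x) = of_nat n \<odot>\<^bsub>U\<^esub> G x"
  by (simp only: gen_smult[symmetric] dist_of_in_S dist_of_smult Kf_Kost)

lemma G_uminus:
  assumes "x \<in> Kf (int (2 * q - 1))"
  shows "G (- x) = (- 1) \<odot>\<^bsub>U\<^esub> G x"
proof -
  note K = assms Kf_closed(1)[OF assms]
  have "G (- x) \<oplus>\<^bsub>U\<^esub> G x = G (of_nat 0 * x)"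
    by (subst G_add[OF K(2,1), symmetric]) simp
  also have "\<dots> = \<zero>\<^bsub>U\<^esub>"
    unfolding G_of_nat[OF assms] using U.smult_l_zero[OF G_closed[OF assms]] by simp
  finally have "\<ominus>\<^bsub>U\<^esub> G x = G (- x)"
    by (rule U.minus_equality[OF _ G_closed[OF K(1)] G_closed[OF K(2)]])
  then show ?thesis using U.smult_minus_one[OF G_closed[OF assms]] by simp
qed

lemma G_one: "G 1 = \<one>\<^bsub>U\<^esub>"
proof -
  have "1 \<in> Kf (int (2 * q - 1))" by (rule Kf_mono[OF Kf_basic(4)]) simp
  then have "of_nat 1 \<odot>\<^bsub>A\<^esub> \<one>\<^bsub>A\<^esub> = dist_of k 1" unfolding dist_of_one by (subst dist_of_smult) (simp_all add: Kf_Kost)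
  then show ?thesis using gen_one[of 1] by simp
qed

lemma Kf_lower: "x \<in> Kf (int (q - 1)) \<Longrightarrow> x \<in> Kf (int (2 * q - 1))" "x \<in> Kf (int q) \<Longrightarrow> x \<in> Kf (int (2 * q - 1))"
  by (erule Kf_mono, simp)+

lemma G_mult:
  assumes "x \<in> Kf (int (q - 1))" "y \<in> Kf (int q)"
  shows "G (x * y) = G x \<otimes>\<^bsub>U\<^esub> G y" "x * y \<in> Kf (int (2 * q - 1))"
proof -
  have "(dist_of k x, dist_of k y) \<in> U_pairs k m" using assms by (auto simp: U_pairs_def dist_filt_eq q)
  from gen_mult[OF this] show "G (x * y) = G x \<otimes>\<^bsub>U\<^esub> G y"
    using assms by (simp add: dist_of_mult Kf_Kost)
  show "x * y \<in> Kf (int (2 * q - 1))"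
    by (rule Kf_mono[OF Kf_mult[OF assms]]) (use q_pos in simp)
qed

lemma G_commutator:
  assumes "x \<in> Kf (int q)" "y \<in> Kf (int q)"
  shows "G x \<otimes>\<^bsub>U\<^esub> G y = G y \<otimes>\<^bsub>U\<^esub> G x \<oplus>\<^bsub>U\<^esub> G (x * y - y * x)"
proof -
  have "dist_of k x \<in> dist_filt k q" "dist_of k y \<in> dist_filt k q" using assms by (auto simp: dist_filt_eq)
  from gen_commutator[OF this] show ?thesis
    using assms by (simp add: dist_of_mult dist_of_diff Kf_Kost Kost_closed)
qed

text \<open>
  A basis element of order at most \<open>2 q - 1\<close> is split into factors of orders at most \<open>q - 1\<close> and
  \<open>q\<close>, which the defining relations allow to multiply. The elements \<open>H choose n\<close> are recovered
  from the expansion of \<open>E^[n] F^[n]\<close>, for \<open>n = q\<close> from the commutator of the two factors.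
\<close>

lemma E_F_generate_induct:
  assumes u: "u \<in> carrier U"
    and add: "\<And>x y. x \<in> carrier U \<Longrightarrow> y \<in> carrier U \<Longrightarrow> P x \<Longrightarrow> P y \<Longrightarrow> P (x \<oplus>\<^bsub>U\<^esub> y)"
    and mult: "\<And>x y. x \<in> carrier U \<Longrightarrow> y \<in> carrier U \<Longrightarrow> P x \<Longrightarrow> P y \<Longrightarrow> P (x \<otimes>\<^bsub>U\<^esub> y)"
    and smult: "\<And>c x. x \<in> carrier U \<Longrightarrow> P x \<Longrightarrow> P (c \<odot>\<^bsub>U\<^esub> x)"
    and E: "\<And>i. i \<le> q \<Longrightarrow> P (G (dE i))"
    and F: "\<And>i. i \<le> q \<Longrightarrow> P (G (dF i))"
  shows "P u"
proof -
  \<comment> \<open>The property is transported to integral representatives, where straightening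
    identities are available. \<open>R\<close> is closed under differences, but under products only
    for factors of orders q - 1 and q.\<close>
  define R where "R = {x \<in> Kf (int (2 * q - 1)). P (G x)}"
  have R_Kf: "x \<in> Kf (int (2 * q - 1))" "P (G x)" if "x \<in> R" for x using that by (auto simp: R_def)
  have R_add: "x + y \<in> R" if "x \<in> R" "y \<in> R" for x y
    using R_Kf[OF that(1)] R_Kf[OF that(2)] by (simp add: R_def Kf_closed(2) G_add add G_closed del: One_nat_def)
  have R_uminus: "- x \<in> R" if "x \<in> R" for x
    using R_Kf[OF that] by (simp add: R_def Kf_closed(1) G_uminus smult G_closed del: One_nat_def)
  have one: "1 \<in> R" using E[of 0] Kf_mono[OF Kf_basic(4)] by (simp add: R_def)
  have zero: "0 \<in> R" using R_add[OF one R_uminus[OF one]] by simp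
  have R_diff: "x - y \<in> R" if "x \<in> R" "y \<in> R" for x y
    using R_add[OF that(1) R_uminus[OF that(2)]] by simp
  have dcR: "diff_closed R" using zero R_diff by (auto simp: diff_closed_def)
  note R_closed = diff_closed_imp[OF dcR]
  have R_mult: "x * y \<in> R" if "x \<in> R" "y \<in> R" "x \<in> Kf (int (q - 1))" "y \<in> Kf (int q)" for x y
    using R_Kf[OF that(1)] R_Kf[OF that(2)] G_mult[OF that(3,4)]
    by (simp add: R_def mult G_closed del: One_nat_def)
  have RE: "dE i \<in> R" and RF: "dF i \<in> R" if "i \<le> q" for i
    using E[OF that] F[OF that] Kf_lower(2)[OF Kf_mono[OF Kf_basic(1)[of i]]] Kf_lower(2)[OF Kf_mono[OF Kf_basic(2)[of i]]] that
    by (auto simp: R_def)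
  have Rspan: "x \<in> R" if "\<And>j. j \<le> n \<Longrightarrow> hb 0 j \<in> R" "x \<in> Hspan 0 (int n)" for x n
    using that(2) by (induction rule: Hspan.induct) (use that(1) zero R_diff in auto)
  have FHE: "dF c * hb z b * dE a \<in> R"
    if "hb z b \<in> R" "c \<le> q - 1" "b \<le> q - 1" "a + b \<le> q" for a b c z
  proof -
    have "hb z b * dE a \<in> R"
      using that by (intro R_mult RE Kf_mono[OF Kf_basic(3)] Kf_mono[OF Kf_basic(1)]) auto
    moreover have "hb z b * dE a \<in> Kf (int q)"
      by (rule Kf_mono[OF Kf_mult[OF Kf_basic(3) Kf_basic(1)]]) (use that in simp)
    ultimately have "dF c * (hb z b * dE a) \<in> R"
      using that by (intro R_mult[of "dF c" "hb z b * dE a"] RF Kf_mono[OF Kf_basic(2)]) auto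
    then show ?thesis by (simp add: mult.assoc)
  qed
  have hb0: "hb 0 n \<in> R" if "n \<le> q" for n
    using that
  proof (induction n rule: less_induct)
    case (less n)
    have hbz: "hb z j \<in> R" if "j < n" for z j
    proof (rule Rspan[OF _ hb_in_Hspan])
      fix i assume "i \<le> j"
      then show "hb 0 i \<in> R" using less that by auto
    qed
    have terms: "EF_term n n j \<in> R" if "0 < j" "j < n" for j
      unfolding EF_term_def using that less.prems by (auto intro!: FHE hbz)
    \<comment> \<open>The last term of the formula for \<open>E^[n] F^[n]\<close> is the bare
      binomial of H over n, since its shift 2 n - n - n is zero. The middle terms contain binomials
      of smaller degree.\<close>
    have expand: "dE n * dF n = EF_term n n 0 + (\<Sum>j\<in>{1..<n}. EF_term n n j) + hb 0 n" if "n > 0"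
    proof -
      have "{..n} = insert 0 (insert n {1..<n})" using that by auto
      then show ?thesis unfolding EF_formula using that by (simp add: EF_term_def)
    qed
    have mid: "(\<Sum>j\<in>{1..<n}. EF_term n n j) \<in> R"
      by (rule R_closed(4)) (use terms in auto)
    have EF0: "EF_term n n 0 = dF n * dE n" by (simp add: EF_term_def)
    consider "n = 0" | "0 < n" "n < q" | "0 < n" "n = q" using less.prems by linarith
    then show ?case
    proof cases
      case 1
      then show ?thesis using one by simp
    next
      case 2
      then have "dE n * dF n \<in> R" "dF n * dE n \<in> R"
        by (auto intro!: R_mult RE RF Kf_mono[OF Kf_basic(1)] Kf_mono[OF Kf_basic(2)])
      then have "dE n * dF n - dF n * dE n - (\<Sum>j\<in>{1..<n}. EF_term n n j) \<in> R"
        using R_diff mid by blast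
      then show ?thesis using expand[OF 2(1)] EF0 by simp
    next
      case 3
      have EFq: "dE n \<in> Kf (int q)" "dF n \<in> Kf (int q)" using Kf_basic(1,2)[of n] 3 by auto
      let ?e = "G (dE n)" and ?f = "G (dF n)" and ?c = "dE n * dF n - dF n * dE n"
      have c: "?c \<in> Kf (int (2 * q - 1))"
        by (rule Kf_mono[OF Kf_commutator[OF EFq]]) (use q_pos in simp)
      have carr: "?e \<in> carrier U" "?f \<in> carrier U" "G ?c \<in> carrier U"
        by (rule G_closed, rule Kf_lower(2), rule EFq)+ (rule G_closed[OF c])
      have "G ?c = ?e \<otimes>\<^bsub>U\<^esub> ?f \<oplus>\<^bsub>U\<^esub> (- 1) \<odot>\<^bsub>U\<^esub> (?f \<otimes>\<^bsub>U\<^esub> ?e)"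
        using carr by (simp add: G_commutator[OF EFq] U.smult_minus_one U.a_comm[of "?f \<otimes>\<^bsub>U\<^esub> ?e" "G ?c"] U.a_assoc U.r_neg)
      moreover have "P (?e \<otimes>\<^bsub>U\<^esub> ?f \<oplus>\<^bsub>U\<^esub> (- 1) \<odot>\<^bsub>U\<^esub> (?f \<otimes>\<^bsub>U\<^esub> ?e))"
        using carr E[of n] F[of n] 3 by (intro add mult smult) auto
      ultimately have "?c \<in> R" using c by (simp add: R_def)
      then have "?c - (\<Sum>j\<in>{1..<n}. EF_term n n j) \<in> R" by (rule R_diff[OF _ mid])
      then show ?thesis using expand[OF 3(1)] EF0 by simp
    qed
  qed
  have hbR: "hb z n \<in> R" if "n \<le> q" for z n
    by (rule Rspan[OF _ hb_in_Hspan]) (use that hb0 in auto)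
  have Kq: "x \<in> R" if "x \<in> Kf (int q)" for x
    using that
  proof (induction rule: Kf.induct)
    case (gen a b c)
    then have abc: "a + b + c \<le> q" by simp
    show ?case
    proof (cases "a = q")
      case True
      then have "b = 0" "c = 0" using abc by auto
      then show ?thesis using RE[of a] True by simp
    next
      case False
      have "hb 0 b * dF c \<in> R"
      proof (cases "b = q")
        case True
        then have "c = 0" using abc by auto
        then show ?thesis using hbR[of b 0] True by simp
      next
        case False
        then show ?thesis using abc
          by (intro R_mult hbR RF Kf_mono[OF Kf_basic(3)] Kf_mono[OF Kf_basic(2)]) auto
      qed
      moreover have "hb 0 b * dF c \<in> Kf (int q)"
        by (rule Kf_mono[OF Kf_mult[OF Kf_basic(3) Kf_basic(2)]]) (use abc in simp)
      ultimately have "dE a * (hb 0 b * dF c) \<in> R"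
        using abc False by (intro R_mult[of "dE a" "hb 0 b * dF c"] RE Kf_mono[OF Kf_basic(1)]) auto
      then show ?thesis by (simp add: mult.assoc)
    qed
  qed (auto intro: zero R_diff)
  have all: "x \<in> R" if "x \<in> Kf (int (2 * q - 1))" for x
    using that
  proof (induction rule: Kf.induct)
    case (gen a b c)
    then have abc: "a + b + c < 2 * q" using q_pos by simp
    show ?case
    proof (cases "a + b + c \<le> q")
      case True
      then show ?thesis by (intro Kq Kf.gen) simp
    next
      case False
      \<comment> \<open>The part of order exactly q becomes the right factor and the complement, of
        order at most q - 1, the left one, as \<open>U_pairs\<close> prescribes.\<close>
      obtain x y z where s: "x \<le> a" "y \<le> b" "z \<le> c" "x + y + z = q"
        "(of_nat (a choose x) :: 'k) \<noteq> 0" "(of_nat (b choose y) :: 'k) \<noteq> 0" "(of_nat (c choose z) :: 'k) \<noteq> 0"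
        using split_order[OF p, of m a b c] abc False unfolding q by (metis nat_le_linear)
      define x' y' z' where d: "x' = a - x" "y' = b - y" "z' = c - z"
      let ?N = "(a choose x) * (b choose y') * (c choose z)"
      have low: "x' + y' + z' \<le> q - 1" using s abc unfolding d by linarith
      have "dE x' * dE x = of_nat (a choose x) * dE a"
        using s(1) unfolding d dE_mult by (simp add: binomial_symmetric[of x a])
      moreover have "hb 0 y' * hb (- int y') y = of_nat (b choose y') * hb 0 b"
        using hb_mult[of 0 y' y] s(2) unfolding d by simp
      moreover have "dF z' * dF z = of_nat (c choose z) * dF c"
        using s(3) unfolding d dF_mult by (simp add: binomial_symmetric[of z c])
      ultimately have N: "of_nat ?N * (dE a * hb 0 b * dF c)
          = (dE x' * dE x) * (hb 0 y' * hb (- int y') y) * (dF z' * dF z)"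
        using of_nat_left_commute[of "dE a * hb 0 b" "c choose z" "dF c"] of_nat_left_commute[of "dE a" "b choose y'" "hb 0 b"]
        by (simp add: mult.assoc)
      \<comment> \<open>Joining the two pieces leaves \<open>dE x\<close> to the left of
        \<open>dF z'\<close>. Straightening these gives terms indexed by t, each cut into
        \<open>L t\<close> of order at most x' + y' + z' - t \<le> q - 1 and \<open>Q t\<close> of
        order at most t + (x - t) + y + z = q.\<close>
      define L where "L t = dE x' * hb (- 2 * int x) y' * dF (z' - t)" for t
      define Q where "Q t = hb (2 * int t - int x - int z') t * dE (x - t) * hb (- int y' - 2 * int z') y * dF z" for t
      have "dE x * hb 0 y' = hb (- 2 * int x) y' * dE x"
        using hb_dE[of "- 2 * int x" y' x] by simp
      moreover have "hb (- int y') y * dF z' = dF z' * hb (- int y' - 2 * int z') y"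
        by (rule hb_dF)
      ultimately have "(dE x' * dE x) * (hb 0 y' * hb (- int y') y) * (dF z' * dF z)
          = dE x' * hb (- 2 * int x) y' * (dE x * dF z') * hb (- int y' - 2 * int z') y * dF z"
        by (metis mult.assoc)
      also have "\<dots> = (\<Sum>t\<le>x. dE x' * hb (- 2 * int x) y' * EF_term x z' t * hb (- int y' - 2 * int z') y * dF z)"
        unfolding EF_formula by (simp add: sum_distrib_left sum_distrib_right)
      also have "\<dots> = (\<Sum>t\<le>x. if t \<le> z' then L t * Q t else 0)"
        by (rule sum.cong) (simp_all add: EF_term_def L_def Q_def mult.assoc)
      also have "\<dots> \<in> R"
      proof (rule R_closed(4))
        fix t assume t: "t \<in> {..x}"
        show "(if t \<le> z' then L t * Q t else 0) \<in> R"
        proof (cases "t \<le> z'")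
          case True
          have "L t \<in> Kf (int x' + int y' + int (z' - t))"
            unfolding L_def by (intro Kf_mult Kf_basic)
          then have L: "L t \<in> Kf (int (q - 1))" by (rule Kf_mono) (use low in simp)
          have "Q t \<in> Kf (int t + int (x - t) + int y + int z)"
            unfolding Q_def by (intro Kf_mult Kf_basic)
          then have Q: "Q t \<in> Kf (int q)" by (rule Kf_mono) (use s t in simp)
          show ?thesis using True R_mult[OF Kq[OF Kf_mono[OF L]] Kq[OF Q] L Q] by simp
        qed (simp add: zero)
      qed
      finally have NR: "of_nat ?N * (dE a * hb 0 b * dF c) \<in> R" unfolding N .
      have xK: "dE a * hb 0 b * dF c \<in> Kf (int (2 * q - 1))" by (rule Kf.gen[OF gen])
      \<comment> \<open>The split was chosen to make this coefficient a unit of the field, so the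
        monomial itself is a scalar multiple of an element already reached.\<close>
      have "(of_nat ?N :: 'k) \<noteq> 0"
        using s binomial_symmetric[of y b] unfolding d by simp
      then have "G (dE a * hb 0 b * dF c) = inverse (of_nat ?N) \<odot>\<^bsub>U\<^esub> G (of_nat ?N * (dE a * hb 0 b * dF c))"
        unfolding G_of_nat[OF xK] by (subst U.smult_assoc[symmetric]) (simp_all add: G_closed[OF xK] del: of_nat_mult)
      moreover have "P (inverse (of_nat ?N) \<odot>\<^bsub>U\<^esub> G (of_nat ?N * (dE a * hb 0 b * dF c)))"
        by (rule smult) (rule G_closed[OF R_Kf(1)[OF NR]], rule R_Kf(2)[OF NR])
      ultimately show ?thesis using xK by (simp add: R_def)
    qed
  qed (auto intro: zero R_diff)
  from u show "P u"
  proof (induction rule: U_induct)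
    case one
    show ?case using R_Kf(2)[OF \<open>1 \<in> R\<close>] by (simp add: G_one)
  next
    case (gen a)
    then obtain x where "x \<in> Kf (int (2 * q - 1))" "a = dist_of k x" by (auto simp: dist_filt_eq)
    then show ?case using R_Kf(2)[OF all] by simp
  qed (use add mult smult in auto)
qed

end

section \<open>Taylor expansions on the projective line\<close>

lemma poly_map_hom:
  fixes c :: "'k::field \<Rightarrow> 'b::comm_ring_1"
  assumes c: "c 0 = 0" "c 1 = 1" "\<And>a b. c (a + b) = c a + c b" "\<And>a b. c (a * b) = c a * c b"
  shows "poly (map_poly c (pCons a p)) x = c a + x * poly (map_poly c p) x"
    "poly (map_poly c (p + r)) x = poly (map_poly c p) x + poly (map_poly c r) x"
    "poly (map_poly c (Polynomial.smult a p)) x = c a * poly (map_poly c p) x"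
    "poly (map_poly c (p * r)) x = poly (map_poly c p) x * poly (map_poly c r) x"
proof -
  show pc: "poly (map_poly c (pCons a p)) x = c a + x * poly (map_poly c p) x" for a p
    by (simp add: map_poly_pCons c)
  show add: "poly (map_poly c (p + r)) x = poly (map_poly c p) x + poly (map_poly c r) x" for p r
    by (induction p r rule: poly_induct2) (simp_all add: pc c algebra_simps)
  show sm: "poly (map_poly c (Polynomial.smult a p)) x = c a * poly (map_poly c p) x" for a p
    by (induction p) (simp_all add: pc c algebra_simps)
  show "poly (map_poly c (p * r)) x = poly (map_poly c p) x * poly (map_poly c r) x"
    by (induction p) (simp_all add: pc c add sm algebra_simps)
qed

lemma const_simps [simp]:
  "const 0 = 0" "const 1 = 1" "const (a + b) = const a + const b" "const (a * b) = const a * const b"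
proof -
  show "const 0 = 0" "const 1 = 1" by (simp_all add: const_def one_pCons[symmetric])
  show "const (a + b) = const a + const b" "const (a * b) = const a * const b"
    by (simp_all add: const_def to_fract_add[symmetric] to_fract_mult[symmetric] del: to_fract_add to_fract_mult)
qed

lemma const_of_nat [simp]: "const (of_nat n) = of_nat n"
  by (induction n) simp_all

lemma const_eq_0_iff [simp]: "const a = 0 \<longleftrightarrow> a = 0"
  by (simp add: const_def)

lemma const_uminus [simp]: "const (- a) = - const a"
  using const_simps(3)[of a "- a"] by (simp add: eq_neg_iff_add_eq_0 add.commute)

lemma eval_at_simps:
  "eval_at x (pCons a p) = const a + x * eval_at x p"
  "eval_at x (p + r) = eval_at x p + eval_at x r"
  "eval_at x (Polynomial.smult a p) = const a * eval_at x p"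
  "eval_at x (p * r) = eval_at x p * eval_at x r"
  unfolding eval_at_def by (rule poly_map_hom; simp)+

lemma eval_at_0 [simp]: "eval_at x 0 = 0" and eval_at_1 [simp]: "eval_at x 1 = 1"
  by (simp_all add: eval_at_def)

lemma eval_at_diff: "eval_at x (p - r) = eval_at x p - eval_at x r"
  using eval_at_simps(2)[of x "p - r" r] by simp

lemma eval_at_power: "eval_at x (p ^ n) = eval_at x p ^ n"
  by (induction n) (simp_all add: eval_at_simps)

lemma eval_at_X: "eval_at x [:0, 1:] = x" "eval_at x [:c:] = const c"
  by (simp_all add: eval_at_simps)

lemma shift_at_simps:
  "shift_at x (pCons a p) = fps_const (const a) + (fps_const x + fps_X) * shift_at x p"
  "shift_at x (p + r) = shift_at x p + shift_at x r"
  "shift_at x (p * r) = shift_at x p * shift_at x r"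
  unfolding shift_at_def by (rule poly_map_hom; simp add: fps_const_add[symmetric] del: fps_const_add)+

lemma shift_at_0 [simp]: "shift_at x 0 = 0" and shift_at_1 [simp]: "shift_at x 1 = 1"
  by (simp_all add: shift_at_def)

lemma shift_at_nth_0: "shift_at x p $ 0 = eval_at x p"
  by (induction p) (simp_all add: shift_at_simps eval_at_simps fps_mult_nth_0)

lemma coord_t_nonzero: "coord_t \<noteq> (0 :: 'k::field ratfun)"
  by (simp add: coord_t_def)

lemma coords_nonzero: "\<tau> \<in> coords \<Longrightarrow> \<tau> \<noteq> 0"
  using coord_t_nonzero by (auto simp: coords_def)

lemma coords_inverse: "\<tau> \<in> coords \<Longrightarrow> inverse \<tau> \<in> coords"
  by (auto simp: coords_def)

lemma coords_cases: "\<tau> \<in> coords \<Longrightarrow> \<sigma> \<in> coords \<Longrightarrow> \<sigma> = \<tau> \<or> \<sigma> = inverse \<tau>"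
  by (auto simp: coords_def)

lemma eval_at_coord_t: "eval_at coord_t p = to_fract p"
proof (induction p)
  case (pCons a p)
  have "pCons a p = [:a:] + [:0, 1:] * p" by simp
  then have "to_fract (pCons a p) = to_fract [:a:] + to_fract [:0, 1:] * to_fract p"
    by (simp only: to_fract_add to_fract_mult)
  then show ?case using pCons by (simp add: eval_at_simps const_def coord_t_def)
qed simp

lemma eval_at_reflect:
  assumes "x \<noteq> 0"
  shows "eval_at x (reflect_poly p) = x ^ degree p * eval_at (inverse x) p"
proof -
  have "map_poly const (reflect_poly p) = reflect_poly (map_poly const p)"
    by (rule poly_eqI) (simp add: coeff_map_poly coeff_reflect_poly degree_map_poly)
  then show ?thesis unfolding eval_at_def by (simp add: poly_reflect_poly_nz[OF assms] degree_map_poly)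
qed

text \<open>At \<open>coord_t\<close> evaluation is the inclusion of polynomials into fractions. At
  its inverse, multiplying by a power of the coordinate turns the value into that of the reflected
  polynomial at \<open>coord_t\<close>.\<close>

lemma eval_at_eq_0_iff:
  assumes "\<tau> \<in> coords"
  shows "eval_at \<tau> a = 0 \<longleftrightarrow> a = 0"
proof -
  consider "\<tau> = coord_t" | "\<tau> = inverse coord_t" using assms by (auto simp: coords_def)
  then show ?thesis
  proof cases
    case 2
    have "eval_at \<tau> a = 0 \<longleftrightarrow> eval_at coord_t (reflect_poly a) = 0"
      unfolding eval_at_reflect[OF coord_t_nonzero] 2 by (simp add: coord_t_nonzero)
    also have "\<dots> \<longleftrightarrow> a = 0" by (simp add: eval_at_coord_t)
    finally show ?thesis .
  qed (simp add: eval_at_coord_t)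
qed

lemma eval_at_fraction:
  assumes "\<tau> \<in> coords"
  obtains a b where "b \<noteq> 0" "f = eval_at \<tau> a / eval_at \<tau> b"
proof -
  obtain a b where ab: "f = Fract a b" "b \<noteq> 0" by (cases f) auto
  then have f: "f = to_fract a / to_fract b" by (simp add: Fract_conv_to_fract)
  consider "\<tau> = coord_t" | "\<tau> = inverse coord_t" using assms by (auto simp: coords_def)
  then show ?thesis
  proof cases
    case 1
    then show ?thesis using that[of b a] ab f by (simp add: eval_at_coord_t)
  next
    case 2
    have t: "to_fract c = coord_t ^ degree c * eval_at \<tau> (reflect_poly c)" for c
    proof -
      have "eval_at \<tau> (reflect_poly c) = \<tau> ^ degree c * to_fract c"
        using eval_at_reflect[of \<tau> c] coords_nonzero[OF assms] 2 by (simp add: eval_at_coord_t)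
      moreover have "coord_t ^ degree c * \<tau> ^ degree c = 1"
        unfolding 2 by (simp only: power_mult_distrib[symmetric] right_inverse[OF coord_t_nonzero] power_one)
      ultimately show ?thesis by (simp add: mult.assoc[symmetric])
    qed
    have "eval_at \<tau> (monom 1 n) = \<tau> ^ n" for n
      using eval_at_power[of \<tau> "[:0, 1:]" n] by (simp add: eval_at_X monom_altdef)
    \<comment> \<open>Each polynomial in t is t to its degree times the reflected polynomial at
      \<tau> = 1/t. The power of t in the numerator is moved to the denominator as a power of
      \<tau>, and conversely.\<close>
    then have "f = eval_at \<tau> (monom 1 (degree b) * reflect_poly a) / eval_at \<tau> (monom 1 (degree a) * reflect_poly b)"
      unfolding f t using 2 coord_t_nonzero by (simp add: eval_at_simps field_simps)
    then show ?thesis by (rule that[rotated]) (use ab in simp)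
  qed
qed

text \<open>Makes the definite description in \<open>taylor\<close> usable. Two fractions for f
  agree after cross multiplication, shifting respects products, and a shifted denominator is an
  invertible series because its constant term is the nonzero value of the denominator.\<close>

lemma taylor_unique:
  assumes "\<tau> \<in> coords" "b \<noteq> 0" "f * eval_at \<tau> b = eval_at \<tau> a" "h * shift_at \<tau> b = shift_at \<tau> a"
  shows "taylor \<tau> f = h"
proof -
  note nz = eval_at_eq_0_iff[OF assms(1)]
  have inv: "shift_at \<tau> d * inverse (shift_at \<tau> d) = 1" if "d \<noteq> 0" for d
    using that by (subst mult.commute, intro inverse_mult_eq_1) (simp add: shift_at_nth_0 nz)
  have cancel: "x * inverse (shift_at \<tau> d) = h" if "d \<noteq> 0" "f * eval_at \<tau> d = eval_at \<tau> c" "x = shift_at \<tau> c" for c d x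
  proof -
    have "eval_at \<tau> (c * b) = eval_at \<tau> (a * d)"
      using that(2) assms(3) by (simp add: eval_at_simps flip: that(2) assms(3))
    then have "eval_at \<tau> (c * b - a * d) = 0"
      by (simp only: eval_at_diff) simp
    then have "c * b = a * d" by (simp only: nz) simp
    then have "shift_at \<tau> c * shift_at \<tau> b = (h * shift_at \<tau> d) * shift_at \<tau> b"
    proof -
      have "shift_at \<tau> c * shift_at \<tau> b = shift_at \<tau> a * shift_at \<tau> d"
        using \<open>c * b = a * d\<close> by (simp only: shift_at_simps(3)[symmetric])
      also have "\<dots> = h * shift_at \<tau> b * shift_at \<tau> d" by (simp only: assms(4))
      finally show ?thesis by (simp only: mult.assoc mult.commute[of "shift_at \<tau> b"])
    qed
    moreover have "shift_at \<tau> b \<noteq> 0" using inv[OF assms(2)] by auto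
    ultimately have "shift_at \<tau> c = h * shift_at \<tau> d" by (metis mult_right_cancel)
    then show ?thesis using inv[OF that(1)] that(3) by (simp only: mult.assoc) simp
  qed
  show ?thesis
    unfolding taylor_def
  proof (rule the_equality)
    have "f = eval_at \<tau> a / eval_at \<tau> b" using assms(2,3) nz[of b] by (simp add: field_simps)
    then show "\<exists>a b. eval_at \<tau> b \<noteq> 0 \<and> f = eval_at \<tau> a / eval_at \<tau> b \<and> h = shift_at \<tau> a * inverse (shift_at \<tau> b)"
      using assms(2,3) nz[of b] cancel[OF assms(2,3) refl] by metis
  next
    fix h' assume "\<exists>a b. eval_at \<tau> b \<noteq> 0 \<and> f = eval_at \<tau> a / eval_at \<tau> b \<and> h' = shift_at \<tau> a * inverse (shift_at \<tau> b)"
    then obtain c d where "eval_at \<tau> d \<noteq> 0" "f = eval_at \<tau> c / eval_at \<tau> d" "h' = shift_at \<tau> c * inverse (shift_at \<tau> d)"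
      by blast
    then show "h' = h" using cancel[of d c "shift_at \<tau> c"] nz[of d] by simp
  qed
qed

lemma taylor_char:
  assumes "\<tau> \<in> coords"
  obtains a b where "b \<noteq> 0" "f * eval_at \<tau> b = eval_at \<tau> a" "taylor \<tau> f * shift_at \<tau> b = shift_at \<tau> a"
proof -
  obtain a b where ab: "b \<noteq> 0" "f = eval_at \<tau> a / eval_at \<tau> b" using eval_at_fraction[OF assms] .
  have f: "f * eval_at \<tau> b = eval_at \<tau> a" using ab eval_at_eq_0_iff[OF assms, of b] by simp
  have "inverse (shift_at \<tau> b) * shift_at \<tau> b = 1"
    by (rule inverse_mult_eq_1) (simp add: shift_at_nth_0 eval_at_eq_0_iff[OF assms] ab)
  then have h: "shift_at \<tau> a * inverse (shift_at \<tau> b) * shift_at \<tau> b = shift_at \<tau> a" by (simp add: mult.assoc)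
  show ?thesis using that[OF ab(1) f] h taylor_unique[OF assms ab(1) f h] by simp
qed

lemma taylor_eval: "\<tau> \<in> coords \<Longrightarrow> taylor \<tau> (eval_at \<tau> a) = shift_at \<tau> a"
  by (rule taylor_unique[of \<tau> 1]) simp_all

lemma taylor_add:
  assumes "\<tau> \<in> coords"
  shows "taylor \<tau> (f + g) = taylor \<tau> f + taylor \<tau> g"
proof -
  obtain a b where ab: "b \<noteq> 0" "f * eval_at \<tau> b = eval_at \<tau> a" "taylor \<tau> f * shift_at \<tau> b = shift_at \<tau> a"
    using taylor_char[OF assms] .
  obtain c d where cd: "d \<noteq> 0" "g * eval_at \<tau> d = eval_at \<tau> c" "taylor \<tau> g * shift_at \<tau> d = shift_at \<tau> c"
    using taylor_char[OF assms] .
  show ?thesis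
    by (rule taylor_unique[OF assms, of "b * d" _ "a * d + b * c"])
      (use ab cd in \<open>simp_all add: eval_at_simps shift_at_simps algebra_simps flip: ab(2,3) cd(2,3)\<close>)
qed

lemma taylor_mult:
  assumes "\<tau> \<in> coords"
  shows "taylor \<tau> (f * g) = taylor \<tau> f * taylor \<tau> g"
proof -
  obtain a b where ab: "b \<noteq> 0" "f * eval_at \<tau> b = eval_at \<tau> a" "taylor \<tau> f * shift_at \<tau> b = shift_at \<tau> a"
    using taylor_char[OF assms] .
  obtain c d where cd: "d \<noteq> 0" "g * eval_at \<tau> d = eval_at \<tau> c" "taylor \<tau> g * shift_at \<tau> d = shift_at \<tau> c"
    using taylor_char[OF assms] .
  show ?thesis
    by (rule taylor_unique[OF assms, of "b * d" _ "a * c"])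
      (use ab cd in \<open>simp_all add: eval_at_simps shift_at_simps algebra_simps flip: ab(2,3) cd(2,3)\<close>)
qed

lemma taylor_const: "\<tau> \<in> coords \<Longrightarrow> taylor \<tau> (const c) = fps_const (const c)"
  using taylor_eval[of \<tau> "[:c:]"] by (simp add: eval_at_X shift_at_simps)

lemma taylor_coord: "\<tau> \<in> coords \<Longrightarrow> taylor \<tau> \<tau> = fps_const \<tau> + fps_X"
  using taylor_eval[of \<tau> "[:0, 1:]"] by (simp add: eval_at_X shift_at_simps)

lemma taylor_1: "\<tau> \<in> coords \<Longrightarrow> taylor \<tau> 1 = 1"
  using taylor_const[of \<tau> 1] by simp

lemma taylor_power: "\<tau> \<in> coords \<Longrightarrow> taylor \<tau> (f ^ n) = taylor \<tau> f ^ n"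
  by (induction n) (simp_all add: taylor_1 taylor_mult)

lemma taylor_nth_0: "\<tau> \<in> coords \<Longrightarrow> taylor \<tau> f $ 0 = f"
proof -
  assume \<tau>: "\<tau> \<in> coords"
  obtain a b where ab: "b \<noteq> 0" "f * eval_at \<tau> b = eval_at \<tau> a" "taylor \<tau> f * shift_at \<tau> b = shift_at \<tau> a"
    using taylor_char[OF \<tau>] .
  have "taylor \<tau> f $ 0 * eval_at \<tau> b = eval_at \<tau> a"
    using arg_cong[OF ab(3), of "\<lambda>h. h $ 0"] by (simp add: fps_mult_nth_0 shift_at_nth_0)
  then show ?thesis using ab eval_at_eq_0_iff[OF \<tau>, of b] by (metis mult_right_cancel)
qed

text \<open>A ring morphism fixed on constants and on \<tau> is fixed on polynomials in \<tau>, and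
  then on fractions, where the shifted denominator can be divided out. It identifies Taylor
  expansions in different coordinates.\<close>

lemma taylor_hom_unique:
  assumes \<tau>: "\<tau> \<in> coords"
    and add: "\<And>f g. \<Phi> (f + g) = \<Phi> f + \<Phi> g" and mult: "\<And>f g. \<Phi> (f * g) = \<Phi> f * \<Phi> g"
    and const: "\<And>c. \<Phi> (const c) = fps_const (const c)" and coord: "\<Phi> \<tau> = fps_const \<tau> + fps_X"
  shows "\<Phi> f = taylor \<tau> f"
proof -
  have ev: "\<Phi> (eval_at \<tau> a) = shift_at \<tau> a" for a
  proof (induction a)
    case 0
    show ?case using const[of 0] by simp
  qed (simp add: eval_at_simps shift_at_simps add mult const coord)
  obtain a b where ab: "b \<noteq> 0" "f * eval_at \<tau> b = eval_at \<tau> a"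
    using taylor_char[OF \<tau>] .
  show ?thesis
    by (rule taylor_unique[OF \<tau> ab, symmetric]) (simp add: ev mult ab(2) flip: ev mult)
qed

definition coeffs_in :: "'a::field set \<Rightarrow> 'a fps \<Rightarrow> bool" where
  "coeffs_in R h \<longleftrightarrow> (\<forall>n. h $ n \<in> R)"

definition subring_set :: "'a::field set \<Rightarrow> bool" where
  "subring_set R \<longleftrightarrow> 0 \<in> R \<and> 1 \<in> R \<and> (\<forall>x\<in>R. \<forall>y\<in>R. x + y \<in> R \<and> x * y \<in> R) \<and> (\<forall>x\<in>R. - x \<in> R)"

lemma subring_sum: "subring_set R \<Longrightarrow> (\<And>i. i \<in> I \<Longrightarrow> f i \<in> R) \<Longrightarrow> sum f I \<in> R"
  by (induction I rule: infinite_finite_induct) (auto simp: subring_set_def)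

lemma coeffs_in_mult:
  assumes "subring_set R" "coeffs_in R f" "coeffs_in R g"
  shows "coeffs_in R (f * g)"
  unfolding coeffs_in_def fps_mult_nth
  using assms by (auto intro!: subring_sum simp: coeffs_in_def subring_set_def)

lemma coeffs_in_power: "subring_set R \<Longrightarrow> coeffs_in R f \<Longrightarrow> coeffs_in R (f ^ n)"
proof (induction n)
  case 0
  then show ?case by (auto simp: coeffs_in_def subring_set_def)
qed (simp add: coeffs_in_mult)

lemma chart_ring_subring: "subring_set (chart_ring \<tau>)"
proof -
  have "0 \<in> chart_ring \<tau>" "1 \<in> chart_ring \<tau>"
    unfolding chart_ring_def by (rule range_eqI[of _ _ 0], simp) (rule range_eqI[of _ _ 1], simp)
  moreover have "x + y \<in> chart_ring \<tau>" "x * y \<in> chart_ring \<tau>" if "x \<in> chart_ring \<tau>" "y \<in> chart_ring \<tau>" for x y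
    using that by (auto simp: chart_ring_def eval_at_simps(2,4)[symmetric])
  moreover have "- x \<in> chart_ring \<tau>" if x: "x \<in> chart_ring \<tau>" for x
  proof -
    obtain a where "x = eval_at \<tau> a" using x by (auto simp: chart_ring_def)
    then have "- x = eval_at \<tau> (Polynomial.smult (-1) a)" by (simp only: eval_at_simps(3)) simp
    then show ?thesis by (simp only: chart_ring_def rangeI)
  qed
  ultimately show ?thesis by (simp add: subring_set_def)
qed

lemma chart_ring_basic: "const c \<in> chart_ring \<tau>" "\<tau> \<in> chart_ring \<tau>"
  unfolding chart_ring_def
  by (rule range_eqI[of _ _ "[:c:]"], simp add: eval_at_X) (rule range_eqI[of _ _ "[:0, 1:]"], simp add: eval_at_X)

text \<open>The chain rule as a substitution. With \<sigma> = 1/\<tau>, the series \<open>v\<close>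
  is the expansion of \<tau> at \<sigma> + s, and composing the \<tau>-expansion with u = v - \<tau>
  gives a ring morphism with the right values on constants and on \<sigma>. As \<open>u\<close> has
  no constant term, only its powers up to \<open>n\<close> reach the coefficient of index n.\<close>

lemma hasse_change_coord:
  assumes \<tau>: "\<tau> \<in> coords"
  shows "\<exists>f. (\<forall>l\<le>n. f l \<in> chart_ring \<tau>) \<and> hasse (inverse \<tau>) n = (\<lambda>g. \<Sum>l\<le>n. f l * hasse \<tau> l g)"
proof -
  define \<sigma> where "\<sigma> = inverse \<tau>"
  have \<sigma>: "\<sigma> \<in> coords" and nz: "\<tau> \<noteq> 0" "\<sigma> \<noteq> 0" "\<tau> * \<sigma> = 1"
    using coords_inverse[OF \<tau>] coords_nonzero[OF \<tau>] by (simp_all add: \<sigma>_def)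
  define v where "v = inverse (fps_const \<sigma> + fps_X)"
  define u where "u = v - fps_const \<tau>"
  have v: "v * (fps_const \<sigma> + fps_X) = 1"
    unfolding v_def by (rule inverse_mult_eq_1) (simp add: nz)
  have v0: "v $ 0 = \<tau>"
    by (simp add: v_def \<sigma>_def)
  \<comment> \<open>Read off from v (\<sigma> + s) = 1. It shows that the coefficients of
    \<open>v\<close> are polynomials in \<tau>, so the new coefficients are regular on the whole
    chart of \<tau>.\<close>
  have vSuc: "v $ Suc n = - \<tau> * v $ n" for n
  proof -
    have "(v * (fps_const \<sigma> + fps_X)) $ Suc n = 0" unfolding v by simp
    then have "v $ Suc n * \<sigma> + v $ n = 0" by (simp add: distrib_left)
    then have "v $ Suc n * \<sigma> = - v $ n" by (simp add: eq_neg_iff_add_eq_0)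
    moreover have "v $ Suc n = v $ Suc n * \<sigma> * \<tau>" using nz(3) by (simp add: mult.assoc mult.commute)
    ultimately show ?thesis by (simp add: mult.commute)
  qed
  have R: "subring_set (chart_ring \<tau>)" by (rule chart_ring_subring)
  have "v $ n \<in> chart_ring \<tau>" for n
    by (induction n) (use R chart_ring_basic(2)[of \<tau>] in \<open>auto simp: v0 vSuc subring_set_def\<close>)
  then have u_in: "coeffs_in (chart_ring \<tau>) u"
    using R v0 by (auto simp: coeffs_in_def u_def subring_set_def nat.split_sels fps_const_def)
  have u0: "u $ 0 = 0" by (simp add: u_def v0)
  have ex: "taylor \<sigma> f = fps_compose (taylor \<tau> f) u" for f
  proof (rule taylor_hom_unique[OF \<sigma>, symmetric])
    fix f g
    show "fps_compose (taylor \<tau> (f + g)) u = fps_compose (taylor \<tau> f) u + fps_compose (taylor \<tau> g) u"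
      by (simp add: taylor_add[OF \<tau>] fps_compose_add_distrib)
    show m: "fps_compose (taylor \<tau> (f * g)) u = fps_compose (taylor \<tau> f) u * fps_compose (taylor \<tau> g) u" for f g
      by (simp add: taylor_mult[OF \<tau>] fps_compose_mult_distrib[OF u0])
    show "fps_compose (taylor \<tau> (const c)) u = fps_const (const c)" for c
      by (simp add: taylor_const[OF \<tau>])
    have "fps_compose (taylor \<tau> \<tau>) u = fps_const \<tau> + u"
      by (simp add: taylor_coord[OF \<tau>] fps_compose_add_distrib fps_X_fps_compose_startby0[OF u0])
    then have "fps_compose (taylor \<tau> \<tau>) u = v" by (simp add: u_def)
    then have "v * fps_compose (taylor \<tau> \<sigma>) u = 1"
      using m[of \<tau> \<sigma>] nz by (simp add: taylor_1[OF \<tau>])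
    then have "v * fps_compose (taylor \<tau> \<sigma>) u * (fps_const \<sigma> + fps_X) = fps_const \<sigma> + fps_X" by simp
    then show "fps_compose (taylor \<tau> \<sigma>) u = fps_const \<sigma> + fps_X"
      using v by (metis (no_types, lifting) mult.assoc mult.commute mult_1)
  qed
  show ?thesis
  proof (intro exI[of _ "\<lambda>l. (u ^ l) $ n"] conjI allI impI)
    show "(u ^ l) $ n \<in> chart_ring \<tau>" for l
      using coeffs_in_power[OF R u_in] by (auto simp: coeffs_in_def)
    show "hasse (inverse \<tau>) n = (\<lambda>g. \<Sum>l\<le>n. (u ^ l) $ n * hasse \<tau> l g)"
      by (simp add: hasse_def ex[unfolded \<sigma>_def] fps_compose_nth atLeast0AtMost mult.commute fun_eq_iff)
  qed
qed

lemma hasse_expansion: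
  assumes \<tau>: "\<tau> \<in> coords" and \<sigma>: "\<sigma> \<in> coords"
  shows "\<exists>f. (\<forall>l\<le>n. f l \<in> chart_ring \<tau>) \<and> hasse \<sigma> n = (\<lambda>g. \<Sum>l\<le>n. f l * hasse \<tau> l g)"
proof (cases "\<sigma> = \<tau>")
  case True
  have "hasse \<sigma> n = (\<lambda>g. \<Sum>l\<le>n. (if l = n then 1 else 0) * hasse \<tau> l g)"
    by (simp add: True if_distrib[of "\<lambda>x. x * _"] sum.delta cong: if_cong)
  moreover have "(if l = n then 1 else 0) \<in> chart_ring \<tau>" for l
    using chart_ring_subring[of \<tau>] by (auto simp: subring_set_def)
  ultimately show ?thesis by (intro exI[of _ "\<lambda>l. if l = n then 1 else 0"]) simp
next
  case False
  then show ?thesis using coords_cases[OF \<tau> \<sigma>] hasse_change_coord[OF \<tau>] by blast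
qed

lemma hasse_linear:
  assumes "\<tau> \<in> coords"
  shows "hasse \<tau> n (f + g) = hasse \<tau> n f + hasse \<tau> n g" "hasse \<tau> n (const c * f) = const c * hasse \<tau> n f"
    "hasse \<tau> 0 f = f" "hasse \<tau> n (f * g) = (\<Sum>i\<le>n. hasse \<tau> i f * hasse \<tau> (n - i) g)"
proof -
  show "hasse \<tau> n (f * g) = (\<Sum>i\<le>n. hasse \<tau> i f * hasse \<tau> (n - i) g)"
    by (simp add: hasse_def taylor_mult[OF assms] fps_mult_nth atLeast0AtMost)
qed (simp_all add: hasse_def taylor_add[OF assms] taylor_mult[OF assms] taylor_const[OF assms] taylor_nth_0[OF assms])

section \<open>Frobenius and the Dwork projection\<close>

text \<open>In characteristic p one has (a + X B)^p = a^p + X^p B^p. Induction on the index peels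
  off one coefficient at a time and so avoids raising an infinite sum to the p-th power.\<close>

lemma fps_frobenius_nth:
  fixes A :: "'a::comm_ring_1 fps"
  assumes p: "Factorial_Ring.prime CHAR('a)"
  shows "(A ^ CHAR('a)) $ n = (if CHAR('a) dvd n then (A $ (n div CHAR('a))) ^ CHAR('a) else 0)"
proof (induction n arbitrary: A rule: less_induct)
  case (less n)
  let ?p = "CHAR('a)"
  have p0: "?p > 0" using p by (rule prime_gt_0_nat)
  define B where "B = fps_shift 1 A"
  have "A = fps_const (A $ 0) + fps_X * B"
    by (rule fps_ext) (simp add: B_def)
  then have "A ^ ?p = (fps_const (A $ 0) + fps_X * B) ^ ?p" by simp
  also have "\<dots> = fps_const (A $ 0) ^ ?p + (fps_X * B) ^ ?p"
    by (rule freshmans_dream) (simp_all add: p)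
  finally have "(A ^ ?p) $ n = (if n = 0 then (A $ 0) ^ ?p else 0) + (if n < ?p then 0 else (B ^ ?p) $ (n - ?p))"
    by (simp add: power_mult_distrib fps_const_power fps_X_power_mult_nth)
  also have "\<dots> = (if ?p dvd n then (A $ (n div ?p)) ^ ?p else 0)"
  proof (cases "n < ?p")
    case True
    then show ?thesis using p0 by (auto dest: dvd_imp_le)
  next
    case False
    then have "n - ?p < n" "n \<noteq> 0" using p0 by auto
    have "(n - ?p) div ?p + 1 = n div ?p" using False p0 by (simp add: le_div_geq)
    then show ?thesis
      using False less[OF \<open>n - ?p < n\<close>, of B] \<open>n \<noteq> 0\<close> p0 by (simp add: dvd_minus_self B_def)
  qed
  finally show ?case .
qed

definition linear_op :: "'k::field operator \<Rightarrow> bool" where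
  "linear_op P \<longleftrightarrow> (\<forall>f g. P (f + g) = P f + P g) \<and> (\<forall>c f. P (const c * f) = const c * P f)"

lemma linear_opD:
  assumes "linear_op P"
  shows "P (f + g) = P f + P g" "P (const c * f) = const c * P f" "P 0 = 0" "P (- f) = - P f"
    "P (f - g) = P f - P g" "P (\<Sum>i\<in>I. F i) = (\<Sum>i\<in>I. P (F i))"
proof -
  show a: "P (f + g) = P f + P g" for f g using assms by (simp add: linear_op_def)
  show c: "P (const c * f) = const c * P f" for c f using assms by (simp add: linear_op_def)
  show z: "P 0 = 0" using c[of 0 0] by simp
  show m: "P (- f) = - P f" for f using c[of "- 1" f] by simp
  show "P (f - g) = P f - P g" using a[of f "- g"] m[of g] by simp
  show "P (\<Sum>i\<in>I. F i) = (\<Sum>i\<in>I. P (F i))"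
    by (induction I rule: infinite_finite_induct) (simp_all add: z a)
qed

lemma linear_op_hasse: "\<tau> \<in> coords \<Longrightarrow> linear_op (hasse \<tau> n)"
  by (simp add: linear_op_def hasse_linear(1,2))

definition frob_proj :: "'k::{field,finite} ratfun \<Rightarrow> 'k operator \<Rightarrow> bool" where
  "frob_proj \<tau> P \<longleftrightarrow> linear_op P \<and>
    (\<forall>j<CARD('k). \<forall>g. P (\<tau> ^ j * g ^ CARD('k)) = (if j = 0 then g ^ CARD('k) else 0))"

definition dwork_op :: "'k::{field,finite} ratfun \<Rightarrow> 'k operator" where
  "dwork_op \<tau> g = (\<Sum>r<CARD('k). (- \<tau>) ^ r * hasse \<tau> r g)"

context prime_card begin

lemma CHAR_ratfun: "CHAR('k ratfun) = CARD('k)"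
proof -
  have "(of_nat n :: 'k ratfun) = 0 \<longleftrightarrow> CARD('k) dvd n" for n
  proof -
    have "(of_nat n :: 'k ratfun) = const (of_nat n)" by simp
    then show ?thesis by (simp only: const_eq_0_iff of_nat_eq_0_iff_card[OF p])
  qed
  from this[of "CARD('k)"] this[of "CHAR('k ratfun)"] show ?thesis
    by (intro dvd_antisym) (simp_all add: of_nat_eq_0_iff_char_dvd)
qed

lemma p_pos: "CARD('k) > 0" "CARD('k) > 1"
  using prime_gt_0_nat[OF p] prime_gt_1_nat[OF p] by auto

lemma frob_add: "((f :: 'k ratfun) + g) ^ CARD('k) = f ^ CARD('k) + g ^ CARD('k)"
  by (rule freshmans_dream) (simp_all add: CHAR_ratfun p)

lemma frob_sum: "(\<Sum>i\<in>I. (f i :: 'k ratfun)) ^ CARD('k) = (\<Sum>i\<in>I. f i ^ CARD('k))"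
  by (rule freshmans_dream_sum) (simp_all add: CHAR_ratfun p)

lemma hasse_frob:
  assumes "\<tau> \<in> coords"
  shows "hasse \<tau> n (f ^ CARD('k)) = (if CARD('k) dvd n then (hasse \<tau> (n div CARD('k)) (f :: 'k ratfun)) ^ CARD('k) else 0)"
  using fps_frobenius_nth[of "taylor \<tau> f" n] by (simp add: hasse_def taylor_power[OF assms] CHAR_ratfun p)

text \<open>A fraction a / b equals a b^(p-1) times the p-th power of 1/b, and \<tau>^i is \<tau>^(i
  mod p) times a p-th power. Hence the products in \<open>base\<close> span the function
  field.\<close>

lemma ratfun_p_induct:
  fixes f :: "'k ratfun"
  assumes \<tau>: "\<tau> \<in> coords"
    and add: "\<And>f g. P f \<Longrightarrow> P g \<Longrightarrow> P (f + g)" and const: "\<And>c f. P f \<Longrightarrow> P (const c * f)"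
    and base: "\<And>j g. j < CARD('k) \<Longrightarrow> P (\<tau> ^ j * g ^ CARD('k))"
  shows "P f"
proof -
  have zero: "P 0" using base[OF p_pos(1), of 0] p_pos by (simp add: zero_power)
  have pw: "P (\<tau> ^ i * g ^ CARD('k))" for i g
  proof -
    have "\<tau> ^ i = \<tau> ^ (i mod CARD('k)) * (\<tau> ^ (i div CARD('k))) ^ CARD('k)"
      by (simp add: power_mult[symmetric] power_add[symmetric] mult.commute)
    then have "\<tau> ^ i * g ^ CARD('k) = \<tau> ^ (i mod CARD('k)) * (\<tau> ^ (i div CARD('k)) * g) ^ CARD('k)"
      by (simp add: power_mult_distrib)
    then show ?thesis using base p_pos by simp
  qed
  have ev: "P (\<tau> ^ i * eval_at \<tau> a * g ^ CARD('k))" for i a g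
  proof (induction a arbitrary: i)
    case 0
    show ?case using zero by simp
  next
    case (pCons c a)
    have eq: "\<tau> ^ i * eval_at \<tau> (pCons c a) * g ^ CARD('k)
        = const c * (\<tau> ^ i * g ^ CARD('k)) + \<tau> ^ Suc i * eval_at \<tau> a * g ^ CARD('k)"
      by (simp add: eval_at_simps algebra_simps)
    show ?case unfolding eq by (rule add[OF const[OF pw] pCons(2)])
  qed
  obtain a b where ab: "b \<noteq> 0" "f = eval_at \<tau> a / eval_at \<tau> b" using eval_at_fraction[OF \<tau>] .
  have nz: "eval_at \<tau> b \<noteq> 0" using ab eval_at_eq_0_iff[OF \<tau>] by simp
  obtain r where r: "CARD('k) = Suc r" using p_pos by (metis not0_implies_Suc less_numeral_extra(3))
  have "f = \<tau> ^ 0 * eval_at \<tau> (a * b ^ r) * (inverse (eval_at \<tau> b)) ^ CARD('k)"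
    using nz unfolding r ab(2) by (simp add: eval_at_simps eval_at_power field_simps)
  then show ?thesis using ev[of 0 "a * b ^ r" "inverse (eval_at \<tau> b)"] by simp
qed

lemma frob_proj_unique:
  fixes P Q :: "'k operator"
  assumes "\<tau> \<in> coords" "frob_proj \<tau> P" "frob_proj \<tau> Q"
  shows "P = Q"
proof
  fix f :: "'k ratfun"
  have lin: "linear_op P" "linear_op Q" using assms by (simp_all add: frob_proj_def)
  show "P f = Q f"
    by (rule ratfun_p_induct[OF assms(1)])
      (use assms in \<open>simp_all add: linear_opD[OF lin(1)] linear_opD[OF lin(2)] frob_proj_def\<close>)
qed

text \<open>Closure under scalars uses that the field is the prime field: a scalar multiple is a
  repeated sum, and sums of p-th powers are p-th powers.\<close>

lemma frob_proj_image:
  fixes P :: "'k operator"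
  assumes "\<tau> \<in> coords" "frob_proj \<tau> P"
  shows "\<exists>h. P f = h ^ CARD('k)"
proof (rule ratfun_p_induct[OF assms(1), where f = f])
  have lin: "linear_op P" using assms by (simp add: frob_proj_def)
  show "\<exists>h. P (f + g) = h ^ CARD('k)" if "\<exists>h. P f = h ^ CARD('k)" "\<exists>h. P g = h ^ CARD('k)" for f g :: "'k ratfun"
    using that by (auto simp: linear_opD[OF lin] frob_add[symmetric])
  show "\<exists>h. P (const c * f) = h ^ CARD('k)" if h: "\<exists>h. P f = h ^ CARD('k)" for c and f :: "'k ratfun"
  proof -
    obtain n where n: "c = of_nat n" using of_nat_surj_card[OF p] by metis
    obtain h where h: "P f = h ^ CARD('k)" using h by blast
    have "\<exists>g. of_nat n * h ^ CARD('k) = g ^ CARD('k)" for n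
    proof (induction n)
      case 0
      show ?case using p_pos by (intro exI[of _ 0]) simp
    next
      case (Suc n)
      then show ?case by (auto simp: distrib_right frob_add[symmetric])
    qed
    moreover have "P (const c * f) = of_nat n * h ^ CARD('k)"
      unfolding linear_opD(2)[OF lin] h by (simp add: n)
    ultimately show ?thesis by simp
  qed
  show "\<exists>h. P (\<tau> ^ j * g ^ CARD('k)) = h ^ CARD('k)" if "j < CARD('k)" for j g
    using assms(2) that p_pos(1) by (auto simp: frob_proj_def intro: exI[of _ 0])
qed

text \<open>For 0 < j < p, the power \<tau>^(-j) is \<tau>^(p-j) times a p-th power, so passing to
  the inverse coordinate permutes the summands that are killed.\<close>

lemma frob_proj_inverse:
  fixes P :: "'k operator"
  assumes "\<tau> \<in> coords" "frob_proj \<tau> P"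
  shows "frob_proj (inverse \<tau>) P"
  unfolding frob_proj_def
proof (intro conjI allI impI)
  show "linear_op P" using assms by (simp add: frob_proj_def)
  fix j g assume j: "j < CARD('k)"
  show "P (inverse \<tau> ^ j * g ^ CARD('k)) = (if j = 0 then g ^ CARD('k) else 0)"
  proof (cases "j = 0")
    case True
    have "\<forall>j<CARD('k). \<forall>g. P (\<tau> ^ j * g ^ CARD('k)) = (if j = 0 then g ^ CARD('k) else 0)"
      using assms(2) by (simp add: frob_proj_def)
    from this[rule_format, OF p_pos(1), of g] show ?thesis using True by simp
  next
    case False
    have "inverse \<tau> ^ j = \<tau> ^ (CARD('k) - j) * inverse \<tau> ^ CARD('k)"
      using j coords_nonzero[OF assms(1)] by (simp add: power_diff field_simps)
    then have "inverse \<tau> ^ j * g ^ CARD('k) = \<tau> ^ (CARD('k) - j) * (inverse \<tau> * g) ^ CARD('k)"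
      by (simp add: power_mult_distrib)
    then show ?thesis using assms(2) j False by (simp add: frob_proj_def)
  qed
qed

lemma frob_proj_any: "\<tau> \<in> coords \<Longrightarrow> \<sigma> \<in> coords \<Longrightarrow> frob_proj \<tau> (P :: 'k operator) \<Longrightarrow> frob_proj \<sigma> P"
  using coords_cases[of \<tau> \<sigma>] frob_proj_inverse by blast

lemma hasse_coord_power:
  assumes "\<tau> \<in> coords"
  shows "hasse \<tau> r (\<tau> ^ j) = of_nat (j choose r) * \<tau> ^ (j - r)"
proof -
  have "hasse \<tau> r (\<tau> ^ j) = ((fps_X + fps_const \<tau>) ^ j) $ r"
    by (simp add: hasse_def taylor_power[OF assms] taylor_coord[OF assms] add.commute)
  also have "\<dots> = (\<Sum>i\<le>j. (of_nat (j choose i) * fps_X ^ i * fps_const \<tau> ^ (j - i)) $ r)"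
    by (simp add: binomial_ring fps_sum_nth)
  also have "\<dots> = (\<Sum>i\<le>j. if i = r then of_nat (j choose i) * \<tau> ^ (j - i) else 0)"
  proof (rule sum.cong[OF refl])
    fix i
    have "of_nat (j choose i) * fps_X ^ i * fps_const \<tau> ^ (j - i) = fps_const (of_nat (j choose i) * \<tau> ^ (j - i)) * fps_X ^ i"
      by (simp add: fps_of_nat[symmetric] fps_const_power mult.commute mult.left_commute flip: fps_const_mult)
    then show "(of_nat (j choose i) * fps_X ^ i * fps_const \<tau> ^ (j - i)) $ r =
        (if i = r then of_nat (j choose i) * \<tau> ^ (j - i) else 0)"
      by (simp add: fps_X_power_nth)
  qed
  also have "\<dots> = of_nat (j choose r) * \<tau> ^ (j - r)"
    by (simp add: binomial_eq_0)
  finally show ?thesis .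
qed

text \<open>Divided derivatives of orders 1 to p - 1 vanish on p-th powers, so only one term of the
  Leibniz rule survives.\<close>

lemma hasse_mult_frob:
  fixes \<tau> :: "'k ratfun"
  assumes "\<tau> \<in> coords" "r < CARD('k)"
  shows "hasse \<tau> r (f * g ^ CARD('k)) = hasse \<tau> r f * g ^ CARD('k)"
proof -
  have "hasse \<tau> r (f * g ^ CARD('k)) = (\<Sum>i\<le>r. if i = r then hasse \<tau> r f * g ^ CARD('k) else 0)"
    unfolding hasse_linear(4)[OF assms(1)]
  proof (rule sum.cong[OF refl])
    fix i assume "i \<in> {..r}"
    then show "hasse \<tau> i f * hasse \<tau> (r - i) (g ^ CARD('k)) = (if i = r then hasse \<tau> r f * g ^ CARD('k) else 0)"
      using assms(2) by (auto simp: hasse_frob[OF assms(1)] hasse_linear(3)[OF assms(1)] dest: dvd_imp_le)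
  qed
  then show ?thesis by simp
qed

text \<open>The expansion of (1 - 1)^N, insensitive to truncation beyond N. It serves both the Dwork
  operator, where N is the exponent of \<tau>, and \<open>Delta_T\<close>, where N is an eigenvalue
  of H.\<close>

lemma alternating_binomial_sum:
  assumes "N < n"
  shows "(\<Sum>i<n. (- 1) ^ i * of_nat (N choose i)) = (if N = 0 then 1 else (0 :: 'a::comm_ring_1))"
proof -
  have "(\<Sum>i<n. (- 1) ^ i * of_nat (N choose i)) = (\<Sum>i\<le>N. (- 1) ^ i * of_nat (N choose i) :: 'a)"
    by (rule sum.mono_neutral_right) (use assms in \<open>auto simp: binomial_eq_0\<close>)
  then show ?thesis using choose_alternating_sum[of N, where ?'a = 'a] by auto
qed

text \<open>The summand of index r acts on \<tau>^j g^p by the scalar (-1)^r (j choose r); the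
  alternating sum of these scalars is 1 for j = 0 and 0 otherwise.\<close>

lemma frob_proj_dwork_op:
  assumes "\<tau> \<in> coords"
  shows "frob_proj \<tau> (dwork_op \<tau> :: 'k operator)"
  unfolding frob_proj_def
proof (intro conjI allI impI)
  show "linear_op (dwork_op \<tau> :: 'k operator)"
    by (simp add: linear_op_def dwork_op_def hasse_linear(1,2)[OF assms] distrib_left sum.distrib sum_distrib_left
        mult.left_commute)
  fix j and g :: "'k ratfun" assume j: "j < CARD('k)"
  have "dwork_op \<tau> (\<tau> ^ j * g ^ CARD('k)) = (\<Sum>r<CARD('k). (- 1) ^ r * of_nat (j choose r) * (\<tau> ^ j * g ^ CARD('k)))"
    unfolding dwork_op_def
  proof (rule sum.cong[OF refl])
    fix r assume r: "r \<in> {..<CARD('k)}"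
    show "(- \<tau>) ^ r * hasse \<tau> r (\<tau> ^ j * g ^ CARD('k)) = (- 1) ^ r * of_nat (j choose r) * (\<tau> ^ j * g ^ CARD('k))"
    proof (cases "r \<le> j")
      case True
      then have "\<tau> ^ j = \<tau> ^ r * \<tau> ^ (j - r)" by (simp add: power_add[symmetric])
      moreover have "(- \<tau>) ^ r = (- 1) ^ r * \<tau> ^ r" by (rule power_minus)
      moreover have "hasse \<tau> r (\<tau> ^ j * g ^ CARD('k)) = of_nat (j choose r) * \<tau> ^ (j - r) * g ^ CARD('k)"
        using r by (simp add: hasse_mult_frob[OF assms] hasse_coord_power[OF assms])
      ultimately show ?thesis by simp
    next
      case False
      then show ?thesis using r by (simp add: hasse_mult_frob[OF assms] hasse_coord_power[OF assms] binomial_eq_0)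
    qed
  qed
  also have "\<dots> = (\<Sum>r<CARD('k). (- 1) ^ r * of_nat (j choose r)) * (\<tau> ^ j * g ^ CARD('k))"
    by (simp only: sum_distrib_right)
  finally show "dwork_op \<tau> (\<tau> ^ j * g ^ CARD('k)) = (if j = 0 then g ^ CARD('k) else 0)"
    by (simp add: alternating_binomial_sum[OF j])
qed

lemma dwork_op_eq: "\<tau> \<in> coords \<Longrightarrow> \<sigma> \<in> coords \<Longrightarrow> dwork_op \<tau> = (dwork_op \<sigma> :: 'k operator)"
  using frob_proj_unique[of \<sigma>] frob_proj_any frob_proj_dwork_op by blast

text \<open>On a value h^p of the projection the left side becomes a sum of p-th powers, which
  additivity of Frobenius collects into the p-th power of the expansion applied to h.\<close>

lemma garnier_op:
  fixes f :: "nat \<Rightarrow> 'k ratfun"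
  assumes \<tau>: "\<tau> \<in> coords" and \<sigma>: "\<sigma> \<in> coords"
    and P: "hasse \<sigma> i = (\<lambda>g. \<Sum>l\<le>N. f l * hasse \<tau> l g)"
  shows "(\<lambda>g. \<Sum>l\<le>N. f l ^ CARD('k) * hasse \<tau> (l * CARD('k)) (dwork_op \<tau> g))
    = (\<lambda>g. hasse \<sigma> (i * CARD('k)) (dwork_op \<tau> g))"
proof
  fix g
  obtain h where h: "dwork_op \<tau> g = h ^ CARD('k)"
    using frob_proj_image[OF \<tau> frob_proj_dwork_op[OF \<tau>]] by blast
  have "(\<Sum>l\<le>N. f l ^ CARD('k) * hasse \<tau> (l * CARD('k)) (dwork_op \<tau> g)) = (\<Sum>l\<le>N. f l * hasse \<tau> l h) ^ CARD('k)"
    using p_pos by (simp add: h hasse_frob[OF \<tau>] frob_sum power_mult_distrib)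
  also have "\<dots> = hasse \<sigma> (i * CARD('k)) (dwork_op \<tau> g)"
    using p_pos by (simp add: h hasse_frob[OF \<sigma>] flip: P[THEN fun_cong])
  finally show "(\<Sum>l\<le>N. f l ^ CARD('k) * hasse \<tau> (l * CARD('k)) (dwork_op \<tau> g)) = hasse \<sigma> (i * CARD('k)) (dwork_op \<tau> g)" .
qed

text \<open>A derivation kills p-th powers in characteristic p, so only the exponent of \<tau>
  contributes to the eigenvalue.\<close>

lemma derivation_frob_power:
  assumes lin: "linear_op (T :: 'k operator)"
    and Leibniz: "\<And>f g. T (f * g) = T f * g + f * T g"
    and coord: "T \<tau> = c * \<tau>"
  shows "T (\<tau> ^ j * g ^ CARD('k)) = of_nat j * c * (\<tau> ^ j * g ^ CARD('k))"
proof -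
  have "T 1 = T 1 + T 1" using Leibniz[of 1 1] by (simp only: mult_1 mult_1_right)
  then have one: "T 1 = 0" by (metis add_cancel_right_right)
  have pow: "T (f ^ n) = of_nat n * f ^ (n - 1) * T f" for f n
  proof (induction n)
    case (Suc n)
    then show ?case by (cases n) (simp_all add: Leibniz algebra_simps)
  qed (simp add: one)
  have "(of_nat CARD('k) :: 'k ratfun) = 0" using CHAR_ratfun by (metis of_nat_CHAR)
  then have "T (g ^ CARD('k)) = 0" by (simp add: pow)
  moreover have "T (\<tau> ^ j) = of_nat j * c * \<tau> ^ j"
  proof -
    have "T (\<tau> ^ j) = of_nat j * \<tau> ^ (j - 1) * (c * \<tau>)" by (simp only: pow coord)
    also have "\<dots> = of_nat j * c * \<tau> ^ j" by (cases j) (simp_all add: algebra_simps)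
    finally show ?thesis .
  qed
  ultimately show ?thesis by (simp add: Leibniz)
qed

text \<open>
  The operator of the distribution \<open>\<Sum>(-1)^i (H choose i)\<close> is determined by its values on
  \<open>\<tau>^j g^p\<close>, an eigenvector of \<open>H = [E, F]\<close> with eigenvalue \<open>-2 j\<close>.
\<close>

lemma H_operator:
  fixes T :: "nat \<Rightarrow> 'k operator"
  assumes odd: "CARD('k) > 2" and \<tau>: "\<tau> \<in> coords"
    and lin: "\<And>n. linear_op (T n)" and T0: "T 0 = id"
    and T1: "\<And>g. T 1 g = hasse \<tau> 1 (hasse (inverse \<tau>) 1 g) - hasse (inverse \<tau>) 1 (hasse \<tau> 1 g)"
    and rec: "\<And>n g. of_nat (Suc n) * T (Suc n) g = T n (T 1 g - of_nat n * g)"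
  shows "(\<lambda>g. \<Sum>i<CARD('k). (- 1) ^ i * T i g) = dwork_op \<tau>"
proof (rule frob_proj_unique[OF \<tau> _ frob_proj_dwork_op[OF \<tau>]])
  have \<sigma>: "inverse \<tau> \<in> coords" using \<tau> by (rule coords_inverse)
  note nz = coords_nonzero[OF \<tau>]
  let ?d = "hasse \<tau> 1 :: 'k operator" and ?e = "hasse (inverse \<tau>) 1 :: 'k operator"
  have dL: "?d (f * g) = ?d f * g + f * ?d g" and eL: "?e (f * g) = ?e f * g + f * ?e g" for f g
    using hasse_linear(4)[OF \<tau>, of 1 f g] hasse_linear(4)[OF \<sigma>, of 1 f g]
    by (simp_all add: hasse_linear(3)[OF \<tau>] hasse_linear(3)[OF \<sigma>])
  note dlin = linear_opD[OF linear_op_hasse[OF \<tau>, of 1]] and elin = linear_opD[OF linear_op_hasse[OF \<sigma>, of 1]]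
  have d1: "?d \<tau> = 1" and e1: "?e (inverse \<tau>) = 1"
    using hasse_coord_power[OF \<tau>, of 1 1] hasse_coord_power[OF \<sigma>, of 1 1] by simp_all
  have "?e 1 = ?e 1 + ?e 1" using eL[of 1 1] by (simp only: mult_1 mult_1_right)
  then have e_one: "?e 1 = 0" by (metis add_cancel_right_right)
  \<comment> \<open>The derivative of \<tau> with respect to 1/\<tau>, obtained by applying the
    Leibniz rule to the product of the two, which is 1.\<close>
  have "?e (\<tau> * inverse \<tau>) = 0" using nz e_one by simp
  then have "?e \<tau> * inverse \<tau> = - \<tau>" unfolding eL e1 by (simp add: eq_neg_iff_add_eq_0)
  then have e\<tau>: "?e \<tau> = - (\<tau> * \<tau>)" using nz by (simp add: field_simps)
  have T1L: "T 1 (f * g) = T 1 f * g + f * T 1 g" for f g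
    unfolding T1 dL eL dlin(1) elin(1) by (simp add: dL eL algebra_simps)
  have T1\<tau>: "T 1 \<tau> = (- 2) * \<tau>"
    unfolding T1 d1 e\<tau> e_one dlin(4) dL by simp
  \<comment> \<open>The eigenvalue -2 j is represented by a natural number below p, so that its
    binomial coefficients are ordinary ones and the alternating sum may stop at p.\<close>
  have eig: "T 1 (\<tau> ^ j * g ^ CARD('k)) = of_nat (2 * j * (CARD('k) - 1) mod CARD('k)) * (\<tau> ^ j * g ^ CARD('k))" for j g
  proof -
    have z: "(of_nat CARD('k) :: 'k ratfun) = 0" using CHAR_ratfun by (metis of_nat_CHAR)
    have "(of_nat (x mod CARD('k)) :: 'k ratfun) = of_nat x" for x
    proof -
      have "(of_nat x :: 'k ratfun) = of_nat (x mod CARD('k) + CARD('k) * (x div CARD('k)))" by simp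
      also have "\<dots> = of_nat (x mod CARD('k))" by (simp only: of_nat_add of_nat_mult z) simp
      finally show ?thesis by simp
    qed
    then have "(of_nat (2 * j * (CARD('k) - 1) mod CARD('k)) :: 'k ratfun) = of_nat (2 * j * (CARD('k) - 1))" .
    also have "\<dots> = of_nat j * (- 2)"
      using z p_pos by (simp add: of_nat_diff)
    finally show ?thesis using derivation_frob_power[OF lin T1L T1\<tau>, of j g] by simp
  qed
  show "frob_proj \<tau> (\<lambda>g. \<Sum>i<CARD('k). (- 1) ^ i * T i g)"
    unfolding frob_proj_def
  proof (intro conjI allI impI)
    show "linear_op (\<lambda>g. \<Sum>i<CARD('k). (- 1) ^ i * T i g)"
      by (simp add: linear_op_def linear_opD(1,2)[OF lin] distrib_left sum.distrib sum_distrib_left mult.left_commute)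
    fix j and g :: "'k ratfun" assume j: "j < CARD('k)"
    define w where "w = \<tau> ^ j * g ^ CARD('k)"
    define N where "N = 2 * j * (CARD('k) - 1) mod CARD('k)"
    have Np: "N < CARD('k)" using p_pos by (simp add: N_def)
    have T1w: "T 1 w = of_nat N * w" using eig by (simp add: w_def N_def)
    have Tw: "T i w = of_nat (N choose i) * w" if "i < CARD('k)" for i
      using that
    proof (induction i)
      case 0
      show ?case by (simp add: T0)
    next
      case (Suc i)
      have cN: "const (of_nat N - of_nat i) = (of_nat N - of_nat i :: 'k ratfun)"
        using const_simps(3)[of "of_nat N" "- of_nat i"] by simp
      have "of_nat (Suc i) * T (Suc i) w = T i (const (of_nat N - of_nat i) * w)"
        unfolding rec T1w cN by (simp add: left_diff_distrib)
      also have "\<dots> = const (of_nat N - of_nat i) * (of_nat (N choose i) * w)"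
        using Suc by (simp add: linear_opD(2)[OF lin])
      also note cN
      also have "(of_nat N - of_nat i) * (of_nat (N choose i) * w) = of_nat (Suc i) * (of_nat (N choose Suc i) * w)"
      proof (cases "i \<le> N")
        case True
        have "(N - i) * (N choose i) = Suc i * (N choose Suc i)"
          by (metis binomial_absorb_comp binomial_absorption mult.commute times_binomial_minus1_eq
              binomial_eq_0 Suc_diff_le True)
        then have "(of_nat (N - i) :: 'k ratfun) * of_nat (N choose i) = of_nat (Suc i) * of_nat (N choose Suc i)"
          by (simp only: of_nat_mult[symmetric])
        then show ?thesis using True by (simp only: of_nat_diff mult.assoc[symmetric])
      qed (simp add: binomial_eq_0)
      finally have "of_nat (Suc i) * T (Suc i) w = of_nat (Suc i) * (of_nat (N choose Suc i) * w)" .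
      \<comment> \<open>The recursion can be divided by \<open>Suc i\<close> because this number is
        below p.\<close>
      moreover have "(of_nat (Suc i) :: 'k ratfun) \<noteq> 0"
        using Suc.prems CHAR_ratfun by (metis of_nat_eq_0_iff_char_dvd dvd_imp_le leD zero_less_Suc)
      ultimately show ?case by (metis mult_left_cancel)
    qed
    have "(\<Sum>i<CARD('k). (- 1) ^ i * T i w) = (\<Sum>i<CARD('k). (- 1) ^ i * of_nat (N choose i)) * w"
      unfolding sum_distrib_right by (rule sum.cong) (simp_all add: Tw)
    also have "\<dots> = (if N = 0 then 1 else 0) * w"
      by (simp only: alternating_binomial_sum[OF Np])
    \<comment> \<open>Here p > 2 is used: 2, p - 1 and every j with 0 < j < p are prime to p, so
      only j = 0 gives the eigenvalue zero.\<close>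
    also have "N = 0 \<longleftrightarrow> j = 0"
    proof -
      have "CARD('k) dvd 2 * j * (CARD('k) - 1) \<Longrightarrow> j = 0"
        using odd p j prime_dvd_mult_iff[OF p] by (auto dest!: dvd_imp_le)
      then show ?thesis by (auto simp: N_def)
    qed
    finally show "(\<Sum>i<CARD('k). (- 1) ^ i * T i (\<tau> ^ j * g ^ CARD('k))) = (if j = 0 then g ^ CARD('k) else 0)"
      by (simp add: w_def)
  qed
qed

end

section \<open>Open sets and differential operators\<close>

text \<open>An intrinsic form of the points of a chart, without the prime ideal. The third clause is
  locality: if a sum is a unit, so is one of the summands. The coordinate enters only the second and
  fourth clauses, which makes a change of chart easy.\<close>

definition local_ring_at :: "'k::field ratfun \<Rightarrow> 'k point \<Rightarrow> bool" where
  "local_ring_at \<tau> y \<longleftrightarrow> subring_set y \<and> chart_ring \<tau> \<subseteq> y \<and>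
    (\<forall>f\<in>y. \<forall>g\<in>y. f + g \<noteq> 0 \<and> inverse (f + g) \<in> y \<longrightarrow> (f \<noteq> 0 \<and> inverse f \<in> y) \<or> (g \<noteq> 0 \<and> inverse g \<in> y)) \<and>
    (\<forall>f\<in>y. \<exists>a\<in>chart_ring \<tau>. \<exists>b\<in>chart_ring \<tau>. b \<noteq> 0 \<and> inverse b \<in> y \<and> f = a / b)"

lemma subring_setD:
  assumes "subring_set R"
  shows "0 \<in> R" "1 \<in> R" "x \<in> R \<Longrightarrow> y \<in> R \<Longrightarrow> x + y \<in> R" "x \<in> R \<Longrightarrow> y \<in> R \<Longrightarrow> x * y \<in> R"
    "x \<in> R \<Longrightarrow> - x \<in> R" "x \<in> R \<Longrightarrow> y \<in> R \<Longrightarrow> x - y \<in> R" "x \<in> R \<Longrightarrow> x ^ n \<in> R"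
proof -
  show m: "x \<in> R \<Longrightarrow> y \<in> R \<Longrightarrow> x * y \<in> R" for x y using assms by (simp add: subring_set_def)
  show o: "1 \<in> R" using assms by (simp add: subring_set_def)
  show a: "x \<in> R \<Longrightarrow> y \<in> R \<Longrightarrow> x + y \<in> R" for x y using assms by (simp add: subring_set_def)
  show n: "x \<in> R \<Longrightarrow> - x \<in> R" for x using assms by (simp add: subring_set_def)
  show "0 \<in> R" using assms by (simp add: subring_set_def)
  show "x \<in> R \<Longrightarrow> y \<in> R \<Longrightarrow> x - y \<in> R" using a[OF _ n, of x y] by simp
  show "x \<in> R \<Longrightarrow> x ^ n \<in> R" by (induction n) (simp_all add: m o)
qed

abbreviation chart_str :: "'k::field ratfun \<Rightarrow> 'k ratfun ring" where
  "chart_str \<tau> \<equiv> ring_of_type_algebra\<lparr>carrier := chart_ring \<tau>\<rparr>"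

lemma chart_str_simps:
  fixes x y \<tau> :: "'k::field ratfun"
  shows
  "carrier (chart_str \<tau>) = chart_ring \<tau>" "x \<otimes>\<^bsub>chart_str \<tau>\<^esub> y = x * y" "x \<oplus>\<^bsub>chart_str \<tau>\<^esub> y = x + y"
  "\<one>\<^bsub>chart_str \<tau>\<^esub> = 1" "\<zero>\<^bsub>chart_str \<tau>\<^esub> = 0"
  "add ring_of_type_algebra = ((+) :: 'k ratfun \<Rightarrow> _)" "monoid.mult ring_of_type_algebra = ((*) :: 'k ratfun \<Rightarrow> _)"
  "one ring_of_type_algebra = (1 :: 'k ratfun)" "ring.zero ring_of_type_algebra = (0 :: 'k ratfun)"
  by (simp_all add: ring_of_type_algebra_def)

lemma cring_chart_str: "cring (chart_str \<tau>)"
proof (rule cringI)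
  note R = subring_setD[OF chart_ring_subring[of \<tau>]]
  show "abelian_group (chart_str \<tau>)"
  proof (rule abelian_groupI)
    fix x assume "x \<in> carrier (chart_str \<tau>)"
    then show "\<exists>y\<in>carrier (chart_str \<tau>). y \<oplus>\<^bsub>chart_str \<tau>\<^esub> x = \<zero>\<^bsub>chart_str \<tau>\<^esub>"
      by (intro bexI[of _ "- x"]) (simp_all add: chart_str_simps R)
  qed (simp_all add: chart_str_simps R)
  show "comm_monoid (chart_str \<tau>)"
    by (rule comm_monoidI) (simp_all add: chart_str_simps R ac_simps)
qed (simp_all add: chart_str_simps algebra_simps)

lemma chart_str_a_inv: "x \<in> chart_ring \<tau> \<Longrightarrow> \<ominus>\<^bsub>chart_str \<tau>\<^esub> x = - x"
proof -
  interpret cring "chart_str \<tau>" by (rule cring_chart_str)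
  show "x \<in> chart_ring \<tau> \<Longrightarrow> \<ominus>\<^bsub>chart_str \<tau>\<^esub> x = - x"
    using minus_equality[of "- x" x] subring_setD(5)[OF chart_ring_subring[of \<tau>]] by (simp add: chart_str_simps)
qed

lemma chart_imp_local_ring:
  assumes "y \<in> chart \<tau>"
  shows "local_ring_at \<tau> y"
proof -
  obtain P where P: "primeideal P (chart_str \<tau>)"
    and y: "y = {a / b | a b. a \<in> chart_ring \<tau> \<and> b \<in> chart_ring \<tau> - P}"
    using assms by (auto simp: chart_def)
  interpret P: primeideal P "chart_str \<tau>" by (rule P)
  note R = subring_setD[OF chart_ring_subring[of \<tau>]]
  have Psub: "a \<in> chart_ring \<tau>" if "a \<in> P" for a using P.a_Hcarr[OF that] by (simp add: chart_str_simps)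
  have Padd: "a + b \<in> P" if "a \<in> P" "b \<in> P" for a b
    using additive_subgroup.a_closed[OF P.additive_subgroup_axioms that] by (simp add: chart_str_simps)
  have Pmult: "a * b \<in> P" if "a \<in> P" "b \<in> chart_ring \<tau>" for a b
    using P.I_r_closed[OF that(1)] that(2) by (simp add: chart_str_simps)
  have P0: "0 \<in> P" using additive_subgroup.zero_closed[OF P.additive_subgroup_axioms] by (simp add: chart_str_simps)
  have P1: "1 \<notin> P" using P.one_imp_carrier P.I_notcarr by (auto simp: chart_str_simps)
  have prime: "a * b \<notin> P" if "a \<in> chart_ring \<tau> - P" "b \<in> chart_ring \<tau> - P" for a b
    using P.I_prime[of a b] that by (auto simp: chart_str_simps)
  have fr: "f \<in> y \<longleftrightarrow> (\<exists>a b. f = a / b \<and> a \<in> chart_ring \<tau> \<and> b \<in> chart_ring \<tau> - P)" for f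
    by (auto simp: y)
  have frI: "a / b \<in> y" if "a \<in> chart_ring \<tau>" "b \<in> chart_ring \<tau> - P" for a b using that fr by blast
  have b0: "b \<noteq> 0" if "b \<in> chart_ring \<tau> - P" for b using that P0 by auto
  have sub: "chart_ring \<tau> \<subseteq> y" using frI[of _ 1] P1 R(2) by auto
  have sy: "subring_set y"
    unfolding subring_set_def
  proof (intro conjI ballI)
    show "0 \<in> y" "1 \<in> y" using sub R(1,2) by auto
    fix f assume "f \<in> y"
    then obtain a b where f: "f = a / b" "a \<in> chart_ring \<tau>" "b \<in> chart_ring \<tau> - P" using fr by blast
    show "- f \<in> y" using frI[of "- a" b] f R(5) by simp
    fix g assume "g \<in> y"
    then obtain c d where g: "g = c / d" "c \<in> chart_ring \<tau>" "d \<in> chart_ring \<tau> - P" using fr by blast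
    have "f + g = (a * d + c * b) / (b * d)" using f g b0 by (simp add: add_frac_eq)
    then show "f + g \<in> y" using frI[of "a * d + c * b" "b * d"] f g R prime by simp
    have "f * g = (a * c) / (b * d)" using f g by simp
    then show "f * g \<in> y" using frI[of "a * c" "b * d"] f g R prime by simp
  qed
  \<comment> \<open>The prime ideal is recovered from the ring of fractions as the set of numerators
    of non-units; locality then follows from its closure under sums.\<close>
  have unit: "a \<in> P \<longleftrightarrow> \<not> (a / b \<noteq> 0 \<and> inverse (a / b) \<in> y)" if "a \<in> chart_ring \<tau>" "b \<in> chart_ring \<tau> - P" for a b
  proof
    assume a: "a \<in> P"
    show "\<not> (a / b \<noteq> 0 \<and> inverse (a / b) \<in> y)"
    proof
      assume *: "a / b \<noteq> 0 \<and> inverse (a / b) \<in> y"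
      then obtain c d where cd: "b / a = c / d" "c \<in> chart_ring \<tau>" "d \<in> chart_ring \<tau> - P" using fr[of "b / a"] by auto
      then have "b * d = a * c" using * b0[of d] by (auto simp: frac_eq_eq mult.commute)
      then have "b * d \<in> P" using Pmult[OF a cd(2)] by simp
      then show False using prime[of b d] that(2) cd(3) by simp
    qed
  next
    assume *: "\<not> (a / b \<noteq> 0 \<and> inverse (a / b) \<in> y)"
    show "a \<in> P"
    proof (rule ccontr)
      assume "a \<notin> P"
      then have "b / a \<in> y" "a \<noteq> 0" using frI[of b a] that b0[of a] by auto
      then show False using * b0[of b] that by auto
    qed
  qed
  show ?thesis
    unfolding local_ring_at_def
  proof (intro conjI ballI impI)
    show "subring_set y" "chart_ring \<tau> \<subseteq> y" by (fact sy, fact sub)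
    fix f assume fy: "f \<in> y"
    then obtain a b where f: "f = a / b" "a \<in> chart_ring \<tau>" "b \<in> chart_ring \<tau> - P" using fr by blast
    have "1 / b \<in> y" using frI[of 1 b] f R(2) by simp
    then show "\<exists>a\<in>chart_ring \<tau>. \<exists>b\<in>chart_ring \<tau>. b \<noteq> 0 \<and> inverse b \<in> y \<and> f = a / b"
      using f b0[of b] by (auto simp: inverse_eq_divide)
    fix g assume "g \<in> y" and u: "f + g \<noteq> 0 \<and> inverse (f + g) \<in> y"
    then obtain c d where g: "g = c / d" "c \<in> chart_ring \<tau>" "d \<in> chart_ring \<tau> - P" using fr by blast
    have fg: "f + g = (a * d + c * b) / (b * d)" using f g b0 by (simp add: add_frac_eq)
    then have "a * d + c * b \<notin> P"
      using unit[of "a * d + c * b" "b * d"] u f g prime R by simp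
    then have "a \<notin> P \<or> c \<notin> P" using Padd Pmult f g by blast
    moreover have "a \<notin> P \<Longrightarrow> f \<noteq> 0 \<and> inverse f \<in> y" using unit[OF f(2,3)] unfolding f(1) by blast
    moreover have "c \<notin> P \<Longrightarrow> g \<noteq> 0 \<and> inverse g \<in> y" using unit[OF g(2,3)] unfolding g(1) by blast
    ultimately show "(f \<noteq> 0 \<and> inverse f \<in> y) \<or> (g \<noteq> 0 \<and> inverse g \<in> y)" by blast
  qed
qed

lemma local_ring_imp_chart:
  assumes "local_ring_at \<tau> y"
  shows "y \<in> chart \<tau>"
proof -
  note R = subring_setD[OF chart_ring_subring[of \<tau>]]
  from assms have sy: "subring_set y" and sub: "chart_ring \<tau> \<subseteq> y"
    and loc: "\<And>f g. f \<in> y \<Longrightarrow> g \<in> y \<Longrightarrow> f + g \<noteq> 0 \<Longrightarrow> inverse (f + g) \<in> y \<Longrightarrow> (f \<noteq> 0 \<and> inverse f \<in> y) \<or> (g \<noteq> 0 \<and> inverse g \<in> y)"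
    and fr: "\<And>f. f \<in> y \<Longrightarrow> \<exists>a\<in>chart_ring \<tau>. \<exists>b\<in>chart_ring \<tau>. b \<noteq> 0 \<and> inverse b \<in> y \<and> f = a / b"
    unfolding local_ring_at_def by blast+
  note S = subring_setD[OF sy]
  \<comment> \<open>The contraction of the maximal ideal, that is, the functions on the chart that
    are not invertible at the point.\<close>
  define P where "P = {f \<in> chart_ring \<tau>. f = 0 \<or> inverse f \<notin> y}"
  have inv_factor: "inverse f \<in> y" if "f * g \<noteq> 0" "inverse (f * g) \<in> y" "g \<in> y" for f g
  proof -
    have "g * inverse (f * g) = inverse f" using that(1) by (simp add: field_simps)
    then show ?thesis using S(4)[OF that(3,2)] by (simp only:)
  qed
  have Pmult: "f * g \<in> P" if "f \<in> P" "g \<in> chart_ring \<tau>" for f g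
    using that inv_factor[of f g] sub R(4) by (auto simp: P_def)
  have "ideal P (chart_str \<tau>)"
  proof (rule idealI)
    show "ring (chart_str \<tau>)" using cring_chart_str cring.axioms(1) by blast
    then interpret ring "chart_str \<tau>" .
    show "subgroup P (add_monoid (chart_str \<tau>))"
    proof (rule add.subgroupI)
      show "P \<subseteq> carrier (chart_str \<tau>)" by (auto simp: P_def chart_str_simps)
      show "P \<noteq> {}" using R(1) by (auto simp: P_def)
      show "\<ominus>\<^bsub>chart_str \<tau>\<^esub> f \<in> P" if "f \<in> P" for f
        using that Pmult[of f "- 1"] R(2,5) by (simp add: chart_str_a_inv P_def)
      show "f \<oplus>\<^bsub>chart_str \<tau>\<^esub> g \<in> P" if "f \<in> P" "g \<in> P" for f g
        using that loc[of f g] sub R(3) by (auto simp: P_def chart_str_simps)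
    qed
  qed (use Pmult in \<open>auto simp: chart_str_simps mult.commute\<close>)
  moreover have "1 \<notin> P" using S(2) by (simp add: P_def)
  then have "carrier (chart_str \<tau>) \<noteq> P" using R(2) by (auto simp: chart_str_simps)
  moreover have "f \<in> P \<or> g \<in> P" if "f \<in> chart_ring \<tau>" "g \<in> chart_ring \<tau>" "f * g \<in> P" for f g
    using that S(4) by (auto simp: P_def)
  ultimately have "primeideal P (chart_str \<tau>)"
    by (intro primeideal.intro cring_chart_str primeideal_axioms.intro) (auto simp: chart_str_simps)
  moreover have "y = {a / b | a b. a \<in> chart_ring \<tau> \<and> b \<in> chart_ring \<tau> - P}"
  proof (intro equalityI subsetI)
    fix f assume "f \<in> y"
    then obtain a b where "a \<in> chart_ring \<tau>" "b \<in> chart_ring \<tau>" "b \<noteq> 0" "inverse b \<in> y" "f = a / b" using fr by blast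
    then show "f \<in> {a / b | a b. a \<in> chart_ring \<tau> \<and> b \<in> chart_ring \<tau> - P}" by (auto simp: P_def)
  next
    fix f assume "f \<in> {a / b | a b. a \<in> chart_ring \<tau> \<and> b \<in> chart_ring \<tau> - P}"
    then obtain a b where ab: "f = a / b" "a \<in> chart_ring \<tau>" "b \<in> chart_ring \<tau> - P" by blast
    then have "inverse b \<in> y" "a \<in> y" using sub by (auto simp: P_def)
    then show "f \<in> y" using S(4) ab by (simp add: divide_inverse)
  qed
  ultimately show ?thesis unfolding chart_def by blast
qed

lemma chart_iff: "y \<in> chart \<tau> \<longleftrightarrow> local_ring_at \<tau> y"
  using chart_imp_local_ring local_ring_imp_chart by blast

lemma point_subring: "y \<in> chart \<tau> \<Longrightarrow> subring_set y"
  and point_chart_ring: "y \<in> chart \<tau> \<Longrightarrow> chart_ring \<tau> \<subseteq> y"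
  by (simp_all add: chart_iff local_ring_at_def)

lemma eval_in_subring:
  assumes "subring_set R" "\<And>c. const c \<in> R" "x \<in> R"
  shows "eval_at x a \<in> R"
  by (induction a) (simp_all add: eval_at_simps subring_setD[OF assms(1)] assms(2,3))

text \<open>A point where \<tau> is invertible lies in the overlap. Its fractions in \<tau> become
  fractions in 1/\<tau> after reflecting both polynomials, and the powers of \<tau> introduced are
  units there.\<close>

lemma chart_inverse:
  assumes \<tau>: "\<tau> \<in> coords" and y: "y \<in> chart \<tau>" and inv: "inverse \<tau> \<in> y"
  shows "y \<in> chart (inverse \<tau>)"
proof -
  let ?\<sigma> = "inverse \<tau>"
  have L: "local_ring_at \<tau> y" using y by (simp add: chart_iff)
  note S = subring_setD[OF point_subring[OF y]]
  have \<tau>y: "\<tau> \<in> y" "\<And>c. const c \<in> y" using point_chart_ring[OF y] chart_ring_basic by blast+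
  have sub: "chart_ring ?\<sigma> \<subseteq> y"
    using eval_in_subring[OF point_subring[OF y] \<tau>y(2) inv] by (auto simp: chart_ring_def)
  have fr: "\<exists>a\<in>chart_ring ?\<sigma>. \<exists>b\<in>chart_ring ?\<sigma>. b \<noteq> 0 \<and> inverse b \<in> y \<and> f = a / b" if f: "f \<in> y" for f
  proof -
    obtain a b where ab: "a \<in> chart_ring \<tau>" "b \<in> chart_ring \<tau>" "b \<noteq> 0" "inverse b \<in> y" "f = a / b"
      using L f unfolding local_ring_at_def by blast
    obtain \<alpha> \<beta> where ev: "a = eval_at \<tau> \<alpha>" "b = eval_at \<tau> \<beta>" using ab by (auto simp: chart_ring_def)
    have nz: "\<tau> \<noteq> 0" "?\<sigma> \<noteq> 0" using coords_nonzero[OF \<tau>] by simp_all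
    let ?m = "degree \<alpha>" and ?n = "degree \<beta>"
    have r: "eval_at ?\<sigma> (reflect_poly \<alpha>) = ?\<sigma> ^ ?m * a" "eval_at ?\<sigma> (reflect_poly \<beta>) = ?\<sigma> ^ ?n * b"
      using eval_at_reflect[OF nz(2)] by (simp_all add: ev)
    \<comment> \<open>Numerator and denominator are multiplied by the same power of \<sigma>, the
      sum of both degrees, which suffices to make each of them a polynomial in \<sigma>.\<close>
    let ?a = "?\<sigma> ^ ?n * (?\<sigma> ^ ?m * a)" and ?b = "?\<sigma> ^ ?m * (?\<sigma> ^ ?n * b)"
    have in\<sigma>: "?\<sigma> ^ i * eval_at ?\<sigma> p \<in> chart_ring ?\<sigma>" for i p
      by (intro subring_setD[OF chart_ring_subring] chart_ring_basic) (simp add: chart_ring_def)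
    have "?a \<in> chart_ring ?\<sigma>" "?b \<in> chart_ring ?\<sigma>" using in\<sigma> by (simp_all only: r[symmetric])
    moreover have "?b \<noteq> 0" using nz ab by simp
    moreover have "inverse ?b \<in> y"
    proof -
      have eq: "inverse ?b = \<tau> ^ ?m * (\<tau> ^ ?n * inverse b)"
        by (simp add: power_inverse mult.commute mult.left_commute)
      show ?thesis unfolding eq by (intro S(4) S(7) \<tau>y ab(4))
    qed
    moreover have "f = ?a / ?b" using ab nz by (simp add: field_simps)
    ultimately show ?thesis by blast
  qed
  show ?thesis
    using L sub fr unfolding chart_iff local_ring_at_def by blast
qed

text \<open>The function field is the local ring at the generic point. It witnesses that charts are
  nonempty, as \<open>opens\<close> requires.\<close>

lemma UNIV_in_chart: "\<tau> \<in> coords \<Longrightarrow> UNIV \<in> chart \<tau>"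
  unfolding chart_iff local_ring_at_def
proof (intro conjI ballI impI)
  fix f :: "'a ratfun" assume \<tau>: "\<tau> \<in> coords"
  obtain a b where "b \<noteq> 0" "f = eval_at \<tau> a / eval_at \<tau> b" using eval_at_fraction[OF \<tau>] .
  then show "\<exists>a\<in>chart_ring \<tau>. \<exists>b\<in>chart_ring \<tau>. b \<noteq> 0 \<and> inverse b \<in> UNIV \<and> f = a / b"
    using eval_at_eq_0_iff[OF \<tau>] by (auto simp: chart_ring_def)
qed (auto simp: subring_set_def)

lemma basic_open_one: "basic_open \<tau> 1 = chart \<tau>"
  using subring_setD(2)[OF point_subring] by (auto simp: basic_open_def)

section \<open>Zariski open sets and regularity of divided derivatives\<close>

lemma zariski_open_chart:
  assumes "\<tau> \<in> coords"
  shows "zariski_open (chart \<tau>)"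
  unfolding zariski_open_def
proof (intro conjI ballI)
  show "chart \<tau> \<subseteq> P1" using assms by (auto simp: P1_def)
  fix x assume x: "x \<in> chart \<tau>"
  have "1 \<in> chart_ring \<tau>" by (rule subring_setD(2)[OF chart_ring_subring])
  moreover have "(1::'a ratfun) \<noteq> 0 \<and> x \<in> basic_open \<tau> 1 \<and> basic_open \<tau> 1 \<subseteq> chart \<tau>"
    using x by (simp add: basic_open_one)
  ultimately show "\<exists>\<sigma>\<in>coords. \<exists>h\<in>chart_ring \<sigma>. h \<noteq> 0 \<and> x \<in> basic_open \<sigma> h \<and> basic_open \<sigma> h \<subseteq> chart \<tau>"
    using assms by blast
qed

lemma zariski_open_P1: "zariski_open P1"
  unfolding zariski_open_def
proof (intro conjI ballI)
  fix x :: "'a point" assume "x \<in> P1"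
  then obtain \<tau> where \<tau>: "\<tau> \<in> coords" "x \<in> chart \<tau>" by (auto simp: P1_def)
  have sub: "chart \<tau> \<subseteq> P1" using \<tau> by (auto simp: P1_def)
  obtain \<sigma> h where "\<sigma> \<in> coords" "h \<in> chart_ring \<sigma>" "h \<noteq> 0" "x \<in> basic_open \<sigma> h" "basic_open \<sigma> h \<subseteq> chart \<tau>"
    using zariski_open_chart[OF \<tau>(1)] \<tau>(2) unfolding zariski_open_def by meson
  then show "\<exists>\<sigma>\<in>coords. \<exists>h\<in>chart_ring \<sigma>. h \<noteq> 0 \<and> x \<in> basic_open \<sigma> h \<and> basic_open \<sigma> h \<subseteq> P1"
    using sub by (meson order_trans)
qed simp

lemma zariski_open_basic:
  assumes "\<tau> \<in> coords" "h \<in> chart_ring \<tau>" "h \<noteq> 0"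
  shows "zariski_open (basic_open \<tau> h)"
  unfolding zariski_open_def
proof (intro conjI ballI)
  show "basic_open \<tau> h \<subseteq> P1" using assms(1) by (auto simp: P1_def basic_open_def)
  show "\<exists>\<sigma>\<in>coords. \<exists>g\<in>chart_ring \<sigma>. g \<noteq> 0 \<and> x \<in> basic_open \<sigma> g \<and> basic_open \<sigma> g \<subseteq> basic_open \<tau> h"
    if "x \<in> basic_open \<tau> h" for x
    using assms that by blast
qed

lemma opens_chart: "\<tau> \<in> coords \<Longrightarrow> chart \<tau> \<in> opens (chart \<tau>)" "\<tau> \<in> coords \<Longrightarrow> chart \<tau> \<in> opens P1"
  using zariski_open_chart UNIV_in_chart by (auto simp: opens_def P1_def)

lemma opens_P1: "P1 \<in> opens P1"
  using zariski_open_P1 UNIV_in_chart by (auto simp: opens_def P1_def coords_def)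

text \<open>Needed to bring two germs of operators to a common neighbourhood. In one chart the basic
  open sets of h and g meet in that of h g; the work lies in basic open sets of different
  charts.\<close>

lemma zariski_open_Int:
  assumes V: "zariski_open V" and W: "zariski_open W"
  shows "zariski_open (V \<inter> W)"
  unfolding zariski_open_def
proof (intro conjI ballI)
  show "V \<inter> W \<subseteq> P1" using V by (auto simp: zariski_open_def)
  fix x assume x: "x \<in> V \<inter> W"
  obtain \<tau> h where h: "\<tau> \<in> coords" "h \<in> chart_ring \<tau>" "h \<noteq> 0" "x \<in> basic_open \<tau> h" "basic_open \<tau> h \<subseteq> V"
    using V x unfolding zariski_open_def by blast
  obtain \<sigma> g where g: "\<sigma> \<in> coords" "g \<in> chart_ring \<sigma>" "g \<noteq> 0" "x \<in> basic_open \<sigma> g" "basic_open \<sigma> g \<subseteq> W"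
    using W x unfolding zariski_open_def by blast
  note R = subring_setD[OF chart_ring_subring[of \<tau>]]
  have factor: "inverse a \<in> y" if "y \<in> chart \<tau>" "inverse (a * b) \<in> y" "b \<in> y" "a * b \<noteq> 0" for y a b
  proof -
    have "inverse a = b * inverse (a * b)" using that(4) by (simp add: field_simps)
    then show ?thesis using subring_setD(4)[OF point_subring[OF that(1)] that(3,2)] by (simp only:)
  qed
  consider "\<sigma> = \<tau>" | "\<sigma> = inverse \<tau>" using coords_cases h(1) g(1) by blast
  then show "\<exists>\<tau>\<in>coords. \<exists>h\<in>chart_ring \<tau>. h \<noteq> 0 \<and> x \<in> basic_open \<tau> h \<and> basic_open \<tau> h \<subseteq> V \<inter> W"
  proof cases
    case 1
    have "x \<in> chart \<tau>" "inverse h \<in> x" "inverse g \<in> x" using h(4) g(4) by (auto simp: basic_open_def)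
    then have "x \<in> basic_open \<tau> (h * g)"
      using subring_setD(4)[OF point_subring, of x \<tau> "inverse h" "inverse g"] by (simp add: basic_open_def)
    moreover have "y \<in> basic_open \<tau> h \<inter> basic_open \<sigma> g" if "y \<in> basic_open \<tau> (h * g)" for y
    proof -
      have y: "y \<in> chart \<tau>" "inverse (h * g) \<in> y" using that by (auto simp: basic_open_def)
      have "h \<in> y" "g \<in> y" using point_chart_ring[OF y(1)] h(2) g(2) 1 by auto
      then have "inverse h \<in> y" "inverse g \<in> y"
        using factor[OF y] factor[of y g h] y h(3) g(3) by (simp_all add: mult.commute[of g h])
      then show ?thesis using y(1) 1 by (simp add: basic_open_def)
    qed
    ultimately show ?thesis using h g R(4) 1 by (intro bexI[of _ \<tau>] bexI[of _ "h * g"]) auto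
  next
    case 2
    note \<sigma> = 2
    obtain \<gamma> where \<gamma>: "g = eval_at \<sigma> \<gamma>" using g(2) by (auto simp: chart_ring_def)
    define g' where "g' = eval_at \<tau> (reflect_poly \<gamma>)"
    have nz: "\<tau> \<noteq> 0" using coords_nonzero[OF h(1)] .
    have g': "g' = \<tau> ^ degree \<gamma> * g" unfolding g'_def eval_at_reflect[OF nz] by (simp add: \<gamma> 2)
    have g'_in: "g' \<in> chart_ring \<tau>" by (simp add: g'_def chart_ring_def)
    \<comment> \<open>\<open>g'\<close> is g cleared of its denominator in \<tau>. The extra factor
      \<tau> forces a point of the new basic open set into the overlap, even when g' is g
      itself.\<close>
    define H where "H = h * (\<tau> * g')"
    have H: "H \<noteq> 0" "H \<in> chart_ring \<tau>" using nz h g g' R g'_in chart_ring_basic(2)[of \<tau>] by (auto simp: H_def)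
    have "x \<in> basic_open \<tau> H"
    proof -
      have x\<tau>: "x \<in> chart \<tau>" and x\<sigma>: "x \<in> chart \<sigma>" and inv: "inverse h \<in> x" "inverse g \<in> x"
        using h(4) g(4) by (auto simp: basic_open_def)
      have \<sigma>x: "\<sigma> \<in> x" using point_chart_ring[OF x\<sigma>] chart_ring_basic(2) by blast
      have eq: "inverse H = inverse h * (\<sigma> * (\<sigma> ^ degree \<gamma> * inverse g))"
        using 2 by (simp add: H_def g' power_inverse mult.commute mult.left_commute)
      have "inverse H \<in> x"
        unfolding eq by (intro subring_setD(4,7)[OF point_subring[OF x\<tau>]] inv \<sigma>x)
      then show ?thesis using x\<tau> by (simp add: basic_open_def)
    qed
    moreover have "y \<in> basic_open \<tau> h \<inter> basic_open \<sigma> g" if "y \<in> basic_open \<tau> H" for y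
    proof -
      have y: "y \<in> chart \<tau>" "inverse H \<in> y" using that by (auto simp: basic_open_def)
      note S = subring_setD[OF point_subring[OF y(1)]]
      have in_y: "h \<in> y" "\<tau> \<in> y" "g' \<in> y"
        using point_chart_ring[OF y(1)] h(2) g'_in chart_ring_basic(2) by blast+
      have 1: "inverse h \<in> y"
        by (rule factor[OF y(1), of h "\<tau> * g'"]) (use y(2) H(1) in \<open>simp_all only: not_False_eq_True H_def S(4)[OF in_y(2,3)]\<close>)
      have 2: "H = \<tau> * (h * g')" by (simp add: H_def)
      have "inverse \<tau> \<in> y"
        by (rule factor[OF y(1), of \<tau> "h * g'"]) (use y(2) H(1) in \<open>simp_all only: not_False_eq_True 2 S(4)[OF in_y(1,3)]\<close>)
      then have y\<sigma>: "y \<in> chart \<sigma>" using chart_inverse[OF h(1) y(1)] \<sigma> by simp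
      have 3: "H = g * (\<tau> ^ degree \<gamma> * (h * \<tau>))" by (simp add: H_def g')
      have "inverse g \<in> y"
        by (rule factor[OF y(1), of g "\<tau> ^ degree \<gamma> * (h * \<tau>)"])
          (use y(2) H(1) in \<open>simp_all only: not_False_eq_True 3 S(4)[OF S(7)[OF in_y(2)] S(4)[OF in_y(1,2)]]\<close>)
      then show ?thesis using y y\<sigma> 1 by (simp add: basic_open_def)
    qed
    ultimately show ?thesis using h g H by (intro bexI[of _ \<tau>] bexI[of _ H]) auto
  qed
qed

text \<open>The recursion for the coefficients of the inverse series divides by the constant term
  only.\<close>

lemma coeffs_in_inverse:
  assumes "subring_set R" "coeffs_in R h" "h $ 0 \<noteq> 0" "inverse (h $ 0) \<in> R"
  shows "coeffs_in R (inverse h)"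
proof -
  note S = subring_setD[OF assms(1)]
  have "inverse h $ n \<in> R" for n
  proof (induction n rule: less_induct)
    case (less n)
    show ?case
    proof (cases n)
      case 0
      then show ?thesis using assms(4) by simp
    next
      case (Suc m)
      have "(inverse h * h) $ n = 0" using inverse_mult_eq_1[OF assms(3)] Suc by simp
      then have "(\<Sum>i\<le>m. inverse h $ i * h $ (n - i)) + inverse h $ n * h $ 0 = 0"
        by (simp add: fps_mult_nth Suc atLeast0AtMost)
      then have "inverse h $ n * h $ 0 = - (\<Sum>i\<le>m. inverse h $ i * h $ (n - i))"
        by (simp add: eq_neg_iff_add_eq_0 add.commute)
      then have "inverse h $ n = - (\<Sum>i\<le>m. inverse h $ i * h $ (n - i)) * inverse (h $ 0)"
        using assms(3) by (metis (no_types, lifting) mult.assoc mult.right_neutral right_inverse)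
      moreover have "(\<Sum>i\<le>m. inverse h $ i * h $ (n - i)) \<in> R"
        by (rule subring_sum[OF assms(1)]) (use less Suc S(4) assms(2) in \<open>auto simp: coeffs_in_def\<close>)
      ultimately show ?thesis using S(4,5) assms(4) by simp
    qed
  qed
  then show ?thesis by (simp add: coeffs_in_def)
qed

lemma shift_in_chart_ring: "coeffs_in (chart_ring \<tau>) (shift_at \<tau> a)"
proof (induction a)
  case 0
  show ?case using subring_setD(1)[OF chart_ring_subring] by (simp add: coeffs_in_def)
next
  case (pCons c a)
  note R = subring_setD[OF chart_ring_subring[of \<tau>]]
  have "coeffs_in (chart_ring \<tau>) (fps_const \<tau> + fps_X)"
    unfolding coeffs_in_def
  proof
    fix n
    show "(fps_const \<tau> + fps_X) $ n \<in> chart_ring \<tau>"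
      using R(1,2) chart_ring_basic(2)[of \<tau>] by (simp add: fps_X_nth)
  qed
  then have "coeffs_in (chart_ring \<tau>) ((fps_const \<tau> + fps_X) * shift_at \<tau> a)"
    by (rule coeffs_in_mult[OF chart_ring_subring _ pCons(2)])
  moreover have "coeffs_in (chart_ring \<tau>) (fps_const (const c))"
    using R(1) chart_ring_basic(1) by (simp add: coeffs_in_def)
  ultimately show ?case unfolding shift_at_simps using R(3) by (simp add: coeffs_in_def)
qed

text \<open>A function regular at y is a fraction whose denominator is a unit of y. That unit is the
  constant term of the shifted denominator, so the whole Taylor expansion has coefficients in
  y.\<close>

lemma hasse_point:
  assumes \<tau>: "\<tau> \<in> coords" and y: "y \<in> chart \<tau>" and f: "f \<in> y"
  shows "hasse \<tau> r f \<in> y"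
proof -
  obtain a b where ab: "a \<in> chart_ring \<tau>" "b \<in> chart_ring \<tau>" "b \<noteq> 0" "inverse b \<in> y" "f = a / b"
    using y f unfolding chart_iff local_ring_at_def by blast
  obtain \<alpha> \<beta> where ev: "a = eval_at \<tau> \<alpha>" "b = eval_at \<tau> \<beta>" using ab by (auto simp: chart_ring_def)
  have \<beta>: "\<beta> \<noteq> 0" using ab(3) ev by auto
  note sy = point_subring[OF y]
  have mono: "coeffs_in y (shift_at \<tau> c)" for c
    using shift_in_chart_ring[of \<tau> c] point_chart_ring[OF y] by (auto simp: coeffs_in_def)
  have inv: "inverse (shift_at \<tau> \<beta>) * shift_at \<tau> \<beta> = 1"
    by (rule inverse_mult_eq_1) (use ab ev in \<open>simp add: shift_at_nth_0\<close>)
  have "shift_at \<tau> \<alpha> * inverse (shift_at \<tau> \<beta>) * shift_at \<tau> \<beta> = shift_at \<tau> \<alpha>"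
    by (simp only: mult.assoc inv mult_1_right)
  moreover have "f * eval_at \<tau> \<beta> = eval_at \<tau> \<alpha>" using ab ev by simp
  ultimately have "taylor \<tau> f = shift_at \<tau> \<alpha> * inverse (shift_at \<tau> \<beta>)"
    using taylor_unique[OF \<tau> \<beta>] by blast
  moreover have "coeffs_in y (inverse (shift_at \<tau> \<beta>))"
    by (rule coeffs_in_inverse[OF sy mono]) (use ab ev in \<open>simp_all add: shift_at_nth_0\<close>)
  ultimately have "coeffs_in y (taylor \<tau> f)" using coeffs_in_mult[OF sy mono] by simp
  then show ?thesis by (simp add: hasse_def coeffs_in_def)
qed

section \<open>The algebra of linear operators on the function field\<close>

lemma op_alg_simps:
  "P \<in> carrier op_alg \<longleftrightarrow> linear_op P" "P \<otimes>\<^bsub>op_alg\<^esub> Q = P \<circ> Q" "P \<oplus>\<^bsub>op_alg\<^esub> Q = (\<lambda>f. P f + Q f)"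
  "\<one>\<^bsub>op_alg\<^esub> = id" "\<zero>\<^bsub>op_alg\<^esub> = (\<lambda>f. 0)" "c \<odot>\<^bsub>op_alg\<^esub> P = (\<lambda>f. const c * P f)"
  by (simp_all add: op_alg_def linear_op_def)

lemma linear_op_closed:
  assumes "linear_op P" "linear_op Q"
  shows "linear_op (P \<circ> Q)" "linear_op (\<lambda>f. P f + Q f)" "linear_op (\<lambda>f. - P f)" "linear_op (\<lambda>f. P f - Q f)"
    "linear_op (\<lambda>f. g * P f)" "linear_op (commut P g)"
proof -
  note P = linear_opD[OF assms(1)] and Q = linear_opD[OF assms(2)]
  show "linear_op (P \<circ> Q)" "linear_op (\<lambda>f. P f + Q f)" "linear_op (\<lambda>f. - P f)" "linear_op (\<lambda>f. P f - Q f)"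
    "linear_op (\<lambda>f. g * P f)"
    by (simp_all add: linear_op_def P(1,2) Q(1,2) distrib_left right_diff_distrib mult.left_commute
        add_diff_add add.assoc add.left_commute)
  have "P (g * (const c * f)) = const c * P (g * f)" for c f
    using P(2)[of c "g * f"] by (simp add: mult.left_commute)
  then show "linear_op (commut P g)"
    by (simp add: linear_op_def commut_def distrib_left P(1,2) right_diff_distrib mult.left_commute)
qed

lemma linear_op_basic: "linear_op id" "linear_op (\<lambda>f. 0)"
  by (simp_all add: linear_op_def)

lemma ring_op_alg: "ring op_alg"
proof (rule ringI)
  show "abelian_group op_alg"
  proof (rule abelian_groupI)
    fix P assume "P \<in> carrier op_alg"
    then show "\<exists>Q\<in>carrier op_alg. Q \<oplus>\<^bsub>op_alg\<^esub> P = \<zero>\<^bsub>op_alg\<^esub>"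
      by (intro bexI[of _ "\<lambda>f. - P f"]) (simp_all add: op_alg_simps linear_op_closed)
  qed (simp_all add: op_alg_simps linear_op_closed linear_op_basic add.assoc add.commute add.left_commute)
  show "Group.monoid op_alg"
    by (rule monoidI) (simp_all add: op_alg_simps linear_op_closed linear_op_basic comp_assoc)
qed (auto simp: op_alg_simps linear_opD fun_eq_iff)

interpretation Op: ring op_alg by (rule ring_op_alg)

lemma op_alg_minus:
  assumes "linear_op P" "linear_op Q"
  shows "P \<ominus>\<^bsub>op_alg\<^esub> Q = (\<lambda>f. P f - Q f)"
proof -
  have "\<ominus>\<^bsub>op_alg\<^esub> Q = (\<lambda>f. - Q f)"
    by (rule Op.minus_equality) (simp_all add: op_alg_simps linear_op_closed(3)[OF assms(2,2)] assms)
  then show ?thesis by (simp add: a_minus_def op_alg_simps)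
qed

section \<open>Sheaf endomorphisms and the order of differential operators\<close>

lemma opens_trans: "V \<in> opens U \<Longrightarrow> W \<in> opens V \<Longrightarrow> W \<in> opens U"
  by (auto simp: opens_def)

lemma opens_subset: "V \<in> opens U \<Longrightarrow> V \<subseteq> U" by (simp add: opens_def)

lemma opens_self: "V \<in> opens U \<Longrightarrow> V \<in> opens V"
  by (auto simp: opens_def)

lemma opens_point: "V \<in> opens U \<Longrightarrow> y \<in> V \<Longrightarrow> \<exists>\<tau>\<in>coords. y \<in> chart \<tau>"
  by (auto simp: opens_def zariski_open_def P1_def)

lemma regular_subring: "V \<in> opens U \<Longrightarrow> subring_set (regular V)"
proof -
  assume V: "V \<in> opens U"
  have *: "subring_set y" if "y \<in> V" for y using opens_point[OF V that] point_subring by blast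
  show ?thesis
    unfolding subring_set_def regular_def using subring_setD[OF *] by blast
qed

lemma regular_const: "V \<in> opens U \<Longrightarrow> const c \<in> regular V"
  using opens_point[of V U] point_chart_ring chart_ring_basic(1) unfolding regular_def by blast

lemma regular_mono: "W \<subseteq> V \<Longrightarrow> f \<in> regular V \<Longrightarrow> f \<in> regular W"
  by (auto simp: regular_def)

text \<open>
  Indexing by strict order bounds makes the recursion uniform, with the zero operator at the
  bottom.
\<close>

definition dlt :: "nat \<Rightarrow> 'k::field point set \<Rightarrow> 'k operator set" where
  "dlt n U = (case n of 0 \<Rightarrow> {\<lambda>f. 0} | Suc m \<Rightarrow> diff_ops m U)"

lemma dlt_0: "P \<in> dlt 0 U \<longleftrightarrow> P = (\<lambda>f. 0)" by (simp add: dlt_def)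

lemma dlt_Suc:
  "P \<in> dlt (Suc n) U \<longleftrightarrow> P \<in> sheaf_endo U \<and> (\<forall>V\<in>opens U. \<forall>f\<in>regular V. commut P f \<in> dlt n V)"
  by (cases n) (simp_all add: dlt_def)

lemma diff_ops_dlt: "diff_ops n U = dlt (Suc n) U" by (simp add: dlt_def)

lemma sheaf_endoD: "P \<in> sheaf_endo U \<Longrightarrow> linear_op P"
  "P \<in> sheaf_endo U \<Longrightarrow> V \<in> opens U \<Longrightarrow> f \<in> regular V \<Longrightarrow> P f \<in> regular V"
  by (auto simp: sheaf_endo_def op_alg_simps)

lemma sheaf_endoI: "linear_op P \<Longrightarrow> (\<And>V f. V \<in> opens U \<Longrightarrow> f \<in> regular V \<Longrightarrow> P f \<in> regular V) \<Longrightarrow> P \<in> sheaf_endo U"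
  by (auto simp: sheaf_endo_def op_alg_simps)

lemma zero_sheaf_endo: "(\<lambda>f. 0) \<in> sheaf_endo U"
  using subring_setD(1)[OF regular_subring] by (intro sheaf_endoI linear_op_basic) blast

lemma commut_zero [simp]: "commut (\<lambda>f. 0) f = (\<lambda>g. 0)" by (simp add: commut_def)

lemma zero_dlt: "(\<lambda>f. 0) \<in> dlt n U"
  by (induction n arbitrary: U) (simp_all add: dlt_0 dlt_Suc zero_sheaf_endo)

lemma dlt_sheaf_endo: "P \<in> dlt n U \<Longrightarrow> P \<in> sheaf_endo U"
  by (cases n) (auto simp: dlt_0 dlt_Suc zero_sheaf_endo)

lemma dlt_linear: "P \<in> dlt n U \<Longrightarrow> linear_op P"
  using dlt_sheaf_endo sheaf_endoD(1) by blast

lemma dlt_restrict: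
  assumes "P \<in> dlt n U" "V \<subseteq> U"
  shows "P \<in> dlt n V"
proof -
  have *: "W \<in> opens U" if "W \<in> opens V" for W using that assms(2) by (auto simp: opens_def)
  show ?thesis
  proof (cases n)
    case (Suc m)
    then show ?thesis using assms(1) * by (auto simp: dlt_Suc intro!: sheaf_endoI dest: sheaf_endoD)
  qed (use assms in \<open>simp add: dlt_0\<close>)
qed

lemma dlt_Suc_mono: "P \<in> dlt n U \<Longrightarrow> P \<in> dlt (Suc n) U"
proof (induction n arbitrary: P U)
  case 0
  then show ?case using zero_dlt by (simp add: dlt_0)
next
  case (Suc n)
  show ?case
    unfolding dlt_Suc[of P "Suc n"] using Suc.prems Suc.IH unfolding dlt_Suc[of P n] by blast
qed

lemma dlt_mono: "n \<le> m \<Longrightarrow> P \<in> dlt n U \<Longrightarrow> P \<in> dlt m U"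
  by (induction m rule: dec_induct) (auto intro: dlt_Suc_mono)

lemma dlt_add:
  "P \<in> dlt n U \<Longrightarrow> Q \<in> dlt n U \<Longrightarrow> (\<lambda>f. P f + Q f) \<in> dlt n U"
proof (induction n arbitrary: P Q U)
  case 0
  then show ?case by (simp add: dlt_0)
next
  case (Suc n)
  show ?case
    unfolding dlt_Suc
  proof (intro conjI ballI)
    show "(\<lambda>f. P f + Q f) \<in> sheaf_endo U"
    proof (rule sheaf_endoI)
      note PQ = dlt_sheaf_endo[OF Suc.prems(1)] dlt_sheaf_endo[OF Suc.prems(2)]
      show "linear_op (\<lambda>f. P f + Q f)" by (rule linear_op_closed(2)[OF PQ[THEN sheaf_endoD(1)]])
      show "P f + Q f \<in> regular V" if V: "V \<in> opens U" "f \<in> regular V" for V f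
        by (rule subring_setD(3)[OF regular_subring[OF V(1)] PQ[THEN sheaf_endoD(2), OF V]])
    qed
    fix V f assume V: "V \<in> opens U" "f \<in> regular V"
    have "commut (\<lambda>f. P f + Q f) f = (\<lambda>g. commut P f g + commut Q f g)"
      by (simp add: commut_def algebra_simps)
    then show "commut (\<lambda>f. P f + Q f) f \<in> dlt n V"
      using Suc V by (simp add: dlt_Suc)
  qed
qed

lemma dlt_scale:
  "P \<in> dlt n U \<Longrightarrow> h \<in> regular U \<Longrightarrow> (\<lambda>f. h * P f) \<in> dlt n U"
proof (induction n arbitrary: P U)
  case 0
  then show ?case by (simp add: dlt_0)
next
  case (Suc n)
  show ?case
    unfolding dlt_Suc
  proof (intro conjI ballI)
    have P: "P \<in> sheaf_endo U" using Suc.prems by (simp add: dlt_Suc)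
    show "(\<lambda>f. h * P f) \<in> sheaf_endo U"
    proof (rule sheaf_endoI)
      show "linear_op (\<lambda>f. h * P f)" using linear_op_closed(5)[OF sheaf_endoD(1)[OF P] sheaf_endoD(1)[OF P]] .
      fix V f assume V: "V \<in> opens U" "f \<in> regular V"
      show "h * P f \<in> regular V"
        by (rule subring_setD(4)[OF regular_subring[OF V(1)] regular_mono[OF opens_subset[OF V(1)] Suc.prems(2)] sheaf_endoD(2)[OF P V]])
    qed
    fix V f assume V: "V \<in> opens U" "f \<in> regular V"
    have "commut (\<lambda>f. h * P f) f = (\<lambda>g. h * commut P f g)"
      by (simp add: commut_def algebra_simps)
    moreover have "commut P f \<in> dlt n V" using Suc.prems V by (simp add: dlt_Suc)
    ultimately show "commut (\<lambda>f. h * P f) f \<in> dlt n V"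
      using Suc.IH[of "commut P f" V] regular_mono[OF opens_subset[OF V(1)] Suc.prems(2)] by simp
  qed
qed

lemma dlt_const_mult: "U \<in> opens W \<Longrightarrow> P \<in> dlt n U \<Longrightarrow> (\<lambda>f. const c * P f) \<in> dlt n U"
  using dlt_scale regular_const by blast

lemma dlt_diff: "U \<in> opens W \<Longrightarrow> P \<in> dlt n U \<Longrightarrow> Q \<in> dlt n U \<Longrightarrow> (\<lambda>f. P f - Q f) \<in> dlt n U"
  using dlt_add[of P n U "\<lambda>f. const (- 1) * Q f"] dlt_const_mult[of U W Q n "- 1"] by simp

lemma dlt_sum: "(\<And>i. i \<in> I \<Longrightarrow> F i \<in> dlt n U) \<Longrightarrow> (\<lambda>f. \<Sum>i\<in>I. F i f) \<in> dlt n U"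
  by (induction I rule: infinite_finite_induct) (auto simp: zero_dlt intro: dlt_add)

text \<open>Taking the commutator with f is a derivation for composition, so it lowers the bound of
  one factor at a time. For strict bounds m + n - 1 expresses additivity of orders; when a bound is
  0 that factor, and with it the composite, is zero.\<close>

lemma dlt_comp:
  "P \<in> dlt m U \<Longrightarrow> Q \<in> dlt n U \<Longrightarrow> P \<circ> Q \<in> dlt (m + n - 1) U"
proof (induction "m + n" arbitrary: m n P Q U rule: less_induct)
  case less
  show ?case
  proof (cases "m = 0 \<or> n = 0")
    case True
    then have "P \<circ> Q = (\<lambda>f. 0)"
      using less.prems linear_opD(3)[OF dlt_linear[OF less.prems(1)]] by (auto simp: dlt_0)
    then show ?thesis by (simp add: zero_dlt)
  next
    case False
    then obtain m' n' where mn: "m = Suc m'" "n = Suc n'" by (metis not0_implies_Suc)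
    note P = less.prems(1)[unfolded mn] and Q = less.prems(2)[unfolded mn]
    note lP = linear_opD[OF dlt_linear[OF P]]
    have "P \<circ> Q \<in> dlt (Suc (m' + n')) U"
      unfolding dlt_Suc
    proof (intro conjI ballI)
      show "P \<circ> Q \<in> sheaf_endo U"
        using dlt_linear[OF P] dlt_linear[OF Q] sheaf_endoD(2)[OF dlt_sheaf_endo[OF P]] sheaf_endoD(2)[OF dlt_sheaf_endo[OF Q]]
        by (intro sheaf_endoI linear_op_closed(1)) auto
      fix V f assume V: "V \<in> opens U" "f \<in> regular V"
      have "commut (P \<circ> Q) f = (\<lambda>g. (commut P f \<circ> Q) g + (P \<circ> commut Q f) g)"
        by (simp add: commut_def lP fun_eq_iff)
      moreover have "commut P f \<circ> Q \<in> dlt (m' + Suc n' - 1) V"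
        using P V by (intro less.hyps dlt_restrict[OF Q opens_subset[OF V(1)]]) (simp_all add: mn dlt_Suc)
      moreover have "P \<circ> commut Q f \<in> dlt (Suc m' + n' - 1) V"
        using Q V by (intro less.hyps dlt_restrict[OF P opens_subset[OF V(1)]]) (simp_all add: mn dlt_Suc)
      ultimately show "commut (P \<circ> Q) f \<in> dlt (m' + n') V"
        using dlt_add[of "commut P f \<circ> Q" "m' + n'" V "P \<circ> commut Q f"] by simp
    qed
    then show ?thesis by (simp add: mn)
  qed
qed

text \<open>The functions regular on a small open set have fraction field \<open>k(t)\<close>.\<close>

lemma dlt_1_linear:
  assumes U: "U \<in> opens W" and P: "P \<in> dlt (Suc 0) U"
  shows "P (f * g) = f * P g"
proof -
  have lin: "P (a * g) = a * P g" if "V \<in> opens U" "a \<in> regular V" for V a g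
    using P that by (auto simp: dlt_Suc dlt_0 commut_def fun_eq_iff)
  obtain x where x: "x \<in> U" "zariski_open U" using U by (auto simp: opens_def)
  then obtain \<tau> h where h: "\<tau> \<in> coords" "h \<in> chart_ring \<tau>" "h \<noteq> 0" "x \<in> basic_open \<tau> h" "basic_open \<tau> h \<subseteq> U"
    unfolding zariski_open_def by blast
  have V: "basic_open \<tau> h \<in> opens U" using h zariski_open_basic[OF h(1-3)] by (auto simp: opens_def)
  have reg: "a \<in> regular (basic_open \<tau> h)" if "a \<in> chart_ring \<tau>" for a
    using that point_chart_ring by (auto simp: regular_def basic_open_def)
  obtain a b where ab: "b \<noteq> 0" "f = eval_at \<tau> a / eval_at \<tau> b" using eval_at_fraction[OF h(1)] .
  have nz: "eval_at \<tau> b \<noteq> 0" using ab eval_at_eq_0_iff[OF h(1)] by simp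
  \<comment> \<open>The denominator of f is regular on the basic open set and can be moved through
    P, which reduces the claim to the regular numerator.\<close>
  have "eval_at \<tau> b * P (f * g) = P (eval_at \<tau> b * (f * g))"
    by (rule lin[OF V reg, symmetric]) (simp add: chart_ring_def)
  also have "eval_at \<tau> b * (f * g) = eval_at \<tau> a * g" using ab nz by simp
  also have "P (eval_at \<tau> a * g) = eval_at \<tau> a * P g"
    by (rule lin[OF V reg]) (simp add: chart_ring_def)
  also have "\<dots> = eval_at \<tau> b * (f * P g)" using ab nz by simp
  finally show ?thesis using nz by (metis mult_left_cancel)
qed

text \<open>The induction of \<open>dlt_comp\<close> with the Jacobi identity in place of the
  product rule. Its gain of one order rests on the base case, where two operators of order 0 must
  truly commute.\<close>

lemma dlt_commutator:
  "U \<in> opens W \<Longrightarrow> P \<in> dlt m U \<Longrightarrow> Q \<in> dlt n U \<Longrightarrow> (\<lambda>f. P (Q f) - Q (P f)) \<in> dlt (m + n - 2) U"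
proof (induction "m + n" arbitrary: m n P Q U W rule: less_induct)
  case less
  show ?case
  proof (cases "m = 0 \<or> n = 0")
    case True
    then have "(\<lambda>f. P (Q f) - Q (P f)) = (\<lambda>f. 0)"
      using less.prems linear_opD(3)[OF dlt_linear[OF less.prems(2)]] linear_opD(3)[OF dlt_linear[OF less.prems(3)]]
      by (auto simp: dlt_0)
    then show ?thesis by (simp add: zero_dlt)
  next
    case False
    then obtain m' n' where mn: "m = Suc m'" "n = Suc n'" by (metis not0_implies_Suc)
    note P = less.prems(2)[unfolded mn] and Q = less.prems(3)[unfolded mn]
    note lP = linear_opD[OF dlt_linear[OF P]] and lQ = linear_opD[OF dlt_linear[OF Q]]
    show ?thesis
    proof (cases "m' + n'")
      case 0
      \<comment> \<open>Operators of order 0 are linear over the whole function field, hence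
        multiplications by their values at 1.\<close>
      have Pl: "P (f * g) = f * P g" and Ql: "Q (f * g) = f * Q g" for f g
        using dlt_1_linear[OF less.prems(1)] P Q 0 by simp_all
      have "P (Q f) - Q (P f) = 0" for f
        using Pl[of "Q f" 1] Ql[of "P f" 1] Pl[of f 1] Ql[of f 1] by simp
      then show ?thesis using zero_dlt by simp
    next
      case (Suc j)
      have "(\<lambda>f. P (Q f) - Q (P f)) \<in> dlt (Suc j) U"
        unfolding dlt_Suc
      proof (intro conjI ballI)
        have "P \<circ> Q \<in> dlt (m + n - 1) U" "Q \<circ> P \<in> dlt (n + m - 1) U"
          using dlt_comp less.prems(2,3) by blast+
        then have "(\<lambda>f. (P \<circ> Q) f - (Q \<circ> P) f) \<in> dlt (m + n - 1) U"
          using dlt_diff[OF less.prems(1), of "P \<circ> Q" "m + n - 1" "Q \<circ> P"] by (simp add: add.commute)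
        then show "(\<lambda>f. P (Q f) - Q (P f)) \<in> sheaf_endo U" using dlt_sheaf_endo by fastforce
        fix V f assume V: "V \<in> opens U" "f \<in> regular V"
        have "commut (\<lambda>f. P (Q f) - Q (P f)) f =
            (\<lambda>g. (commut P f (Q g) - Q (commut P f g)) + (P (commut Q f g) - commut Q f (P g)))"
          by (simp add: commut_def lP lQ fun_eq_iff right_diff_distrib)
        moreover have "(\<lambda>g. commut P f (Q g) - Q (commut P f g)) \<in> dlt (m' + Suc n' - 2) V"
          using P V by (intro less.hyps[of m' "Suc n'", OF _ opens_trans[OF less.prems(1) V(1)]] dlt_restrict[OF Q opens_subset[OF V(1)]])
            (simp_all add: mn dlt_Suc)
        moreover have "(\<lambda>g. P (commut Q f g) - commut Q f (P g)) \<in> dlt (Suc m' + n' - 2) V"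
          using Q V by (intro less.hyps[of "Suc m'" n', OF _ opens_trans[OF less.prems(1) V(1)]] dlt_restrict[OF P opens_subset[OF V(1)]])
            (simp_all add: mn dlt_Suc)
        ultimately show "commut (\<lambda>f. P (Q f) - Q (P f)) f \<in> dlt j V"
          using Suc by (simp add: dlt_add)
      qed
      then show ?thesis using Suc by (simp add: mn)
    qed
  qed
qed

lemma hasse_sheaf_endo:
  assumes \<tau>: "\<tau> \<in> coords" and U: "U \<subseteq> chart \<tau>"
  shows "hasse \<tau> r \<in> sheaf_endo U"
proof (rule sheaf_endoI[OF linear_op_hasse[OF \<tau>]])
  fix V f assume V: "V \<in> opens U" "f \<in> regular V"
  show "hasse \<tau> r f \<in> regular V"
    unfolding regular_def
  proof
    fix y assume y: "y \<in> V"
    then have "y \<in> chart \<tau>" using opens_subset[OF V(1)] U by blast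
    then show "hasse \<tau> r f \<in> y" using hasse_point[OF \<tau>] V(2) y by (auto simp: regular_def)
  qed
qed

text \<open>By the Leibniz rule the commutator with f is a combination of divided derivatives of
  orders below r, whose coefficients are derivatives of f and hence regular.\<close>

lemma hasse_dlt:
  assumes \<tau>: "\<tau> \<in> coords"
  shows "U \<subseteq> chart \<tau> \<Longrightarrow> hasse \<tau> r \<in> dlt (Suc r) U"
proof (induction r arbitrary: U rule: less_induct)
  case (less r)
  show ?case
    unfolding dlt_Suc
  proof (intro conjI ballI)
    show "hasse \<tau> r \<in> sheaf_endo U" by (rule hasse_sheaf_endo[OF \<tau> less.prems])
    fix V f assume V: "V \<in> opens U" "f \<in> regular V"
    have VU: "V \<subseteq> chart \<tau>" using opens_subset[OF V(1)] less.prems by blast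
    have "commut (hasse \<tau> r) f g = (\<Sum>i<r. hasse \<tau> (Suc i) f * hasse \<tau> (r - Suc i) g)" for g
      unfolding commut_def hasse_linear(4)[OF \<tau>] lessThan_Suc_atMost[symmetric] sum.lessThan_Suc_shift
      by (simp add: hasse_linear(3)[OF \<tau>])
    then have eq: "commut (hasse \<tau> r) f = (\<lambda>g. \<Sum>i\<in>{..<r}. hasse \<tau> (Suc i) f * hasse \<tau> (r - Suc i) g)" by blast
    have "(\<lambda>g. hasse \<tau> (Suc i) f * hasse \<tau> (r - Suc i) g) \<in> dlt r V" if i: "i \<in> {..<r}" for i
    proof (rule dlt_scale)
      show "hasse \<tau> (r - Suc i) \<in> dlt r V"
        using i by (intro dlt_mono[OF _ less.IH[OF _ VU]]) auto
      show "hasse \<tau> (Suc i) f \<in> regular V"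
        by (rule sheaf_endoD(2)[OF hasse_sheaf_endo[OF \<tau> VU] opens_self[OF V(1)] V(2)])
    qed
    then show "commut (hasse \<tau> r) f \<in> dlt r V" unfolding eq by (rule dlt_sum)
  qed
qed

lemma chart_ring_regular: "f \<in> chart_ring \<tau> \<Longrightarrow> f \<in> regular (chart \<tau>)"
  using point_chart_ring by (auto simp: regular_def)

lemma id_dlt: "U \<in> opens W \<Longrightarrow> id \<in> dlt (Suc 0) U"
  unfolding dlt_Suc dlt_0 by (auto intro!: sheaf_endoI linear_op_basic simp: commut_def)

lemma mult_dlt: "U \<in> opens W \<Longrightarrow> h \<in> regular U \<Longrightarrow> (\<lambda>f. h * f) \<in> dlt (Suc 0) U"
  using dlt_scale[OF id_dlt, of U W h] by simp

section \<open>Stalks of the differential operators of level m\<close>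

lemma stalk_filt_iff: "P \<in> stalk_filt x n \<longleftrightarrow> (\<exists>V. zariski_open V \<and> x \<in> V \<and> P \<in> dlt (Suc n) V)"
  by (auto simp: stalk_filt_def diff_ops_dlt)

lemma stalk_filt_common:
  assumes "P \<in> stalk_filt x n" "Q \<in> stalk_filt x m"
  obtains V where "V \<in> opens P1" "x \<in> V" "P \<in> dlt (Suc n) V" "Q \<in> dlt (Suc m) V"
proof -
  obtain V W where V: "zariski_open V" "x \<in> V" "P \<in> dlt (Suc n) V"
    and W: "zariski_open W" "x \<in> W" "Q \<in> dlt (Suc m) W"
    using assms by (auto simp: stalk_filt_iff)
  have "V \<inter> W \<in> opens P1"
    using zariski_open_Int[OF V(1) W(1)] V W by (auto simp: opens_def zariski_open_def)
  then show ?thesis using that dlt_restrict[OF V(3), of "V \<inter> W"] dlt_restrict[OF W(3), of "V \<inter> W"] V W by blast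
qed

lemma stalk_filtI: "V \<in> opens U \<Longrightarrow> x \<in> V \<Longrightarrow> P \<in> dlt (Suc n) V \<Longrightarrow> P \<in> stalk_filt x n"
  by (auto simp: stalk_filt_iff opens_def)

lemma stalk_filt_mono: "n \<le> m \<Longrightarrow> P \<in> stalk_filt x n \<Longrightarrow> P \<in> stalk_filt x m"
  unfolding stalk_filt_iff using dlt_mono[of "Suc n" "Suc m"] by blast

locale D_level = prime_card k for k :: "'k::{field,finite} itself" +
  fixes m q :: nat and x :: "'k point"
  assumes q: "q = CARD('k) ^ m" and x: "x \<in> P1"
begin

lemma q_pos: "q \<ge> 1" "q > 0"
  using prime_gt_0_nat[OF p] by (simp_all add: q Suc_le_eq)

text \<open>Two germs are first represented on a common open set. Then, as for distributions, the
  orders q + q - 1 of a commutator and q + (q - 1) of a product meet the bound 2 q - 1.\<close>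

sublocale level_data "op_alg :: ('k, 'k operator) module" "stalk_filt x" q "D_pairs m x"
proof
  let ?S = "stalk_filt x (2 * q - 1)"
  show "P \<oplus>\<^bsub>op_alg\<^esub> Q \<in> ?S" if PQ: "P \<in> ?S" "Q \<in> ?S" for P Q
  proof -
    obtain V where "V \<in> opens P1" "x \<in> V" "P \<in> dlt (Suc (2 * q - 1)) V" "Q \<in> dlt (Suc (2 * q - 1)) V"
      using stalk_filt_common[OF PQ] .
    then show ?thesis unfolding op_alg_simps by (intro stalk_filtI[of V P1] dlt_add)
  qed
  show "c \<odot>\<^bsub>op_alg\<^esub> P \<in> ?S" if P: "P \<in> ?S" for c P
  proof -
    obtain V where "V \<in> opens P1" "x \<in> V" "P \<in> dlt (Suc (2 * q - 1)) V" using stalk_filt_common[OF P P] .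
    then show ?thesis unfolding op_alg_simps by (intro stalk_filtI[of V P1] dlt_const_mult[of V P1])
  qed
  show "\<one>\<^bsub>op_alg\<^esub> \<in> ?S"
    unfolding op_alg_simps by (rule stalk_filtI[OF opens_P1 x dlt_mono[OF _ id_dlt[OF opens_P1]]]) simp
  show "P \<in> ?S" if "P \<in> stalk_filt x q" for P
    by (rule stalk_filt_mono[OF _ that]) simp
  show "P \<otimes>\<^bsub>op_alg\<^esub> Q \<ominus>\<^bsub>op_alg\<^esub> Q \<otimes>\<^bsub>op_alg\<^esub> P \<in> ?S" if PQ: "P \<in> stalk_filt x q" "Q \<in> stalk_filt x q" for P Q
  proof -
    obtain V where V: "V \<in> opens P1" "x \<in> V" "P \<in> dlt (Suc q) V" "Q \<in> dlt (Suc q) V"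
      using stalk_filt_common[OF PQ] .
    have "(\<lambda>f. P (Q f) - Q (P f)) \<in> dlt (Suc q + Suc q - 2) V"
      by (rule dlt_commutator[OF V(1,3,4)])
    moreover have "Suc q + Suc q - 2 = Suc (2 * q - 1)" using q_pos by simp
    ultimately have "(\<lambda>f. P (Q f) - Q (P f)) \<in> dlt (Suc (2 * q - 1)) V" by simp
    moreover have "P \<otimes>\<^bsub>op_alg\<^esub> Q \<ominus>\<^bsub>op_alg\<^esub> Q \<otimes>\<^bsub>op_alg\<^esub> P = (\<lambda>f. P (Q f) - Q (P f))"
      using dlt_linear[OF V(3)] dlt_linear[OF V(4)] by (simp add: op_alg_simps op_alg_minus linear_op_closed)
    ultimately show ?thesis using stalk_filtI[OF V(1,2)] by metis
  qed
  show "P \<in> ?S \<and> Q \<in> ?S \<and> P \<otimes>\<^bsub>op_alg\<^esub> Q \<in> ?S" if "(P, Q) \<in> D_pairs m x" for P Q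
  proof -
    have PQ: "P \<in> stalk_filt x q" "Q \<in> stalk_filt x (q - 1)" using that by (auto simp: D_pairs_def q)
    obtain V where V: "V \<in> opens P1" "x \<in> V" "P \<in> dlt (Suc q) V" "Q \<in> dlt (Suc (q - 1)) V"
      using stalk_filt_common[OF PQ] .
    have "P \<circ> Q \<in> dlt (Suc q + Suc (q - 1) - 1) V" by (rule dlt_comp[OF V(3,4)])
    moreover have "Suc q + Suc (q - 1) - 1 = Suc (2 * q - 1)" using q_pos by simp
    ultimately have "P \<circ> Q \<in> ?S" using stalk_filtI[OF V(1,2)] by simp
    moreover have "P \<in> ?S" by (rule stalk_filt_mono[OF _ PQ(1)]) simp
    moreover have "Q \<in> ?S" by (rule stalk_filt_mono[OF _ PQ(2)]) simp
    ultimately show ?thesis by (simp add: op_alg_simps)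
  qed
qed

lemma gen_add_op: "P \<in> stalk_filt x (2 * q - 1) \<Longrightarrow> Q \<in> stalk_filt x (2 * q - 1) \<Longrightarrow>
    gen P \<oplus>\<^bsub>U\<^esub> gen Q = gen (\<lambda>f. P f + Q f)"
  by (subst gen_add[symmetric]) (simp_all only: op_alg_simps(3))

lemma gen_id: "gen id = \<one>\<^bsub>U\<^esub>"
proof -
  have "(1 :: 'k) \<odot>\<^bsub>op_alg\<^esub> \<one>\<^bsub>op_alg\<^esub> = id" by (auto simp: op_alg_simps)
  then show ?thesis using gen_one[of 1] by simp
qed

lemma gen_comp:
  assumes "P \<in> stalk_filt x q" "Q \<in> stalk_filt x (q - 1)"
  shows "gen P \<otimes>\<^bsub>U\<^esub> gen Q = gen (P \<circ> Q)"
proof -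
  have "(P, Q) \<in> D_pairs m x" using assms by (simp add: D_pairs_def q)
  from gen_mult[OF this] show ?thesis by (simp add: op_alg_simps)
qed

text \<open>
  The relations of the level algebra give \<open>a \<otimes> b = a b\<close> only for \<open>b\<close> of order less than \<open>q\<close>;
  for a function \<open>a\<close> and \<open>b\<close> of order \<open>q\<close> one has to commute first.
\<close>

lemma gen_fun_mult:
  assumes N: "N \<in> opens P1" "x \<in> N" and h: "h \<in> regular N" and P: "P \<in> dlt (Suc q) N"
  shows "gen (\<lambda>f. h * f) \<otimes>\<^bsub>U\<^esub> gen P = gen (\<lambda>f. h * P f)"
proof -
  let ?h = "\<lambda>f. h * f"
  note lP = dlt_linear[OF P]
  have hS: "?h \<in> dlt (Suc 0) N" by (rule mult_dlt[OF N(1) h])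
  have S: "?h \<in> stalk_filt x q" "?h \<in> stalk_filt x (q - 1)" "P \<in> stalk_filt x q"
    by (rule stalk_filtI[OF N dlt_mono[OF _ hS]], simp)+ (rule stalk_filtI[OF N P])
  have Ph: "P \<circ> ?h \<in> stalk_filt x (2 * q - 1)"
    by (rule stalk_filtI[OF N dlt_mono[OF _ dlt_comp[OF P hS]]]) (use q_pos in simp)
  have C: "?h \<otimes>\<^bsub>op_alg\<^esub> P \<ominus>\<^bsub>op_alg\<^esub> P \<otimes>\<^bsub>op_alg\<^esub> ?h = (\<lambda>f. h * P f - P (h * f))"
    unfolding op_alg_simps(2)
    by (subst op_alg_minus[OF linear_op_closed(1)[OF dlt_linear[OF hS] lP] linear_op_closed(1)[OF lP dlt_linear[OF hS]]])
      (simp add: comp_def)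
  \<comment> \<open>In the reversed order the multiplicativity relation applies, because a function
    has order 0 \<le> q - 1. The commutator then corrects the order of the factors.\<close>
  have "gen ?h \<otimes>\<^bsub>U\<^esub> gen P = gen (P \<circ> ?h) \<oplus>\<^bsub>U\<^esub> gen (\<lambda>f. h * P f - P (h * f))"
    using gen_commutator[OF S(1,3)] gen_comp[OF S(3,2)] by (simp add: C)
  also have "\<dots> = gen (\<lambda>f. (P \<circ> ?h) f + (h * P f - P (h * f)))"
    using S_commutator[OF S(1,3)] by (intro gen_add_op Ph) (simp add: C)
  finally show ?thesis by simp
qed

end

section \<open>Commutativity of the diagram\<close>

text \<open>Evaluates sums of sections of \<open>D^(m)\<close>, which are not shown to form a group.\<close>

lemma finsum_eqI:
  fixes M (structure)
  assumes fin: "finite A" and zero: "g {} = \<zero>" and closed: "\<And>B. B \<subseteq> A \<Longrightarrow> g B \<in> carrier M"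
    and step: "\<And>x B. insert x B \<subseteq> A \<Longrightarrow> x \<notin> B \<Longrightarrow> f x \<oplus> g B = g (insert x B)"
  shows "finsum M f A = g A"
proof -
  let ?F = "foldSetD (carrier M) (add M \<circ> f) \<zero>"
  have uniq: "y = g B" if "(B, y) \<in> ?F" "B \<subseteq> A" for B y
    using that
  proof (induction rule: foldSetD.induct)
    case emptyI
    show ?case by (simp add: zero)
  next
    case (insertI x B y)
    then show ?case using step[of x B] by simp
  qed
  have ex: "(B, g B) \<in> ?F" if "B \<subseteq> A" for B
    using finite_subset[OF that fin] that
  proof (induction B)
    case empty
    then show ?case using closed[of "{}"] zero by (auto intro: foldSetD.emptyI)
  next
    case (insert x B)
    have eq: "(add M \<circ> f) x (g B) = g (insert x B)" using step[of x B] insert by simp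
    have "(insert x B, (add M \<circ> f) x (g B)) \<in> ?F"
      using insert closed[of "insert x B"] unfolding eq[symmetric] by (intro foldSetD.insertI) auto
    then show ?case unfolding eq .
  qed
  have "foldD (carrier M) (add M \<circ> f) \<zero> A = g A"
    unfolding foldD_def using ex uniq by (intro the_equality) auto
  then show ?thesis using fin by (simp add: finsum_def finprod_def)
qed

section \<open>Sections of level m and their chart expansions\<close>

lemma Dm_sections_simps:
  "s \<otimes>\<^bsub>Dm_sections m U\<^esub> s' = (\<lambda>x\<in>U. s x \<otimes>\<^bsub>Dm_stalk m x\<^esub> s' x)"
  "s \<oplus>\<^bsub>Dm_sections m U\<^esub> s' = (\<lambda>x\<in>U. s x \<oplus>\<^bsub>Dm_stalk m x\<^esub> s' x)"
  "\<one>\<^bsub>Dm_sections m U\<^esub> = (\<lambda>x\<in>U. \<one>\<^bsub>Dm_stalk m x\<^esub>)"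
  "\<zero>\<^bsub>Dm_sections m U\<^esub> = (\<lambda>x\<in>U. \<zero>\<^bsub>Dm_stalk m x\<^esub>)"
  by (simp_all add: Dm_sections_def)

lemma Dm_of_carrier:
  fixes P :: "'k::{field,finite} operator"
  assumes "U \<in> opens W" "P \<in> diff_ops (2 * CARD('k) ^ m - 1) U"
  shows "Dm_of m U P \<in> carrier (Dm_sections m U)"
proof -
  have "letter P \<in> carrier (free_alg (diff_ops (2 * CARD('k) ^ m - 1) U))"
    by (rule letter_in_carrier[OF assms(2)])
  then show ?thesis
    using opens_self[OF assms(1)] by (auto simp: Dm_sections_def Dm_of_def)
qed

lemma Dm_carrier_extensional: "s \<in> carrier (Dm_sections m U) \<Longrightarrow> s \<in> extensional U"
  by (simp add: Dm_sections_def)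

text \<open>For n = p a lift of \<open>Delta_T\<close> to the integral form: (p - 1)^i represents
  the sign (-1)^i modulo p. Natural coefficients let it be handled by additivity alone.\<close>

definition H_sum :: "nat \<Rightarrow> usl2" where
  "H_sum n = (\<Sum>i<n. of_nat ((n - 1) ^ i) * hb 0 i)"

lemma Kf_H_sum: "H_sum n \<in> Kf (int (n - 1))"
  unfolding H_sum_def
  by (rule Kf_closed(4), rule Kf_closed(3), rule Kf_mono[OF Kf_basic(3)]) auto

context prime_card begin

context
  fixes m q :: nat and N :: "'k point set"
  assumes q: "q = CARD('k) ^ m" and N: "N \<in> opens P1"
begin

lemma D_level_at: "x \<in> N \<Longrightarrow> D_level k m q x"
  using opens_subset[OF N] by unfold_locales (auto simp: q)

lemma Dm_of_at:
  assumes "x \<in> N"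
  shows "Dm_of m N P x = level_class op_alg (stalk_filt x) q (D_pairs m x) (letter P)"
    "Dm_stalk m x = level_alg op_alg (stalk_filt x) q (D_pairs m x)"
  using assms by (simp_all add: Dm_of_def Dm_germ_def Dm_stalk_def q)

lemma q_gt_0: "q > 0" using p_pos by (simp add: q)

lemma Dm_of_mult:
  assumes P: "\<And>x. x \<in> N \<Longrightarrow> P \<in> stalk_filt x q" and Q: "\<And>x. x \<in> N \<Longrightarrow> Q \<in> stalk_filt x (q - 1)"
  shows "Dm_of m N P \<otimes>\<^bsub>Dm_sections m N\<^esub> Dm_of m N Q = Dm_of m N (P \<circ> Q)"
proof
  fix x
  show "(Dm_of m N P \<otimes>\<^bsub>Dm_sections m N\<^esub> Dm_of m N Q) x = Dm_of m N (P \<circ> Q) x"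
  proof (cases "x \<in> N")
    case True
    interpret D_level k m q x by (rule D_level_at[OF True])
    show ?thesis
      using gen_comp[OF P[OF True] Q[OF True]] True by (simp add: Dm_sections_simps Dm_of_at)
  qed (simp add: Dm_sections_simps Dm_of_def)
qed

lemma Dm_fun_mult:
  assumes h: "h \<in> regular N" and P: "P \<in> dlt (Suc q) N"
  shows "Dm_fun m N h \<otimes>\<^bsub>Dm_sections m N\<^esub> Dm_of m N P = Dm_of m N (\<lambda>f. h * P f)"
proof
  fix x
  show "(Dm_fun m N h \<otimes>\<^bsub>Dm_sections m N\<^esub> Dm_of m N P) x = Dm_of m N (\<lambda>f. h * P f) x"
  proof (cases "x \<in> N")
    case True
    interpret D_level k m q x by (rule D_level_at[OF True])
    show ?thesis
      unfolding Dm_fun_def using gen_fun_mult[OF N True h P] True by (simp add: Dm_sections_simps Dm_of_at)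
  qed (simp add: Dm_sections_simps Dm_of_def)
qed

text \<open>Sums remain sections given by single operators as long as all terms have order at most 2
  q - 1, the range in which operators are generators.\<close>

lemma Dm_of_sum:
  assumes fin: "finite I" and F: "\<And>i. i \<in> I \<Longrightarrow> F i \<in> dlt (2 * q) N"
    and s: "\<And>i. i \<in> I \<Longrightarrow> s i = Dm_of m N (F i)"
  shows "finsum (Dm_sections m N) s I = Dm_of m N (\<lambda>f. \<Sum>i\<in>I. F i f)"
proof (rule finsum_eqI[OF fin])
  have sum: "(\<lambda>f. \<Sum>i\<in>B. F i f) \<in> dlt (2 * q) N" if "B \<subseteq> I" for B
    by (rule dlt_sum) (use that F in blast)
  have q2: "2 * q = Suc (2 * q - 1)" using q_gt_0 by simp
  show "Dm_of m N (\<lambda>f. \<Sum>i\<in>{}. F i f) = \<zero>\<^bsub>Dm_sections m N\<^esub>"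
  proof
    fix x
    show "Dm_of m N (\<lambda>f. \<Sum>i\<in>{}. F i f) x = \<zero>\<^bsub>Dm_sections m N\<^esub> x"
    proof (cases "x \<in> N")
      case True
      interpret D_level k m q x by (rule D_level_at[OF True])
      have "gen (0 \<odot>\<^bsub>op_alg\<^esub> \<one>\<^bsub>op_alg\<^esub>) = \<zero>\<^bsub>U\<^esub>"
        unfolding gen_one using U.smult_l_zero[OF U.one_closed] by simp
      then have "gen (\<lambda>f. 0) = \<zero>\<^bsub>U\<^esub>" by (simp add: op_alg_simps)
      then show ?thesis using True by (simp add: Dm_sections_simps Dm_of_at)
    qed (simp add: Dm_sections_simps Dm_of_def)
  qed
  show "Dm_of m N (\<lambda>f. \<Sum>i\<in>B. F i f) \<in> carrier (Dm_sections m N)" if "B \<subseteq> I" for B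
    using sum[OF that] q2 by (intro Dm_of_carrier[OF N]) (simp add: diff_ops_dlt q)
  fix i B assume iB: "insert i B \<subseteq> I" "i \<notin> B"
  have finB: "finite B" using iB(1) fin by (meson finite_subset insert_subset)
  show "s i \<oplus>\<^bsub>Dm_sections m N\<^esub> Dm_of m N (\<lambda>f. \<Sum>i\<in>B. F i f) = Dm_of m N (\<lambda>f. \<Sum>i\<in>insert i B. F i f)"
  proof
    fix x
    show "(s i \<oplus>\<^bsub>Dm_sections m N\<^esub> Dm_of m N (\<lambda>f. \<Sum>i\<in>B. F i f)) x = Dm_of m N (\<lambda>f. \<Sum>i\<in>insert i B. F i f) x"
    proof (cases "x \<in> N")
      case True
      interpret D_level k m q x by (rule D_level_at[OF True])
      have "F i \<in> stalk_filt x (2 * q - 1)" "(\<lambda>f. \<Sum>i\<in>B. F i f) \<in> stalk_filt x (2 * q - 1)"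
        using F[of i] sum[of B] iB q2 by (auto intro!: stalk_filtI[OF N True])
      from gen_add_op[OF this] show ?thesis
        using True iB finB s[of i] by (simp add: Dm_sections_simps Dm_of_at)
    qed (simp add: Dm_sections_simps Dm_of_def)
  qed
qed

end

context
  fixes m q :: nat and \<tau> :: "'k ratfun"
  assumes q: "q = CARD('k) ^ m" and \<tau>: "\<tau> \<in> coords"
begin

text \<open>For l < q the second factor is an empty power. For l = q the first factor is the
  identity operator and the second a first power. In both cases one generator remains.\<close>

lemma Dm_partial_eq:
  assumes "l \<le> q"
  shows "Dm_partial m \<tau> l = Dm_of m (chart \<tau>) (hasse \<tau> l)"
proof
  fix x
  note C = opens_chart(2)[OF \<tau>]
  have q0: "q > 0" by (rule q_gt_0[OF q C])
  have id: "hasse \<tau> 0 = id" by (auto simp: hasse_linear(3)[OF \<tau>])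
  show "Dm_partial m \<tau> l x = Dm_of m (chart \<tau>) (hasse \<tau> l) x"
  proof (cases "x \<in> chart \<tau>")
    case True
    interpret D_level k m q x by (rule D_level_at[OF q C True])
    have closed: "gen (hasse \<tau> l) \<in> carrier U" if "l \<le> q" for l
    proof (rule gen_closed, rule stalk_filtI[OF C True])
      show "hasse \<tau> l \<in> dlt (Suc (2 * q - 1)) (chart \<tau>)"
        by (rule dlt_mono[OF _ hasse_dlt[OF \<tau> subset_refl]]) (use that q0 in simp)
    qed
    note at = Dm_of_at[OF q C True]
    consider "l < q" | "l = q" using assms by linarith
    then show ?thesis
    proof cases
      case 1
      then show ?thesis
        using True closed[of l] by (simp add: Dm_partial_def Let_def q[symmetric] Dm_sections_simps at)
    next
      case 2
      then show ?thesis
        using True closed[of q] q0 gen_id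
        by (simp add: Dm_partial_def Let_def q[symmetric] Dm_sections_simps at id One_nat_def)
    qed
  next
    case False
    then show ?thesis by (simp add: Dm_partial_def Let_def Dm_sections_simps Dm_of_def)
  qed
qed

lemma chart_term:
  assumes "l \<le> q" "h \<in> chart_ring \<tau>"
  shows "Dm_fun m (chart \<tau>) h \<otimes>\<^bsub>Dm_sections m (chart \<tau>)\<^esub> Dm_partial m \<tau> l
    = Dm_of m (chart \<tau>) (\<lambda>f. h * hasse \<tau> l f)"
  unfolding Dm_partial_eq[OF assms(1)]
  by (rule Dm_fun_mult[OF q opens_chart(2)[OF \<tau>] chart_ring_regular[OF assms(2)]])
    (rule dlt_mono[OF _ hasse_dlt[OF \<tau> subset_refl]], use assms in simp)

lemma chart_term_dlt:
  assumes "l \<le> q" "h \<in> chart_ring \<tau>"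
  shows "(\<lambda>f. h * hasse \<tau> l f) \<in> dlt (Suc q) (chart \<tau>)"
  by (rule dlt_scale[OF dlt_mono[OF _ hasse_dlt[OF \<tau> subset_refl]] chart_ring_regular[OF assms(2)]])
    (use assms in simp)

lemma chart_expansion_eq:
  assumes "N \<le> q" "\<And>l. l \<le> N \<Longrightarrow> h l \<in> chart_ring \<tau>"
  shows "chart_expansion m \<tau> N h = Dm_of m (chart \<tau>) (\<lambda>f. \<Sum>l\<le>N. h l * hasse \<tau> l f)"
  unfolding chart_expansion_def Let_def
proof (rule Dm_of_sum[OF q opens_chart(2)[OF \<tau>]])
  fix l assume "l \<in> {..N}"
  then have l: "l \<le> q" "h l \<in> chart_ring \<tau>" using assms by auto
  show "(\<lambda>f. h l * hasse \<tau> l f) \<in> dlt (2 * q) (chart \<tau>)"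
    by (rule dlt_mono[OF _ chart_term_dlt[OF l]]) (use q_gt_0[OF q opens_chart(2)[OF \<tau>]] in simp)
  show "Dm_fun m (chart \<tau>) (h l) \<otimes>\<^bsub>Dm_sections m (chart \<tau>)\<^esub> Dm_partial m \<tau> l
      = Dm_of m (chart \<tau>) (\<lambda>f. h l * hasse \<tau> l f)"
    by (rule chart_term[OF l])
qed simp

end

lemma dwork_op_dlt: "\<tau> \<in> coords \<Longrightarrow> (dwork_op \<tau> :: 'k operator) \<in> dlt CARD('k) (chart \<tau>)"
proof -
  assume \<tau>: "\<tau> \<in> (coords :: 'k ratfun set)"
  have neg: "- \<tau> \<in> chart_ring \<tau>" by (rule subring_setD(5)[OF chart_ring_subring chart_ring_basic(2)])
  have "(\<lambda>g. \<Sum>r\<in>{..<CARD('k)}. (- \<tau>) ^ r * hasse \<tau> r g) \<in> dlt CARD('k) (chart \<tau>)"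
    by (rule dlt_sum, rule dlt_scale[OF dlt_mono[OF _ hasse_dlt[OF \<tau> subset_refl]]
          chart_ring_regular[OF subring_setD(7)[OF chart_ring_subring neg]]]) simp
  then show "(dwork_op \<tau> :: 'k operator) \<in> dlt CARD('k) (chart \<tau>)"
    by (simp add: dwork_op_def[abs_def])
qed

lemma dwork_eq:
  assumes \<tau>: "\<tau> \<in> coords"
  shows "dwork (Suc m) \<tau> = Dm_of (Suc m) (chart \<tau>) (dwork_op \<tau> :: 'k operator)"
proof -
  let ?q = "CARD('k) ^ Suc m"
  have pq: "CARD('k) \<le> ?q" using p_pos by simp
  have neg: "- \<tau> \<in> chart_ring \<tau>" by (rule subring_setD(5)[OF chart_ring_subring chart_ring_basic(2)])
  have "dwork (Suc m) \<tau> = Dm_of (Suc m) (chart \<tau>) (\<lambda>f. \<Sum>r\<in>{..<CARD('k)}. (- \<tau>) ^ r * hasse \<tau> r f)"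
    unfolding dwork_def
  proof (rule Dm_of_sum[OF refl opens_chart(2)[OF \<tau>]])
    fix r assume "r \<in> {..<CARD('k)}"
    then have "r \<le> ?q" using order_trans[OF less_imp_le pq] by simp
    from chart_term_dlt[OF refl \<tau> this subring_setD(7)[OF chart_ring_subring neg, of r]]
    show "(\<lambda>f. (- \<tau>) ^ r * hasse \<tau> r f) \<in> dlt (2 * ?q) (chart \<tau>)"
      by (rule dlt_mono[rotated]) (use pq p_pos in simp)
  qed simp_all
  then show ?thesis by (simp add: dwork_op_def[abs_def])
qed

text \<open>The indices l p stay at most p^(m+1), and the Dwork operator has order at most p - 1.
  This fits the multiplicativity relation, so each term is the section of a composite operator and
  \<open>garnier_op\<close> adds them up.\<close>

lemma garnier_expansion_eq:
  assumes \<tau>: "\<tau> \<in> coords" and \<sigma>: "\<sigma> \<in> coords" and N: "N \<le> CARD('k) ^ m"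
    and h: "\<And>l. l \<le> N \<Longrightarrow> h l \<in> chart_ring \<tau>"
    and P: "hasse \<sigma> i = (\<lambda>g. \<Sum>l\<le>N. h l * hasse \<tau> l g)"
  shows "garnier_expansion m \<tau> N h = Dm_of (Suc m) (chart \<tau>) (hasse \<sigma> (i * CARD('k)) \<circ> (dwork_op \<tau> :: 'k operator))"
proof -
  let ?q = "CARD('k) ^ Suc m" and ?D = "dwork_op \<tau> :: 'k operator"
  note C = opens_chart(2)[OF \<tau>]
  have pq: "CARD('k) \<le> ?q" using p_pos by simp
  have "garnier_expansion m \<tau> N h = Dm_of (Suc m) (chart \<tau>) (\<lambda>f. \<Sum>l\<le>N. h l ^ CARD('k) * hasse \<tau> (l * CARD('k)) (?D f))"
    unfolding garnier_expansion_def Let_def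
  proof (rule Dm_of_sum[OF refl C])
    fix l assume "l \<in> {..N}"
    then have l: "l * CARD('k) \<le> ?q" and hl: "h l ^ CARD('k) \<in> chart_ring \<tau>"
      using N h subring_setD(7)[OF chart_ring_subring] by (auto simp: mult.commute)
    note T = chart_term_dlt[OF refl \<tau> l hl]
    have "(\<lambda>f. h l ^ CARD('k) * hasse \<tau> (l * CARD('k)) f) \<circ> ?D \<in> dlt (Suc ?q + CARD('k) - 1) (chart \<tau>)"
      by (rule dlt_comp[OF T dwork_op_dlt[OF \<tau>]])
    then show "(\<lambda>f. h l ^ CARD('k) * hasse \<tau> (l * CARD('k)) (?D f)) \<in> dlt (2 * ?q) (chart \<tau>)"
      using dlt_mono[of "Suc ?q + CARD('k) - 1" "2 * ?q"] pq by (simp add: comp_def)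
    have "Dm_of (Suc m) (chart \<tau>) (\<lambda>f. h l ^ CARD('k) * hasse \<tau> (l * CARD('k)) f) \<otimes>\<^bsub>Dm_sections (Suc m) (chart \<tau>)\<^esub>
        Dm_of (Suc m) (chart \<tau>) ?D = Dm_of (Suc m) (chart \<tau>) ((\<lambda>f. h l ^ CARD('k) * hasse \<tau> (l * CARD('k)) f) \<circ> ?D)"
    proof (rule Dm_of_mult[OF refl C])
      fix x assume x: "x \<in> chart \<tau>"
      show "(\<lambda>f. h l ^ CARD('k) * hasse \<tau> (l * CARD('k)) f) \<in> stalk_filt x ?q" by (rule stalk_filtI[OF C x T])
      show "?D \<in> stalk_filt x (?q - 1)"
        by (rule stalk_filtI[OF C x dlt_mono[OF _ dwork_op_dlt[OF \<tau>]]]) (use pq in simp)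
    qed
    then show "Dm_fun (Suc m) (chart \<tau>) (h l ^ CARD('k)) \<otimes>\<^bsub>Dm_sections (Suc m) (chart \<tau>)\<^esub>
        Dm_partial (Suc m) \<tau> (l * CARD('k)) \<otimes>\<^bsub>Dm_sections (Suc m) (chart \<tau>)\<^esub> dwork (Suc m) \<tau>
      = Dm_of (Suc m) (chart \<tau>) (\<lambda>f. h l ^ CARD('k) * hasse \<tau> (l * CARD('k)) (?D f))"
      unfolding chart_term[OF refl \<tau> l hl] dwork_eq[OF \<tau>] by (simp add: comp_def)
  qed simp
  then show ?thesis unfolding garnier_op[OF \<tau> \<sigma> P] by (simp add: comp_def)
qed

text \<open>Outside the chart of \<sigma> regularity and order of the operator are not evident. They
  follow from its expansion in the coordinate of a chart that contains the point.\<close>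

lemma hasse_stalk:
  assumes x: "x \<in> P1" and \<sigma>: "\<sigma> \<in> coords"
  shows "(hasse \<sigma> n :: 'k operator) \<in> stalk_filt x n"
proof -
  obtain \<tau> where \<tau>: "\<tau> \<in> coords" "x \<in> chart \<tau>" using x by (auto simp: P1_def)
  obtain f where f: "\<forall>l\<le>n. f l \<in> chart_ring \<tau>" "hasse \<sigma> n = (\<lambda>g. \<Sum>l\<le>n. f l * hasse \<tau> l g)"
    using hasse_expansion[OF \<tau>(1) \<sigma>] by blast
  have "(\<lambda>g. \<Sum>l\<in>{..n}. f l * hasse \<tau> l g) \<in> dlt (Suc n) (chart \<tau>)"
    by (rule dlt_sum, rule dlt_scale[OF dlt_mono[OF _ hasse_dlt[OF \<tau>(1) subset_refl]] chart_ring_regular]) (use f in auto)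
  then show ?thesis unfolding f(2) by (rule stalk_filtI[OF opens_chart(2)[OF \<tau>(1)] \<tau>(2)])
qed

lemma dwork_op_stalk:
  assumes x: "x \<in> P1" and \<sigma>: "\<sigma> \<in> coords" and n: "CARD('k) \<le> Suc n"
  shows "(dwork_op \<sigma> :: 'k operator) \<in> stalk_filt x n"
proof -
  obtain \<tau> where \<tau>: "\<tau> \<in> coords" "x \<in> chart \<tau>" using x by (auto simp: P1_def)
  show ?thesis
    unfolding dwork_op_eq[OF \<sigma> \<tau>(1)]
    by (rule stalk_filtI[OF opens_chart(2)[OF \<tau>(1)] \<tau>(2) dlt_mono[OF n dwork_op_dlt[OF \<tau>(1)]]])
qed

section \<open>The action of distributions and the comparison of both paths\<close>

lemma rho_simps:
  assumes \<rho>: "is_rho (\<rho> :: sl2_free set set \<Rightarrow> 'k operator)"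
  shows "x \<in> Kost \<Longrightarrow> y \<in> Kost \<Longrightarrow> \<rho> (dist_of k (x * y)) = \<rho> (dist_of k x) \<circ> \<rho> (dist_of k y)"
    and "x \<in> Kost \<Longrightarrow> y \<in> Kost \<Longrightarrow> \<rho> (dist_of k (x + y)) = (\<lambda>f. \<rho> (dist_of k x) f + \<rho> (dist_of k y) f)"
    and "x \<in> Kost \<Longrightarrow> \<rho> (dist_of k (of_nat n * x)) = (\<lambda>f. of_nat n * \<rho> (dist_of k x) f)"
    and "\<rho> (dist_of k 1) = id"
    and "x \<in> Kost \<Longrightarrow> linear_op (\<rho> (dist_of k x))"
    and "\<rho> (dist_of k (dE n)) = hasse coord_t n" "\<rho> (dist_of k (dF n)) = hasse (inverse coord_t) n"
proof -
  have hom: "\<rho> \<in> alg_hom A (D_sections P1)" and gens: "\<And>n. \<rho> (dist_E k n) = hasse coord_t n" "\<And>n. \<rho> (dist_F k n) = hasse (inverse coord_t) n"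
    using \<rho> by (auto simp: is_rho_def k)
  have ops: "P \<otimes>\<^bsub>D_sections P1\<^esub> Q = P \<circ> Q" "P \<oplus>\<^bsub>D_sections P1\<^esub> Q = (\<lambda>f. P f + Q f)"
    "\<one>\<^bsub>D_sections P1\<^esub> = id" "c \<odot>\<^bsub>D_sections P1\<^esub> P = (\<lambda>f. const c * P f)" for P Q :: "'k operator" and c
    by (simp_all add: D_sections_def op_alg_def)
  have mult: "\<rho> (a \<otimes>\<^bsub>A\<^esub> b) = \<rho> a \<circ> \<rho> b" and add: "\<rho> (a \<oplus>\<^bsub>A\<^esub> b) = (\<lambda>f. \<rho> a f + \<rho> b f)"
    and sm: "\<rho> (c \<odot>\<^bsub>A\<^esub> a) = (\<lambda>f. const c * \<rho> a f)" and one: "\<rho> \<one>\<^bsub>A\<^esub> = id"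
    and closed: "\<rho> a \<in> carrier (D_sections P1)"
    if "a \<in> carrier A" "b \<in> carrier A" for a b c
    using hom that unfolding alg_hom_def nonunital_alg_hom_def nonunital_ring_hom_def ops by (auto simp: ops)
  show "x \<in> Kost \<Longrightarrow> y \<in> Kost \<Longrightarrow> \<rho> (dist_of k (x * y)) = \<rho> (dist_of k x) \<circ> \<rho> (dist_of k y)"
    by (simp only: dist_of_mult[symmetric] mult dist_of_closed)
  show "x \<in> Kost \<Longrightarrow> y \<in> Kost \<Longrightarrow> \<rho> (dist_of k (x + y)) = (\<lambda>f. \<rho> (dist_of k x) f + \<rho> (dist_of k y) f)"
    by (simp only: dist_of_add[symmetric] add dist_of_closed)
  show "x \<in> Kost \<Longrightarrow> \<rho> (dist_of k (of_nat n * x)) = (\<lambda>f. of_nat n * \<rho> (dist_of k x) f)"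
    using sm[OF dist_of_closed A.one_closed, of x "of_nat n"] by (simp only: dist_of_smult const_of_nat)
  show "\<rho> (dist_of k 1) = id" using one[OF A.one_closed A.one_closed] by (simp add: dist_of_one)
  show "linear_op (\<rho> (dist_of k x))" if "x \<in> Kost"
    using closed[OF dist_of_closed[OF that] dist_of_closed[OF that]] by (auto simp: D_sections_def diff_ops_dlt dest: dlt_linear)
  show "\<rho> (dist_of k (dE n)) = hasse coord_t n" "\<rho> (dist_of k (dF n)) = hasse (inverse coord_t) n"
    using gens by (simp_all add: dist_gens)
qed

lemma minus_one_power: "(of_nat ((CARD('k) - 1) ^ i) :: 'a::comm_ring_1) = (- 1) ^ i" if "CHAR('a) = CARD('k)"
proof -
  have "(of_nat CARD('k) :: 'a) = 0" using that by (metis of_nat_CHAR)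
  then show ?thesis using p_pos by (simp add: of_nat_diff)
qed

lemma hb_Kost: "hb 0 n \<in> Kost" by (rule Kost_basic)

text \<open>\<rho> is prescribed on divided powers of E and F only. Its values on the binomials of H
  are governed by H = E F - F E and the recursion \<open>hb_Suc\<close>, integral identities that
  survive reduction; they are the hypotheses of \<open>H_operator\<close>.\<close>

lemma rho_H_sum:
  assumes odd: "CARD('k) > 2" and \<rho>: "is_rho (\<rho> :: sl2_free set set \<Rightarrow> 'k operator)"
  shows "\<rho> (dist_of k (H_sum CARD('k))) = dwork_op coord_t"
proof -
  note r = rho_simps[OF \<rho>]
  define T where "T n = \<rho> (dist_of k (hb 0 n))" for n
  have t: "coord_t \<in> (coords :: 'k ratfun set)" by (simp add: coords_def)
  have minus: "\<rho> (dist_of k (x - y)) = (\<lambda>f. \<rho> (dist_of k x) f - \<rho> (dist_of k y) f)" if xy: "x \<in> Kost" "y \<in> Kost" for x y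
  proof -
    have "\<rho> (dist_of k (x - y + y)) = (\<lambda>f. \<rho> (dist_of k (x - y)) f + \<rho> (dist_of k y) f)" by (rule r(2)[OF Kost_diff[OF xy] xy(2)])
    then show ?thesis by (simp add: fun_eq_iff)
  qed
  have H: "hb 0 1 = dE 1 * dF 1 - dF 1 * dE 1"
    using hb_Suc[of 0 0] dE_Suc[of 0] dF_Suc[of 0] uEF by simp
  have "(\<lambda>g. \<Sum>i<CARD('k). (- 1) ^ i * T i g) = dwork_op coord_t"
  proof (rule H_operator[OF odd t])
    show "linear_op (T n)" for n unfolding T_def by (rule r(5)[OF hb_Kost])
    show "T 0 = id" by (simp add: T_def r(4))
    show "T 1 g = hasse coord_t 1 (hasse (inverse coord_t) 1 g) - hasse (inverse coord_t) 1 (hasse coord_t 1 g)" for g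
      unfolding T_def H by (simp add: minus r(1,6,7) Kost_basic Kost_closed)
    show "of_nat (Suc n) * T (Suc n) g = T n (T 1 g - of_nat n * g)" for n g
    proof -
      have "hb 0 1 - of_nat n * 1 \<in> Kost" by (intro Kost_diff Kost_of_nat Kost_closed hb_Kost)
      moreover have "hb 0 n * (hb 0 1 - of_nat n * 1) = of_nat (Suc n) * hb 0 (Suc n)"
        using hb_Suc[of n 0] hb_Suc[of 0 0] by simp
      ultimately have "\<rho> (dist_of k (of_nat (Suc n) * hb 0 (Suc n))) = \<rho> (dist_of k (hb 0 n)) \<circ> \<rho> (dist_of k (hb 0 1 - of_nat n * 1))"
        using r(1)[OF hb_Kost] by metis
      moreover have "\<rho> (dist_of k (hb 0 1 - of_nat n * 1)) = (\<lambda>f. T 1 f - of_nat n * f)"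
        by (subst minus[OF hb_Kost Kost_of_nat[OF Kost_closed(2)]], subst r(3)[OF Kost_closed(2)]) (simp add: r(4) T_def)
      ultimately show ?thesis unfolding r(3)[OF hb_Kost] T_def by (simp add: fun_eq_iff)
    qed
  qed
  moreover have "\<rho> (dist_of k (\<Sum>i\<in>I. of_nat (c i) * hb 0 i)) = (\<lambda>g. \<Sum>i\<in>I. of_nat (c i) * T i g)
      \<and> (\<Sum>i\<in>I. of_nat (c i) * hb 0 i) \<in> Kost" if "finite I" for I c
    using that
  proof (induction I)
    case empty
    have "\<rho> (dist_of k (of_nat 0 * 1)) = (\<lambda>f. of_nat 0 * \<rho> (dist_of k 1) f)" by (rule r(3)[OF Kost_closed(2)])
    then show ?case by (simp add: Kost_closed)
  next
    case (insert i I)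
    then show ?case
      using r(2)[OF Kost_of_nat[OF hb_Kost, of "c i" i], of "\<Sum>i\<in>I. of_nat (c i) * hb 0 i"]
        Kost_closed(3)[OF Kost_of_nat[OF hb_Kost, of "c i" i]]
      by (simp add: r(3)[OF hb_Kost] T_def)
  qed
  ultimately show ?thesis
    unfolding H_sum_def by (simp only: finite_lessThan minus_one_power[OF CHAR_ratfun])
qed

end

context prime_card begin

lemma is_rho_level_simps:
  assumes \<rho>m: "is_rho_level (\<rho> :: sl2_free set set \<Rightarrow> 'k operator) m \<rho>m" and q: "q = CARD('k) ^ m"
  defines "B \<equiv> U_alg m :: ('k, 'k U_elem) module"
  shows "u \<in> carrier B \<Longrightarrow> v \<in> carrier B \<Longrightarrow> \<rho>m (u \<otimes>\<^bsub>B\<^esub> v) = \<rho>m u \<otimes>\<^bsub>Dm_sections m P1\<^esub> \<rho>m v"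
    and "u \<in> carrier B \<Longrightarrow> v \<in> carrier B \<Longrightarrow> \<rho>m (u \<oplus>\<^bsub>B\<^esub> v) = \<rho>m u \<oplus>\<^bsub>Dm_sections m P1\<^esub> \<rho>m v"
    and "u \<in> carrier B \<Longrightarrow> \<rho>m u \<in> carrier (Dm_sections m P1)"
    and "x \<in> Kf (int (2 * q - 1)) \<Longrightarrow> \<rho>m (U_gen m (dist_of k x)) = Dm_of m P1 (\<rho> (dist_of k x))"
proof -
  have hom: "\<rho>m \<in> alg_hom B (Dm_sections m P1)" using \<rho>m by (simp add: is_rho_level_def B_def)
  show "u \<in> carrier B \<Longrightarrow> v \<in> carrier B \<Longrightarrow> \<rho>m (u \<otimes>\<^bsub>B\<^esub> v) = \<rho>m u \<otimes>\<^bsub>Dm_sections m P1\<^esub> \<rho>m v"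
    "u \<in> carrier B \<Longrightarrow> v \<in> carrier B \<Longrightarrow> \<rho>m (u \<oplus>\<^bsub>B\<^esub> v) = \<rho>m u \<oplus>\<^bsub>Dm_sections m P1\<^esub> \<rho>m v"
    "u \<in> carrier B \<Longrightarrow> \<rho>m u \<in> carrier (Dm_sections m P1)"
    using hom by (auto simp: alg_hom_def nonunital_alg_hom_def nonunital_ring_hom_def)
  show "\<rho>m (U_gen m (dist_of k x)) = Dm_of m P1 (\<rho> (dist_of k x))" if "x \<in> Kf (int (2 * q - 1))"
  proof -
    have "dist_of k x \<in> dist_filt k (2 * q - 1)" unfolding dist_filt_eq using that by (rule imageI)
    then show ?thesis using \<rho>m unfolding is_rho_level_def k q by blast
  qed
qed

text \<open>All terms have order at most p - 1, within the range where the map from distributions to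
  \<open>U^(m+1)\<close> is additive, so the sum in the level algebra is the image of a single
  distribution.\<close>

lemma Delta_T_eq:
  "(Delta_T (Suc m) :: 'k U_elem) = U_gen (Suc m) (dist_of k (H_sum CARD('k)))"
proof -
  let ?q = "CARD('k) ^ Suc m"
  interpret U_level k "Suc m" ?q by unfold_locales simp
  have pq: "CARD('k) \<le> ?q" using p_pos by simp
  define s where "s I = (\<Sum>i\<in>I. of_nat ((CARD('k) - 1) ^ i) * hb 0 i)" for I
  have hbK: "hb 0 i \<in> Kf (int (2 * ?q - 1))" if "i < CARD('k)" for i
    by (rule Kf_mono[OF Kf_basic(3)]) (use that pq in linarith)
  have sK: "s I \<in> Kf (int (2 * ?q - 1))" if "I \<subseteq> {..<CARD('k)}" for I
    unfolding s_def by (rule Kf_closed(4), rule Kf_closed(3), rule hbK) (use that in auto)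
  have "(Delta_T (Suc m) :: 'k U_elem) = finsum U (\<lambda>i. ((- 1) ^ i) \<odot>\<^bsub>U\<^esub> G (hb 0 i)) {..<CARD('k)}"
    by (simp add: Delta_T_def U_H_def U_alg_eq U_gen_eq k[symmetric] dist_gens)
  also have "\<dots> = G (s {..<CARD('k)})"
  proof (rule finsum_eqI)
    have one: "1 \<in> Kf (int (2 * ?q - 1))" by (rule Kf_mono[OF Kf_basic(4)]) simp
    have "G (of_nat 0 * 1) = \<zero>\<^bsub>U\<^esub>"
      using U.smult_l_zero[OF G_closed[OF one]] unfolding G_of_nat[OF one] by (simp only: of_nat_0)
    then show "G (s {}) = \<zero>\<^bsub>U\<^esub>" by (simp only: s_def sum.empty of_nat_0 mult_zero_left)
    show "G (s I) \<in> carrier U" if "I \<subseteq> {..<CARD('k)}" for I by (rule G_closed[OF sK[OF that]])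
    fix i I assume iI: "insert i I \<subseteq> {..<CARD('k)}" "i \<notin> I"
    have i: "i < CARD('k)" and I: "I \<subseteq> {..<CARD('k)}" using iI by auto
    have fin: "finite I" using I finite_subset by blast
    have sgn: "(- 1) ^ i = (of_nat ((CARD('k) - 1) ^ i) :: 'k)"
      using minus_one_power[OF prime_card_CHAR[OF p]] by simp
    have "G (s (insert i I)) = G (of_nat ((CARD('k) - 1) ^ i) * hb 0 i + s I)"
      using fin iI(2) by (simp add: s_def)
    also have "\<dots> = G (of_nat ((CARD('k) - 1) ^ i) * hb 0 i) \<oplus>\<^bsub>U\<^esub> G (s I)"
      by (rule G_add[OF Kf_closed(3)[OF hbK[OF i]] sK[OF I]])
    also have "G (of_nat ((CARD('k) - 1) ^ i) * hb 0 i) = (- 1) ^ i \<odot>\<^bsub>U\<^esub> G (hb 0 i)"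
      unfolding sgn by (rule G_of_nat[OF hbK[OF i]])
    finally show "(- 1) ^ i \<odot>\<^bsub>U\<^esub> G (hb 0 i) \<oplus>\<^bsub>U\<^esub> G (s I) = G (s (insert i I))" by simp
  qed simp
  finally show ?thesis by (simp add: s_def H_sum_def U_gen_eq)
qed

text \<open>Covers E and F at once: \<sigma> is \<open>coord_t\<close> for the former and its
  inverse for the latter. One path is a composite computed globally; the Garnier map is known
  through its chart formulas only, so the other path is evaluated near each point.\<close>

lemma diagram_on_generator:
  assumes odd: "CARD('k) > 2" and \<rho>: "is_rho (\<rho> :: sl2_free set set \<Rightarrow> 'k operator)"
    and \<rho>m: "is_rho_level \<rho> m \<rho>m" and \<rho>m': "is_rho_level \<rho> (Suc m) \<rho>m'"
    and \<gamma>: "is_garnier m \<gamma>"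
    and q: "q = CARD('k) ^ m" and i: "i \<le> q" and \<sigma>: "\<sigma> \<in> coords"
    and e: "e \<in> Kf (int i)" "\<rho> (dist_of k e) = hasse \<sigma> i"
    and e': "e' \<in> Kf (int (i * CARD('k)))" "\<rho> (dist_of k e') = hasse \<sigma> (i * CARD('k))"
    and \<phi>: "\<phi> (U_gen m (dist_of k e)) = U_gen (Suc m) (dist_of k e') \<otimes>\<^bsub>U_alg (Suc m)\<^esub> Delta_T (Suc m)"
  shows "\<rho>m' (\<phi> (U_gen m (dist_of k e))) = \<gamma> (\<rho>m (U_gen m (dist_of k e)))"
proof -
  let ?p = "CARD('k)" and ?q = "CARD('k) ^ Suc m"
  let ?D = "dwork_op coord_t :: 'k operator"
  interpret M: U_level k m q by unfold_locales (rule q)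
  interpret M': U_level k "Suc m" ?q by unfold_locales simp
  have t: "coord_t \<in> (coords :: 'k ratfun set)" by (simp add: coords_def)
  have pq: "?p \<le> ?q" and ipq: "i * ?p \<le> ?q" using p_pos i by (simp_all add: q mult.commute)
  have eK: "e \<in> Kf (int (2 * q - 1))" using M.q_pos i by (intro Kf_mono[OF e(1)]) linarith
  have e'K: "e' \<in> Kf (int (2 * ?q - 1))" using M'.q_pos ipq by (intro Kf_mono[OF e'(1)]) linarith
  have HK: "H_sum ?p \<in> Kf (int (2 * ?q - 1))" using M'.q_pos pq by (intro Kf_mono[OF Kf_H_sum]) linarith
  have lhs: "\<rho>m' (\<phi> (U_gen m (dist_of k e))) = Dm_of (Suc m) P1 (hasse \<sigma> (i * ?p) \<circ> ?D)"
  proof -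
    have "\<rho>m' (\<phi> (U_gen m (dist_of k e))) = Dm_of (Suc m) P1 (\<rho> (dist_of k e')) \<otimes>\<^bsub>Dm_sections (Suc m) P1\<^esub> Dm_of (Suc m) P1 (\<rho> (dist_of k (H_sum ?p)))"
      unfolding \<phi> Delta_T_eq
      using is_rho_level_simps(1)[OF \<rho>m' refl] is_rho_level_simps(4)[OF \<rho>m' refl] e'K HK M'.G_closed
      by (simp only: M'.U_alg_eq M'.U_gen_eq)
    also have "\<dots> = Dm_of (Suc m) P1 (hasse \<sigma> (i * ?p)) \<otimes>\<^bsub>Dm_sections (Suc m) P1\<^esub> Dm_of (Suc m) P1 ?D"
      by (simp only: e'(2) rho_H_sum[OF odd \<rho>])
    also have "\<dots> = Dm_of (Suc m) P1 (hasse \<sigma> (i * ?p) \<circ> ?D)"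
    proof (rule Dm_of_mult[OF refl opens_P1])
      fix x :: "'k point" assume x: "x \<in> P1"
      show "hasse \<sigma> (i * ?p) \<in> stalk_filt x ?q"
        by (rule stalk_filt_mono[OF ipq hasse_stalk[OF x \<sigma>]])
      show "?D \<in> stalk_filt x (?q - 1)"
        by (rule dwork_op_stalk[OF x t]) (use pq in linarith)
    qed
    finally show ?thesis .
  qed
  define P where "P = \<rho>m (U_gen m (dist_of k e))"
  have P: "P = Dm_of m P1 (hasse \<sigma> i)"
    unfolding P_def using is_rho_level_simps(4)[OF \<rho>m q eK] e(2) by simp
  have P_carrier: "P \<in> carrier (Dm_sections m P1)"
    unfolding P_def by (rule is_rho_level_simps(3)[OF \<rho>m q]) (simp only: M.U_alg_eq M.U_gen_eq M.G_closed[OF eK])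
  have \<gamma>_carrier: "\<gamma> P \<in> carrier (Dm_sections (Suc m) P1)"
    using \<gamma> P_carrier by (auto simp: is_garnier_def nonunital_ring_hom_def)
  have "\<gamma> P = Dm_of (Suc m) P1 (hasse \<sigma> (i * ?p) \<circ> ?D)"
  proof (rule extensionalityI)
    show "\<gamma> P \<in> extensional P1" by (rule Dm_carrier_extensional[OF \<gamma>_carrier])
    show "Dm_of (Suc m) P1 (hasse \<sigma> (i * ?p) \<circ> ?D) \<in> extensional P1" by (simp add: Dm_of_def)
    fix x :: "'k point" assume x: "x \<in> P1"
    obtain \<tau> where \<tau>: "\<tau> \<in> coords" "x \<in> chart \<tau>" using x by (auto simp: P1_def)
    have sub: "chart \<tau> \<subseteq> P1" using \<tau> by (auto simp: P1_def)
    \<comment> \<open>The chart around x may belong to the other coordinate, which is why the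
      derivation must be re-expanded in \<tau> before the Garnier formula can be applied.\<close>
    obtain f where f: "\<And>l. l \<le> i \<Longrightarrow> f l \<in> chart_ring \<tau>" "hasse \<sigma> i = (\<lambda>g. \<Sum>l\<le>i. f l * hasse \<tau> l g)"
      using hasse_expansion[OF \<tau>(1) \<sigma>] by blast
    have "restrict P (chart \<tau>) = Dm_of m (chart \<tau>) (hasse \<sigma> i)"
      using sub by (auto simp: P Dm_of_def restrict_def fun_eq_iff)
    also have "\<dots> = chart_expansion m \<tau> i f"
      using chart_expansion_eq[OF q \<tau>(1) i f(1)] f(2) by simp
    finally have "restrict (\<gamma> P) (chart \<tau>) = garnier_expansion m \<tau> i f"
      using \<gamma> P_carrier \<tau>(1) f(1) unfolding is_garnier_def by blast
    also have "\<dots> = Dm_of (Suc m) (chart \<tau>) (hasse \<sigma> (i * ?p) \<circ> dwork_op \<tau>)"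
      by (rule garnier_expansion_eq[OF \<tau>(1) \<sigma> i[unfolded q] f])
    also have "dwork_op \<tau> = ?D" by (rule dwork_op_eq[OF \<tau>(1) t])
    finally have "restrict (\<gamma> P) (chart \<tau>) x = Dm_of (Suc m) (chart \<tau>) (hasse \<sigma> (i * ?p) \<circ> ?D) x"
      by (rule fun_cong)
    then show "\<gamma> P x = Dm_of (Suc m) P1 (hasse \<sigma> (i * ?p) \<circ> ?D) x"
      using x \<tau> by (simp add: Dm_of_def)
  qed
  then show ?thesis using lhs by (simp add: P_def)
qed

lemma diagram_commutes:
  assumes odd: "CARD('k) > 2" and \<rho>: "is_rho (\<rho> :: sl2_free set set \<Rightarrow> 'k operator)"
    and \<rho>m: "is_rho_level \<rho> m \<rho>m" and \<rho>m': "is_rho_level \<rho> (Suc m) \<rho>m'"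
    and \<phi>: "is_phi m \<phi>" and \<gamma>: "is_garnier m \<gamma>"
    and u: "u \<in> carrier (U_alg m)"
  shows "\<rho>m' (\<phi> u) = \<gamma> (\<rho>m u)"
proof -
  let ?p = "CARD('k)"
  define q where "q = ?p ^ m"
  interpret M: U_level k m q by unfold_locales (rule q_def)
  note r = is_rho_level_simps[OF \<rho>m q_def, unfolded M.U_alg_eq]
    and r' = is_rho_level_simps[OF \<rho>m' refl]
  have \<phi>_hom: "\<phi> \<in> nonunital_alg_hom M.U (U_alg (Suc m))" using \<phi> by (simp add: is_phi_def Let_def M.U_alg_eq)
  have \<phi>_closed: "\<phi> x \<in> carrier (U_alg (Suc m))" if "x \<in> carrier M.U" for x
    using \<phi>_hom that by (auto simp: nonunital_alg_hom_def nonunital_ring_hom_def)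
  have \<phi>_add: "\<phi> (x \<oplus>\<^bsub>M.U\<^esub> y) = \<phi> x \<oplus>\<^bsub>U_alg (Suc m)\<^esub> \<phi> y" and \<phi>_mult: "\<phi> (x \<otimes>\<^bsub>M.U\<^esub> y) = \<phi> x \<otimes>\<^bsub>U_alg (Suc m)\<^esub> \<phi> y"
    if "x \<in> carrier M.U" "y \<in> carrier M.U" for x y
    using \<phi>_hom that by (auto simp: nonunital_alg_hom_def nonunital_ring_hom_def)
  have \<gamma>_add: "\<gamma> (s \<oplus>\<^bsub>Dm_sections m P1\<^esub> s') = \<gamma> s \<oplus>\<^bsub>Dm_sections (Suc m) P1\<^esub> \<gamma> s'"
    and \<gamma>_mult: "\<gamma> (s \<otimes>\<^bsub>Dm_sections m P1\<^esub> s') = \<gamma> s \<otimes>\<^bsub>Dm_sections (Suc m) P1\<^esub> \<gamma> s'"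
    if "s \<in> carrier (Dm_sections m P1)" "s' \<in> carrier (Dm_sections m P1)" for s s'
    using \<gamma> that by (auto simp: is_garnier_def nonunital_ring_hom_def)
  have add: "\<rho>m' (\<phi> (x \<oplus>\<^bsub>M.U\<^esub> y)) = \<gamma> (\<rho>m (x \<oplus>\<^bsub>M.U\<^esub> y))"
    if "x \<in> carrier M.U" "y \<in> carrier M.U" "\<rho>m' (\<phi> x) = \<gamma> (\<rho>m x)" "\<rho>m' (\<phi> y) = \<gamma> (\<rho>m y)" for x y
    using that by (simp only: \<phi>_add r'(2) \<phi>_closed r(2,3) \<gamma>_add)
  from u have "u \<in> carrier M.U" by (simp only: M.U_alg_eq)
  then show ?thesis
  proof (rule M.E_F_generate_induct[where P = "\<lambda>u. \<rho>m' (\<phi> u) = \<gamma> (\<rho>m u)"])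
    show "\<rho>m' (\<phi> (x \<oplus>\<^bsub>M.U\<^esub> y)) = \<gamma> (\<rho>m (x \<oplus>\<^bsub>M.U\<^esub> y))"
      if "x \<in> carrier M.U" "y \<in> carrier M.U" "\<rho>m' (\<phi> x) = \<gamma> (\<rho>m x)" "\<rho>m' (\<phi> y) = \<gamma> (\<rho>m y)" for x y
      by (rule add[OF that])
    show "\<rho>m' (\<phi> (x \<otimes>\<^bsub>M.U\<^esub> y)) = \<gamma> (\<rho>m (x \<otimes>\<^bsub>M.U\<^esub> y))"
      if "x \<in> carrier M.U" "y \<in> carrier M.U" "\<rho>m' (\<phi> x) = \<gamma> (\<rho>m x)" "\<rho>m' (\<phi> y) = \<gamma> (\<rho>m y)" for x y
      using that by (simp only: \<phi>_mult r'(1) \<phi>_closed r(1,3) \<gamma>_mult)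
    show "\<rho>m' (\<phi> (c \<odot>\<^bsub>M.U\<^esub> x)) = \<gamma> (\<rho>m (c \<odot>\<^bsub>M.U\<^esub> x))"
      if x: "x \<in> carrier M.U" "\<rho>m' (\<phi> x) = \<gamma> (\<rho>m x)" for c x
    proof -
      \<comment> \<open>The Garnier map is a ring morphism without a rule for scalars, so scalars
        act by repeated addition. Adding p to a representative makes it positive, and the induction
        can start at 1 instead of 0.\<close>
      have *: "\<rho>m' (\<phi> (of_nat (Suc n) \<odot>\<^bsub>M.U\<^esub> x)) = \<gamma> (\<rho>m (of_nat (Suc n) \<odot>\<^bsub>M.U\<^esub> x))" for n
      proof (induction n)
        case 0
        show ?case using x by simp
      next
        case (Suc n)
        have "of_nat (Suc (Suc n)) \<odot>\<^bsub>M.U\<^esub> x = of_nat (Suc n) \<odot>\<^bsub>M.U\<^esub> x \<oplus>\<^bsub>M.U\<^esub> x"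
          using M.U.smult_l_distr[OF x(1), of "of_nat (Suc n)" 1] x(1) by (simp add: add.commute)
        then show ?case using add[OF M.U.smult_closed[OF x(1)] x(1) Suc x(2)] by simp
      qed
      obtain n where "c = of_nat n" using of_nat_surj_card[OF p] by metis
      moreover have "(of_nat ?p :: 'k) = 0" using of_nat_eq_0_iff_card[OF p] by simp
      moreover have "Suc (n + (?p - 1)) = n + ?p" using p_pos by simp
      ultimately have "c = of_nat (Suc (n + (?p - 1)))" by (simp only: of_nat_add) simp
      then show ?thesis by (simp only: *)
    qed
    have phi_gens: "\<phi> (U_E m i) = U_E (Suc m) (i * ?p) \<otimes>\<^bsub>U_alg (Suc m)\<^esub> Delta_T (Suc m)"
      "\<phi> (U_F m i) = U_F (Suc m) (i * ?p) \<otimes>\<^bsub>U_alg (Suc m)\<^esub> Delta_T (Suc m)" if "i \<le> q" for i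
      using \<phi> that by (simp_all add: is_phi_def Let_def q_def)
    note gens = phi_gens[unfolded U_E_def U_F_def k[symmetric] dist_gens]
    have t: "coord_t \<in> (coords :: 'k ratfun set)" "inverse coord_t \<in> (coords :: 'k ratfun set)" by (simp_all add: coords_def)
    show "\<rho>m' (\<phi> (M.G (dE i))) = \<gamma> (\<rho>m (M.G (dE i)))" if "i \<le> q" for i
      using diagram_on_generator[where \<phi> = \<phi> and e = "dE i" and e' = "dE (i * ?p)", OF odd \<rho> \<rho>m \<rho>m' \<gamma> q_def that t(1) Kf_basic(1) rho_simps(6)[OF \<rho>] Kf_basic(1) rho_simps(6)[OF \<rho>] gens(1)[OF that]]
      by (simp only: M.U_gen_eq)
    show "\<rho>m' (\<phi> (M.G (dF i))) = \<gamma> (\<rho>m (M.G (dF i)))" if "i \<le> q" for i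
      using diagram_on_generator[where \<phi> = \<phi> and e = "dF i" and e' = "dF (i * ?p)", OF odd \<rho> \<rho>m \<rho>m' \<gamma> q_def that t(2) Kf_basic(2) rho_simps(7)[OF \<rho>] Kf_basic(2) rho_simps(7)[OF \<rho>] gens(2)[OF that]]
      by (simp only: M.U_gen_eq)
  qed
qed

end

theorem proposition3p2p2:
  fixes m :: nat
    and \<rho> :: "sl2_free set set \<Rightarrow> 'k::{field,finite} operator"
    and \<rho>m \<rho>m' :: "'k U_elem \<Rightarrow> 'k point \<Rightarrow> 'k D_germ"
    and \<phi> :: "'k U_elem \<Rightarrow> 'k U_elem"
    and \<gamma> :: "('k point \<Rightarrow> 'k D_germ) \<Rightarrow> 'k point \<Rightarrow> 'k D_germ"
  assumes "Factorial_Ring.prime CARD('k)" and "CARD('k) > 2"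
    and "is_rho \<rho>"
    and "is_rho_level \<rho> m \<rho>m"
    and "is_rho_level \<rho> (Suc m) \<rho>m'"
    and "is_phi m \<phi>"
    and "is_garnier m \<gamma>"
  shows "\<forall>u\<in>carrier (U_alg m). \<rho>m' (\<phi> u) = \<gamma> (\<rho>m u)"
proof
  interpret prime_card "TYPE('k)" by unfold_locales (rule assms(1), rule refl)
  fix u :: "'k U_elem" assume "u \<in> carrier (U_alg m)"
  then show "\<rho>m' (\<phi> u) = \<gamma> (\<rho>m u)" by (rule diagram_commutes[OF assms(2-7)])
qed

end
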